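(* Let $A$ be an abelian group of odd order with at most two generators, equipped with a non-degenerate symmetric (bilinear) pairing $\ell\colon A\times A\to\mathbb{Q}/\mathbb{Z}$. Then $(A,\ell)$ decomposes as an orthogonal sum of two subgroups generated cyclically by $g_1,g_2$, which are of respective order $q_1$ and $q_2$ with $q_1\mid q_2$ and odd $q_1,q_2\ge1$. Let $\frac{a_i}{q_i}=\ell(g_i,g_i)\in\mathbb{Q}/\mathbb{Z}$ with $a_i\in\mathbb{Z}$. Then $a_i$ and $q_i$ are coprime, and for a given $u\in\{-1,1\}$ the following statements (A) and (B) are equivalent: (A) $\ell$ can be presented by an odd symmetric $2\times2$ integer matrix $M$ with $\det M\equiv u\pmod 4$. (B) $a_1,a_2,q_1,q_2,u$ satisfy both of the following two conditions: (B1) $(-1)^{(q_1q_2-u)/2}a_1a_2$ is a quadratic residue modulo $q_1$; (B2) $u=1$, or $q_1q_2\equiv3\pmod4$, or the Jacobi symbol $\left(\frac{a_2}{q_2/q_1}\right)$ equals $1$. Moreover, although $a_1,a_2\in\mathbb{Z}$ are not uniquely determined, whether statement (B) holds does not depend on the choice of $a_1,a_2$.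
   Context: A pairing $\ell$ is non-degenerate if for every $x\in A\setminus\{0\}$ there is $y\in A$ with $\ell(x,y)\ne0$. A symmetric integer matrix $M$ of size $n$ with $\det M\ne0$ presents a symmetric pairing $\ell\colon A\times A\to\mathbb{Q}/\mathbb{Z}$ if $\ell$ is isometric to $\ell_M\colon\mathbb{Z}^n/M\mathbb{Z}^n\times\mathbb{Z}^n/M\mathbb{Z}^n\to\mathbb{Q}/\mathbb{Z}$, $(x,y)\mapsto x^{\top}M^{-1}y+\mathbb{Z}$, i.e. there is a group isomorphism $A\to\mathbb{Z}^n/M\mathbb{Z}^n$ carrying $\ell$ to $\ell_M$. A symmetric integer matrix is odd if at least one of its diagonal entries is odd. An integer is a quadratic residue modulo $q$ if it is congruent to a square modulo $q$ (everything is a quadratic residue modulo $1$). The Jacobi symbol $\left(\frac{x}{y}\right)$ for $y$ odd and positive is the usual one, with $\left(\frac{x}{1}\right)=1$. *)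

theory Defs
  imports
    "HOL-Analysis.Determinants"
    "HOL-Number_Theory.Residues"
    "HOL-Algebra.Generated_Groups"
    "HOL-Algebra.Multiplicative_Group"
begin

section \<open>The group \<open>\<rat>/\<int>\<close>\<close>

quotient_type rat_mod_int = rat / "\<lambda>x y. x - y \<in> \<int>"
  morphisms rep_rat_mod_int rat_class
proof (rule equivpI)
  show "reflp (\<lambda>x y :: rat. x - y \<in> \<int>)"
    by (simp add: reflp_def)
  show "symp (\<lambda>x y :: rat. x - y \<in> \<int>)"
    by (metis (mono_tags, lifting) Ints_minus minus_diff_eq sympI)
  show "transp (\<lambda>x y :: rat. x - y \<in> \<int>)"
    by (rule transpI) (metis Ints_add diff_add_cancel add_diff_eq)
qed

instantiation rat_mod_int :: ab_group_add
begin

lift_definition zero_rat_mod_int :: rat_mod_int is 0 .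

lift_definition plus_rat_mod_int :: "rat_mod_int \<Rightarrow> rat_mod_int \<Rightarrow> rat_mod_int" is "(+)"
  by (metis Ints_add add_diff_add)

lift_definition uminus_rat_mod_int :: "rat_mod_int \<Rightarrow> rat_mod_int" is uminus
  by (metis Ints_minus minus_diff_minus)

lift_definition minus_rat_mod_int :: "rat_mod_int \<Rightarrow> rat_mod_int \<Rightarrow> rat_mod_int" is "(-)"
  by (metis Ints_diff diff_diff_eq2 diff_diff_add add_diff_eq add.commute diff_add_eq)

instance
  by standard (transfer; simp add: algebra_simps)+

end

lemma rat_class_eq_iff: "rat_class x = rat_class y \<longleftrightarrow> x - y \<in> \<int>"
  by (rule rat_mod_int.abs_eq_iff)


section \<open>Pairings on abelian groups\<close>

text \<open>Groups are written multiplicatively, as in HOL-Algebra; the target \<open>\<rat>/\<int>\<close> is written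
  additively. Only the values of a pairing on the carrier matter.\<close>

definition bilinear_pairing ::
    "('a, 'm) monoid_scheme \<Rightarrow> ('a \<Rightarrow> 'a \<Rightarrow> rat_mod_int) \<Rightarrow> bool" where
  "bilinear_pairing G l \<longleftrightarrow>
     (\<forall>x\<in>carrier G. \<forall>y\<in>carrier G. \<forall>z\<in>carrier G.
        l (x \<otimes>\<^bsub>G\<^esub> y) z = l x z + l y z \<and> l x (y \<otimes>\<^bsub>G\<^esub> z) = l x y + l x z)"

definition symmetric_pairing ::
    "('a, 'm) monoid_scheme \<Rightarrow> ('a \<Rightarrow> 'a \<Rightarrow> rat_mod_int) \<Rightarrow> bool" where
  "symmetric_pairing G l \<longleftrightarrow> (\<forall>x\<in>carrier G. \<forall>y\<in>carrier G. l x y = l y x)"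

definition nondegenerate_pairing ::
    "('a, 'm) monoid_scheme \<Rightarrow> ('a \<Rightarrow> 'a \<Rightarrow> rat_mod_int) \<Rightarrow> bool" where
  "nondegenerate_pairing G l \<longleftrightarrow> (\<forall>x\<in>carrier G - {\<one>\<^bsub>G\<^esub>}. \<exists>y\<in>carrier G. l x y \<noteq> 0)"

definition isometric_pairings ::
    "('a, 'm) monoid_scheme \<Rightarrow> ('a \<Rightarrow> 'a \<Rightarrow> rat_mod_int) \<Rightarrow>
     ('b, 'n) monoid_scheme \<Rightarrow> ('b \<Rightarrow> 'b \<Rightarrow> rat_mod_int) \<Rightarrow> bool" where
  "isometric_pairings G l H l' \<longleftrightarrow>
     (\<exists>\<phi>\<in>iso G H. \<forall>x\<in>carrier G. \<forall>y\<in>carrier G. l' (\<phi> x) (\<phi> y) = l x y)"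

definition orthogonal_sum ::
    "('a, 'm) monoid_scheme \<Rightarrow> ('a \<Rightarrow> 'a \<Rightarrow> rat_mod_int) \<Rightarrow> 'a set \<Rightarrow> 'a set \<Rightarrow> bool" where
  "orthogonal_sum G l H K \<longleftrightarrow>
     subgroup H G \<and> subgroup K G \<and> H \<inter> K = {\<one>\<^bsub>G\<^esub>} \<and> H <#>\<^bsub>G\<^esub> K = carrier G \<and>
     (\<forall>x\<in>H. \<forall>y\<in>K. l x y = 0)"

definition orthogonal_cyclic_decomposition ::
    "('a, 'm) monoid_scheme \<Rightarrow> ('a \<Rightarrow> 'a \<Rightarrow> rat_mod_int) \<Rightarrow> 'a \<Rightarrow> nat \<Rightarrow> 'a \<Rightarrow> nat \<Rightarrow> bool" where
  "orthogonal_cyclic_decomposition G l g1 q1 g2 q2 \<longleftrightarrow>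
     g1 \<in> carrier G \<and> g2 \<in> carrier G \<and>
     orthogonal_sum G l (generate G {g1}) (generate G {g2}) \<and>
     group.ord G g1 = q1 \<and> group.ord G g2 = q2 \<and>
     q1 \<ge> 1 \<and> q2 \<ge> 1 \<and> odd q1 \<and> odd q2 \<and> q1 dvd q2"


section \<open>Presentation of pairings by symmetric integer matrices\<close>

definition int_vec_group :: "(int ^ 'n) monoid" where
  "int_vec_group = \<lparr>carrier = UNIV, mult = (+), one = 0\<rparr>"

definition cokernel :: "int ^ 'n ^ 'n \<Rightarrow> (int ^ 'n) set monoid" where
  "cokernel M = int_vec_group Mod (range (\<lambda>v. M *v v))"

definition inverse_form :: "int ^ 'n ^ 'n \<Rightarrow> int ^ 'n \<Rightarrow> int ^ 'n \<Rightarrow> rat" where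
  "inverse_form M x y =
     (\<Sum>i\<in>UNIV. of_int (x $ i) *
        (matrix_inv (map_matrix of_int M :: rat ^ 'n ^ 'n) *v (\<chi> j. of_int (y $ j))) $ i)"

text \<open>The pairing on cosets is evaluated on chosen representatives; for symmetric \<open>M\<close> with non-zero
  determinant the choice is irrelevant, see \<open>matrix_pairing_coset\<close> below.\<close>

definition matrix_pairing :: "int ^ 'n ^ 'n \<Rightarrow> (int ^ 'n) set \<Rightarrow> (int ^ 'n) set \<Rightarrow> rat_mod_int" where
  "matrix_pairing M X Y = rat_class (inverse_form M (SOME x. x \<in> X) (SOME y. y \<in> Y))"

definition presents ::
    "int ^ 'n ^ 'n \<Rightarrow> ('a, 'm) monoid_scheme \<Rightarrow> ('a \<Rightarrow> 'a \<Rightarrow> rat_mod_int) \<Rightarrow> bool" where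
  "presents M G l \<longleftrightarrow>
     transpose M = M \<and> det M \<noteq> 0 \<and> isometric_pairings G l (cokernel M) (matrix_pairing M)"

definition odd_matrix :: "int ^ 'n ^ 'n \<Rightarrow> bool" where
  "odd_matrix M \<longleftrightarrow> (\<exists>i. odd (M $ i $ i))"

lemma det_map_of_int:
  "det (map_matrix of_int M :: 'a::comm_ring_1 ^ 'n ^ 'n) = of_int (det (M :: int ^ 'n ^ 'n))"
  by (simp add: det_def)

lemma invertible_matrix_inv:
  assumes "invertible R"
  shows "R ** matrix_inv R = mat 1" "matrix_inv R ** R = mat 1"
  using someI_ex[OF assms[unfolded invertible_def]] by (simp_all add: matrix_inv_def)

lemma inverse_form_commute:
  fixes M :: "int ^ 'n ^ 'n"
  assumes "transpose M = M" "det M \<noteq> 0"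
  shows "inverse_form M x y = inverse_form M y x"
proof -
  define R where "R = (map_matrix of_int M :: rat ^ 'n ^ 'n)"
  define N where "N = matrix_inv R"
  have "invertible R"
    using assms(2) by (simp add: R_def invertible_det_nz det_map_of_int)
  then have inv: "R ** N = mat 1" "N ** R = mat 1"
    by (simp_all add: N_def invertible_matrix_inv)
  have "transpose R = R"
    using assms(1) by (simp add: R_def transpose_def vec_eq_iff)
  then have "R ** transpose N = mat 1"
    by (metis inv(2) matrix_transpose_mul transpose_mat)
  then have "transpose N = N"
    by (metis inv(2) matrix_mul_assoc matrix_mul_lid matrix_mul_rid)
  then have sym: "N $ i $ j = N $ j $ i" for i j
    by (metis transpose_def vec_lambda_beta)
  have form: "inverse_form M x y = (\<Sum>i\<in>UNIV. \<Sum>j\<in>UNIV. of_int (x $ i) * (N $ i $ j * of_int (y $ j)))" for x y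
    by (simp add: inverse_form_def N_def R_def matrix_vector_mult_def sum_distrib_left)
  show ?thesis
    unfolding form[of x y] form[of y x]
    by (subst sum.swap) (intro sum.cong refl, metis sym mult.assoc mult.commute)
qed

lemma inverse_form_shift:
  fixes M :: "int ^ 'n ^ 'n"
  assumes "det M \<noteq> 0"
  shows "inverse_form M x (y + M *v w) = inverse_form M x y + of_int (\<Sum>i\<in>UNIV. x $ i * w $ i)"
proof -
  define R where "R = (map_matrix of_int M :: rat ^ 'n ^ 'n)"
  define N where "N = matrix_inv R"
  have "invertible R"
    using assms by (simp add: R_def invertible_det_nz det_map_of_int)
  then have inv: "N ** R = mat 1"
    by (simp add: N_def invertible_matrix_inv)
  have "(\<chi> j. of_int ((y + M *v w) $ j)) = (\<chi> j. of_int (y $ j)) + R *v (\<chi> j. of_int (w $ j))"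
    by (simp add: vec_eq_iff R_def matrix_vector_mult_def)
  then have "N *v (\<chi> j. of_int ((y + M *v w) $ j)) = N *v (\<chi> j. of_int (y $ j)) + (\<chi> j. of_int (w $ j))"
    by (simp add: matrix_vector_right_distrib matrix_vector_mul_assoc inv)
  then show ?thesis
    by (simp add: inverse_form_def N_def R_def distrib_left sum.distrib)
qed

lemma matrix_pairing_coset:
  fixes M :: "int ^ 'n ^ 'n"
  assumes "transpose M = M" "det M \<noteq> 0"
  shows "matrix_pairing M (range (\<lambda>v. M *v v) #>\<^bsub>int_vec_group\<^esub> x)
           (range (\<lambda>v. M *v v) #>\<^bsub>int_vec_group\<^esub> y) = rat_class (inverse_form M x y)"
proof -
  let ?c = "\<lambda>x. range (\<lambda>v. M *v v) #>\<^bsub>int_vec_group\<^esub> x"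
  have ex: "\<exists>v. (SOME z. z \<in> ?c x) = x + M *v v" for x
  proof -
    have "x \<in> ?c x"
      by (auto simp: r_coset_def int_vec_group_def intro!: exI[of _ 0])
    then have "(SOME z. z \<in> ?c x) \<in> ?c x"
      by (rule someI)
    then show ?thesis
      by (auto simp: r_coset_def int_vec_group_def add.commute)
  qed
  obtain v w where v: "(SOME z. z \<in> ?c x) = x + M *v v" and w: "(SOME z. z \<in> ?c y) = y + M *v w"
    using ex by meson
  have "inverse_form M (x + M *v v) (y + M *v w) - inverse_form M x y \<in> \<int>"
    by (simp add: inverse_form_shift[OF assms(2)] inverse_form_commute[OF assms, of "x + M *v v"]
        inverse_form_commute[OF assms, of y x] del: of_int_sum)
  then show ?thesis
    unfolding matrix_pairing_def v w by (simp add: rat_class_eq_iff)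
qed


section \<open>The arithmetic condition\<close>

definition Jacobi :: "int \<Rightarrow> nat \<Rightarrow> int" where
  "Jacobi a n = (\<Prod>p\<in>#prime_factorization n. Legendre a (int p))"

definition self_pairing_numerators ::
    "('a \<Rightarrow> 'a \<Rightarrow> rat_mod_int) \<Rightarrow> 'a \<Rightarrow> nat \<Rightarrow> 'a \<Rightarrow> nat \<Rightarrow> int \<Rightarrow> int \<Rightarrow> bool" where
  "self_pairing_numerators l g1 q1 g2 q2 a1 a2 \<longleftrightarrow>
     l g1 g1 = rat_class (of_int a1 / of_nat q1) \<and> l g2 g2 = rat_class (of_int a2 / of_nat q2)"

text \<open>For odd \<open>q1, q2 \<ge> 1\<close> and \<open>u \<in> {-1, 1}\<close> the exponent in \<open>condition_B1\<close> is exact and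
  non-negative, and for \<open>q1 dvd q2\<close> the quotient in \<open>condition_B2\<close> is exact.\<close>

definition condition_B1 :: "int \<Rightarrow> int \<Rightarrow> nat \<Rightarrow> nat \<Rightarrow> int \<Rightarrow> bool" where
  "condition_B1 a1 a2 q1 q2 u \<longleftrightarrow>
     QuadRes (int q1) ((-1) ^ nat ((int (q1 * q2) - u) div 2) * a1 * a2)"

definition condition_B2 :: "int \<Rightarrow> nat \<Rightarrow> nat \<Rightarrow> int \<Rightarrow> bool" where
  "condition_B2 a2 q1 q2 u \<longleftrightarrow>
     u = 1 \<or> [q1 * q2 = 3] (mod 4) \<or> Jacobi a2 (q2 div q1) = 1"

definition condition_B :: "int \<Rightarrow> int \<Rightarrow> nat \<Rightarrow> nat \<Rightarrow> int \<Rightarrow> bool" where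
  "condition_B a1 a2 q1 q2 u \<longleftrightarrow> condition_B1 a1 a2 q1 q2 u \<and> condition_B2 a2 q1 q2 u"

end

theory Submission
  imports Defs "HOL-Number_Theory.Number_Theory" "HOL-Computational_Algebra.Squarefree"
    "HOL-Analysis.Harmonic_Numbers"
begin

text \<open>
  Write \<open>n = q2 div q1\<close>. A symmetric \<open>2 \<times> 2\<close> matrix \<open>M\<close> that presents the pairing is \<open>q1\<close> times a
  primitive matrix \<open>M'\<close>, and \<open>det M = \<epsilon> q1 q2\<close> with a sign \<open>\<epsilon>\<close> that is determined by \<open>det M\<close> modulo 4
  (\<open>sign_exponent\<close>). The pairing on the cokernel is then \<open>\<epsilon> N (x, y) / q2\<close> with the integral
  form \<open>N\<close> adjoint to \<open>M'\<close>, of determinant \<open>\<epsilon> n\<close>. So the question is which forms \<open>N\<close> of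
  determinant \<open>\<epsilon> n\<close>, multiplied by \<open>\<epsilon>\<close>, become diagonal with entries \<open>n a1\<close> and \<open>a2\<close> modulo \<open>q2\<close>.

  From (A) to (B): comparing determinants modulo \<open>q2\<close> in both directions yields the shape of \<open>M\<close> and
  the fact that \<open>\<epsilon> a1 a2\<close> is a square modulo \<open>q1\<close>, which is (B1) (\<open>presentation_invariants\<close>). If \<open>u = -1\<close>
  and \<open>q1 q2\<close> is not 3 modulo 4, then \<open>\<epsilon> = -1\<close> and \<open>n\<close> is 1 modulo 4. The number \<open>-a2\<close> is congruent to a value
  of \<open>N\<close>. Such a value can be taken odd since \<open>N\<close> is an odd form, and after division by a square
  it is primitively represented by \<open>N\<close>. Then \<open>n\<close>, which is minus the determinant of \<open>N\<close>, is a square modulo this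
  value, and quadratic reciprocity shows that its Jacobi symbol over \<open>n\<close> is 1. This is (B2) (\<open>Jacobi_form_value\<close>).

  From (B) to (A): it suffices to find an odd integer \<open>r\<close> that is congruent to \<open>\<epsilon> a2\<close> times a square
  modulo \<open>q2\<close> and modulo which \<open>-\<epsilon> n\<close> is a square. Indeed, then \<open>r c - b\<^sup>2 = \<epsilon> n\<close> has a solution, the form
  \<open>[[r, b], [b, c]]\<close> can be taken for \<open>N\<close>, and (B1) takes care of the orthogonal complement of the first unit
  vector (\<open>presentation_of_conditions\<close>). Dirichlet's theorem on primes in arithmetic progressions
  would provide a prime \<open>r\<close> by reciprocity, but less is needed. The residue symbol of
  \<open>-\<epsilon> n\<close> is a product \<open>\<chi>\<close> of the quadratic characters modulo \<open>4 q2\<close>, and it is enough to find a number \<open>m\<close> with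
  given values of these characters, whose product \<open>\<chi> m\<close> is 1, such that the primes with odd
  multiplicity in \<open>m\<close> have \<open>\<chi> p = 1\<close>: the squarefree part of \<open>m\<close> is then a suitable \<open>r\<close>, up to sign
  (\<open>exists_representing_coefficient\<close>). For \<open>m\<close> coprime to \<open>4 q2\<close>, let \<open>f m\<close> be the
  sum of \<open>\<chi>\<close> over the divisors of \<open>m\<close>. It is nonnegative, at least 1 at squares, and positive only if \<open>m\<close> has the required
  prime factors. The squares alone show that the sum of \<open>f m / sqrt m\<close> diverges.
  If it is twisted by a quadratic character \<open>\<psi>\<close> other than the principal one and \<open>\<chi>\<close>, then \<open>\<psi> f\<close> is the convolution
  of the two nonprincipal characters \<open>\<psi>\<close> and \<open>\<psi> \<chi>\<close>, and the hyperbola method shows that the sums up to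
  perfect squares stay bounded. Hence the numbers \<open>m\<close> with \<open>f m > 0\<close> cannot avoid a prescribed pattern of
  signs (\<open>exists_prescribed_signs\<close>).

  The orthogonal decomposition is found by choosing an element whose pairing with itself has the
  exponent of the group as denominator. That condition (B) does not depend on the choices follows
  from its equivalence with (A).
\<close>

section \<open>Sums of real characters\<close>

text \<open>Abel's inequality: a decreasing weight costs at most its first value.\<close>

lemma abs_weighted_sum_le:
  fixes F w :: "nat \<Rightarrow> real"
  assumes bound: "\<And>k. m < k \<Longrightarrow> \<bar>\<Sum>i\<in>{m<..k}. F i\<bar> \<le> B"
    and decr: "\<And>k. w (Suc k) \<le> w k" and nonneg: "\<And>k. 0 \<le> w k"
    and "0 \<le> B"
  shows "\<bar>\<Sum>i\<in>{m<..m + d}. F i * w i\<bar> \<le> B * w (Suc m)"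
proof -
  define S where "S k = (\<Sum>i\<in>{m<..k}. F i)" for k
  have S_Suc: "S (Suc k) = S k + F (Suc k)" if "m \<le> k" for k
    using that by (simp add: S_def atLeastSucAtMost_greaterThanAtMost[symmetric])
  have S_bound: "\<bar>S k\<bar> \<le> B" if "m \<le> k" for k
    using bound[of k] that \<open>0 \<le> B\<close> by (cases "m = k") (auto simp: S_def)
  \<comment> \<open>summation by parts\<close>
  have parts: "(\<Sum>i\<in>{m<..m + d}. F i * w i)
      = S (m + d) * w (Suc (m + d)) + (\<Sum>i\<in>{m<..m + d}. S i * (w i - w (Suc i)))" for d
  proof (induction d)
    case 0
    then show ?case by (simp add: S_def)
  next
    case (Suc d)
    have set: "{m<..m + Suc d} = insert (Suc (m + d)) {m<..m + d}"
      by auto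
    show ?case
      unfolding set using Suc S_Suc[of "m + d"] by (simp add: algebra_simps)
  qed
  have tele: "(\<Sum>i\<in>{m<..m + d}. w i - w (Suc i)) = w (Suc m) - w (Suc (m + d))" for d
  proof (induction d)
    case (Suc d)
    have set: "{m<..m + Suc d} = insert (Suc (m + d)) {m<..m + d}"
      by auto
    show ?case
      unfolding set using Suc by simp
  qed simp
  have "\<bar>\<Sum>i\<in>{m<..m + d}. S i * (w i - w (Suc i))\<bar> \<le> (\<Sum>i\<in>{m<..m + d}. B * (w i - w (Suc i)))"
    by (rule order_trans[OF sum_abs], rule sum_mono)
       (use S_bound decr in \<open>auto simp: abs_mult intro!: mult_mono \<open>0 \<le> B\<close>\<close>)
  also have "\<dots> = B * (w (Suc m) - w (Suc (m + d)))"
    by (simp flip: sum_distrib_left add: tele)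
  finally have "\<bar>\<Sum>i\<in>{m<..m + d}. S i * (w i - w (Suc i))\<bar> \<le> B * (w (Suc m) - w (Suc (m + d)))" .
  moreover have "\<bar>S (m + d) * w (Suc (m + d))\<bar> \<le> B * w (Suc (m + d))"
    using S_bound[of "m + d"] nonneg by (simp add: abs_mult mult_right_mono)
  ultimately show ?thesis
    unfolding parts by (simp add: algebra_simps)
qed

lemma sum_inverse_sqrt_le: "(\<Sum>a\<in>{1..y}. 1 / sqrt (real a)) \<le> 2 * sqrt (real y)"
proof (induction y)
  case (Suc y)
  have "1 / sqrt (real (Suc y)) \<le> 2 * (sqrt (real (Suc y)) - sqrt (real y))"
  proof -
    let ?u = "sqrt (real (Suc y))" and ?v = "sqrt (real y)"
    have "?v \<le> ?u" "0 < ?u" by simp_all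
    have "(?u - ?v) * (?u + ?v) = 1"
      by (simp add: algebra_simps)
    then have "1 \<le> (?u - ?v) * (2 * ?u)"
      using mult_left_mono[of "?u + ?v" "2 * ?u" "?u - ?v"] \<open>?v \<le> ?u\<close> by simp
    then show ?thesis
      using \<open>0 < ?u\<close> by (simp add: field_simps)
  qed
  with Suc show ?case by simp
qed simp

text \<open>The sum of \<open>F a * G b / sqrt (a * b)\<close> over the positive lattice points on or below the
  hyperbola \<open>a * b = y\<^sup>2\<close>. Only perfect squares are used as bounds, so that the hyperbola meets
  the diagonal in the lattice point \<open>(y, y)\<close>.\<close>

definition hyperbola_sum :: "(nat \<Rightarrow> real) \<Rightarrow> (nat \<Rightarrow> real) \<Rightarrow> nat \<Rightarrow> real" where
  "hyperbola_sum F G y =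
     (\<Sum>(a, b)\<in>{(a, b). 1 \<le> a \<and> 1 \<le> b \<and> a * b \<le> y\<^sup>2}. F a * G b / sqrt (real (a * b)))"

text \<open>With weight \<open>1 / sqrt (a * b)\<close>, functions with bounded partial sums have bounded
  hyperbola sums: for each \<open>a \<le> y\<close> the tail over \<open>b > y\<close> contributes at most \<open>B / sqrt (a * y)\<close>.\<close>

lemma hyperbola_sum_bounded:
  fixes F G :: "nat \<Rightarrow> real"
  assumes F1: "\<And>a. \<bar>F a\<bar> \<le> 1" and G1: "\<And>a. \<bar>G a\<bar> \<le> 1"
    and FB: "\<And>m k. \<bar>\<Sum>i\<in>{m<..k}. F i\<bar> \<le> B" and GB: "\<And>m k. \<bar>\<Sum>i\<in>{m<..k}. G i\<bar> \<le> B"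
  shows "\<bar>hyperbola_sum F G y\<bar> \<le> 4 * B + B\<^sup>2"
proof (cases "y = 0")
  case True
  have "{(a, b). 1 \<le> a \<and> 1 \<le> b \<and> a * b \<le> (0 :: nat)\<^sup>2} = {}"
    by auto
  then have "hyperbola_sum F G y = 0"
    unfolding hyperbola_sum_def True by (simp only: sum.empty)
  moreover have "0 \<le> B"
    using FB[of 0 0] by simp
  ultimately show ?thesis by simp
next
  case False
  then have y: "1 \<le> y" by simp
  have "0 \<le> B"
    using FB[of 0 0] by simp
  define w where "w k = 1 / sqrt (real (max 1 k))" for k :: nat
  have w: "w k = 1 / sqrt (real k)" if "1 \<le> k" for k
    using that by (simp add: w_def max_def)
  have w_decr: "w (Suc k) \<le> w k" for k
    unfolding w_def by (intro divide_left_mono) auto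
  have w_nonneg: "0 \<le> w k" for k
    by (simp add: w_def)
  \<comment> \<open>the region is cut into a square and two tails that the reflection \<open>(a, b) \<mapsto> (b, a)\<close> interchanges\<close>
  have tail: "\<bar>\<Sum>a\<in>{1..y}. \<Sum>b\<in>{y<..y\<^sup>2 div a}. F a * G b / sqrt (real (a * b))\<bar> \<le> 2 * B"
    if F1: "\<And>a. \<bar>F a\<bar> \<le> 1" and GB: "\<And>m k. \<bar>\<Sum>i\<in>{m<..k}. G i\<bar> \<le> B" for F G :: "nat \<Rightarrow> real"
  proof -
    have inner: "\<bar>\<Sum>b\<in>{y<..y\<^sup>2 div a}. F a * G b / sqrt (real (a * b))\<bar>
        \<le> (1 / sqrt (real a)) * (B / sqrt (real y))" if "a \<in> {1..y}" for a
    proof -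
      have "y \<le> y\<^sup>2 div a"
        using that by (simp add: less_eq_div_iff_mult_less_eq power2_eq_square)
      then obtain d where d: "y\<^sup>2 div a = y + d"
        using le_Suc_ex by blast
      have "\<bar>\<Sum>i\<in>{y<..y + d}. G i * w i\<bar> \<le> B * w (Suc y)"
        using abs_weighted_sum_le[of y G B w d] GB w_decr w_nonneg \<open>0 \<le> B\<close> by blast
      also have "\<dots> \<le> B * w y"
        by (rule mult_left_mono[OF w_decr \<open>0 \<le> B\<close>])
      finally have 1: "\<bar>\<Sum>i\<in>{y<..y + d}. G i * w i\<bar> \<le> B / sqrt (real y)"
        using w[OF y] by simp
      have "(\<Sum>b\<in>{y<..y\<^sup>2 div a}. F a * G b / sqrt (real (a * b)))
          = F a * (1 / sqrt (real a)) * (\<Sum>i\<in>{y<..y + d}. G i * w i)"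
        unfolding d sum_distrib_left using w y by (intro sum.cong) (auto simp: real_sqrt_mult)
      then have "\<bar>\<Sum>b\<in>{y<..y\<^sup>2 div a}. F a * G b / sqrt (real (a * b))\<bar>
          = \<bar>F a\<bar> * (1 / sqrt (real a)) * \<bar>\<Sum>i\<in>{y<..y + d}. G i * w i\<bar>"
        by (simp add: abs_mult)
      also have "\<dots> \<le> 1 * (1 / sqrt (real a)) * (B / sqrt (real y))"
        using F1[of a] 1 by (intro mult_mono) auto
      finally show ?thesis by simp
    qed
    have "\<bar>\<Sum>a\<in>{1..y}. \<Sum>b\<in>{y<..y\<^sup>2 div a}. F a * G b / sqrt (real (a * b))\<bar>
        \<le> (\<Sum>a\<in>{1..y}. (1 / sqrt (real a)) * (B / sqrt (real y)))"
      by (rule order_trans[OF sum_abs sum_mono[OF inner]])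
    also have "\<dots> = (\<Sum>a\<in>{1..y}. 1 / sqrt (real a)) * (B / sqrt (real y))"
      by (simp only: sum_distrib_right)
    also have "\<dots> \<le> 2 * sqrt (real y) * (B / sqrt (real y))"
      by (rule mult_right_mono[OF sum_inverse_sqrt_le]) (simp add: \<open>0 \<le> B\<close>)
    also have "\<dots> = 2 * B"
      using y by simp
    finally show ?thesis .
  qed
  let ?t = "\<lambda>a b. F a * G b / sqrt (real (a * b))"
  let ?Q = "{1..y} \<times> {1..y}"
  let ?X = "SIGMA a:{1..y}. {y<..y\<^sup>2 div a}"
  let ?Y = "(\<lambda>(b, a). (a, b)) ` (SIGMA b:{1..y}. {y<..y\<^sup>2 div b})"
  have le_div: "b \<le> y\<^sup>2 div a \<longleftrightarrow> a * b \<le> y\<^sup>2" if "1 \<le> a" for a b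
    using that by (simp add: less_eq_div_iff_mult_less_eq mult.commute)
  have region: "{(a, b). 1 \<le> a \<and> 1 \<le> b \<and> a * b \<le> y\<^sup>2} = ?Q \<union> ?X \<union> ?Y"
  proof -
    have "(1 \<le> a \<and> 1 \<le> b \<and> a * b \<le> y\<^sup>2) \<longleftrightarrow> (a, b) \<in> ?Q \<union> ?X \<union> ?Y" for a b
    proof -
      have Y: "(a, b) \<in> ?Y \<longleftrightarrow> b \<in> {1..y} \<and> a \<in> {y<..y\<^sup>2 div b}"
        by (auto simp: image_iff)
      have "a * b \<le> y\<^sup>2" if "a \<le> y" "b \<le> y"
        using that by (simp add: power2_eq_square mult_le_mono)
      moreover have "\<not> a * b \<le> y\<^sup>2" if "y < a" "y < b"
        using mult_strict_mono[of y a y b] that by (simp add: power2_eq_square)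
      ultimately show ?thesis
        unfolding Un_iff Y using le_div[of a b] le_div[of b a] y by (auto simp: mult.commute)
    qed
    then show ?thesis by blast
  qed
  have disj: "?Q \<inter> ?X = {}" "(?Q \<union> ?X) \<inter> ?Y = {}"
    by auto
  have fin: "finite ?X" "finite ?Y"
    by auto
  have "hyperbola_sum F G y = (\<Sum>(a, b)\<in>?Q. ?t a b) + (\<Sum>(a, b)\<in>?X. ?t a b) + (\<Sum>(a, b)\<in>?Y. ?t a b)"
    unfolding hyperbola_sum_def region
    by (subst sum.union_disjoint, use fin disj in auto)+
  also have "(\<Sum>(a, b)\<in>?Q. ?t a b) = (\<Sum>a\<in>{1..y}. F a * w a) * (\<Sum>b\<in>{1..y}. G b * w b)"
    unfolding sum_product sum.cartesian_product by (intro sum.cong) (auto simp: w real_sqrt_mult)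
  also have "(\<Sum>(a, b)\<in>?X. ?t a b) = (\<Sum>a\<in>{1..y}. \<Sum>b\<in>{y<..y\<^sup>2 div a}. ?t a b)"
    by (simp add: sum.Sigma)
  also have "(\<Sum>(a, b)\<in>?Y. ?t a b) = (\<Sum>b\<in>{1..y}. \<Sum>a\<in>{y<..y\<^sup>2 div b}. G b * F a / sqrt (real (b * a)))"
    by (subst sum.reindex) (auto simp: inj_on_def sum.Sigma mult.commute intro!: sum.cong)
  finally have eq: "hyperbola_sum F G y =
     (\<Sum>a\<in>{1..y}. F a * w a) * (\<Sum>b\<in>{1..y}. G b * w b) + (\<Sum>a\<in>{1..y}. \<Sum>b\<in>{y<..y\<^sup>2 div a}. ?t a b)
     + (\<Sum>b\<in>{1..y}. \<Sum>a\<in>{y<..y\<^sup>2 div b}. G b * F a / sqrt (real (b * a)))" .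
  have square: "\<bar>\<Sum>a\<in>{1..y}. F a * w a\<bar> \<le> B"
    if "\<And>m k. \<bar>\<Sum>i\<in>{m<..k}. F i\<bar> \<le> B" for F :: "nat \<Rightarrow> real"
  proof -
    have "{1..y} = {0<..0 + y}" by auto
    then show ?thesis
      using abs_weighted_sum_le[of 0 F B w y] that w_decr w_nonneg \<open>0 \<le> B\<close> w[of 1] by simp
  qed
  have "\<bar>(\<Sum>a\<in>{1..y}. F a * w a) * (\<Sum>b\<in>{1..y}. G b * w b)\<bar> \<le> B * B"
    unfolding abs_mult by (rule mult_mono) (use square FB GB \<open>0 \<le> B\<close> in auto)
  moreover note tail[of F G, OF F1 GB] tail[of G F, OF G1 FB]
  ultimately show ?thesis
    unfolding eq power2_eq_square by linarith
qed

lemma hyperbola_sum_commute: "hyperbola_sum F G y = hyperbola_sum G F y"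
  unfolding hyperbola_sum_def
  by (rule sum.reindex_bij_witness[of _ prod.swap prod.swap]) (auto simp: mult.commute)

lemma hyperbola_sum_eq_divisor_sum:
  "hyperbola_sum F G y = (\<Sum>n\<in>{1..y\<^sup>2}. (\<Sum>b | b dvd n. F (n div b) * G b) / sqrt (real n))"
proof -
  have "(\<Sum>n\<in>{1..y\<^sup>2}. (\<Sum>b | b dvd n. F (n div b) * G b) / sqrt (real n))
      = (\<Sum>n\<in>{1..y\<^sup>2}. \<Sum>b | b dvd n. F (n div b) * G b / sqrt (real n))"
    by (simp add: sum_divide_distrib)
  also have "\<dots> = (\<Sum>(n, b)\<in>(SIGMA n:{1..y\<^sup>2}. {b. b dvd n}). F (n div b) * G b / sqrt (real n))"
    by (rule sum.Sigma) auto
  also have "\<dots> = hyperbola_sum F G y"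
    unfolding hyperbola_sum_def
    by (rule sum.reindex_bij_witness[of _ "\<lambda>(a, b). (a * b, b)" "\<lambda>(n, b). (n div b, b)"])
       (auto elim!: dvdE simp: Suc_le_eq mult.commute)
  finally show ?thesis by simp
qed

lemma periodic_sum_bounded:
  fixes F :: "nat \<Rightarrow> real"
  assumes "0 < N" and period: "\<And>a. F (a mod N) = F a" and F1: "\<And>a. \<bar>F a\<bar> \<le> 1"
    and zero: "(\<Sum>i<N. F i) = 0"
  shows "\<bar>\<Sum>i\<in>{m<..k}. F i\<bar> \<le> 2 * real N"
proof -
  have init: "\<bar>\<Sum>i<k. F i\<bar> \<le> real N" for k
  proof -
    have shift: "F (n * N + i) = F i" for n i
      using period[of "n * N + i"] period[of i] by simp
    have blocks: "(\<Sum>i<n * N. F i) = 0" for n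
    proof -
      have "(\<Sum>i<n * N. F i) = (\<Sum>j<n. \<Sum>i\<in>{j * N..<j * N + N}. F i)"
        by (rule sum.nat_group[symmetric])
      also have "\<dots> = (\<Sum>j<n. \<Sum>i<N. F i)"
      proof (rule sum.cong[OF refl])
        fix j
        show "(\<Sum>i\<in>{j * N..<j * N + N}. F i) = (\<Sum>i<N. F i)"
          using sum.shift_bounds_nat_ivl[of F 0 "j * N" N] shift[of j]
          by (simp add: add.commute[of N] add.commute[of _ "j * N"] atLeast0LessThan)
      qed
      finally show ?thesis
        by (simp add: zero)
    qed
    have "(\<Sum>i<k. F i) = (\<Sum>i<k div N * N. F i) + (\<Sum>i\<in>{k div N * N..<k div N * N + k mod N}. F i)"
    proof (subst sum.union_disjoint[symmetric])
      show "(\<Sum>i<k. F i) = sum F ({..<k div N * N} \<union> {k div N * N..<k div N * N + k mod N})"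
        by (subst ivl_disj_un_one(2)) auto
    qed auto
    also have "(\<Sum>i\<in>{k div N * N..<k div N * N + k mod N}. F i) = (\<Sum>i<k mod N. F i)"
      using sum.shift_bounds_nat_ivl[of F 0 "k div N * N" "k mod N"] shift[of "k div N"]
      by (simp add: add.commute[of "k mod N"] add.commute[of _ "k div N * N"] atLeast0LessThan del: div_mult_mod_eq mod_div_mult_eq)
    finally have "(\<Sum>i<k. F i) = (\<Sum>i<k mod N. F i)"
      by (simp add: blocks)
    also have "\<bar>\<dots>\<bar> \<le> (\<Sum>i<k mod N. 1)"
      by (rule order_trans[OF sum_abs sum_mono[OF F1]])
    also have "\<dots> \<le> real N"
      using \<open>0 < N\<close> by (simp add: less_imp_le)
    finally show ?thesis .
  qed
  show ?thesis
  proof (cases "m \<le> k")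
    case True
    have "(\<Sum>i<Suc k. F i) = (\<Sum>i<Suc m. F i) + (\<Sum>i\<in>{m<..k}. F i)"
    proof (subst sum.union_disjoint[symmetric])
      show "(\<Sum>i<Suc k. F i) = sum F ({..<Suc m} \<union> {m<..k})"
        by (rule sum.cong) (use True in auto)
    qed auto
    then show ?thesis
      using init[of "Suc k"] init[of "Suc m"] by linarith
  qed (use \<open>0 < N\<close> in auto)
qed


lemma divisor_sum_prime_Suc:
  fixes g :: "nat \<Rightarrow> real"
  assumes mult: "\<And>a b. g (a * b) = g a * g b" and p: "prime p" "\<not> p dvd m" and "0 < m"
  shows "(\<Sum>b | b dvd p ^ Suc k * m. g b) = g p * (\<Sum>b | b dvd p ^ k * m. g b) + (\<Sum>b | b dvd m. g b)"
proof -
  have "p \<noteq> 0" using p by auto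
  have fin: "finite {b. b dvd p ^ k * m}" for k
    using p \<open>0 < m\<close> by (intro finite_divisors_nat) (auto simp: prime_gt_0_nat)
  have eq: "{b. b dvd p ^ Suc k * m} = (\<lambda>b. p * b) ` {b. b dvd p ^ k * m} \<union> {b. b dvd m}" (is "?L = ?A \<union> ?B")
  proof (rule Set.set_eqI)
    fix b
    show "b \<in> {b. b dvd p ^ Suc k * m} \<longleftrightarrow> b \<in> ?A \<union> ?B"
    proof (cases "p dvd b")
      case True
      then obtain c where b: "b = p * c" ..
      then have "b \<notin> ?B"
        using p by (auto dest: dvd_mult_left)
      then show ?thesis
        using \<open>p \<noteq> 0\<close> by (auto simp: b mult.assoc)
    next
      case False
      then have "coprime b (p ^ Suc k)"
        using p(1) by (simp add: prime_imp_coprime coprime_commute[of b] del: power_Suc)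
      then have "b dvd p ^ Suc k * m \<longleftrightarrow> b dvd m"
        by (rule coprime_dvd_mult_right_iff)
      then show ?thesis
        using False by auto
    qed
  qed
  have "?A \<inter> ?B = {}"
    using p by (auto dest: dvd_mult_left)
  then have "(\<Sum>b | b dvd p ^ Suc k * m. g b) = (\<Sum>b\<in>?A. g b) + (\<Sum>b\<in>?B. g b)"
    unfolding eq using fin[of k] fin[of 0] by (intro sum.union_disjoint) auto
  also have "(\<Sum>b\<in>?A. g b) = g p * (\<Sum>b | b dvd p ^ k * m. g b)"
    using \<open>p \<noteq> 0\<close> by (subst sum.reindex) (auto simp: inj_on_def mult sum_distrib_left)
  finally show ?thesis .
qed

text \<open>For a completely multiplicative \<open>g\<close> with values in \<open>{-1, 0, 1}\<close>, the divisor sum of \<open>g\<close>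
  is multiplicative, and its value at \<open>p ^ k\<close> is \<open>k + 1\<close>, \<open>1\<close>, or alternately \<open>1\<close> and \<open>0\<close>,
  according to whether \<open>g p\<close> is \<open>1\<close>, \<open>0\<close> or \<open>-1\<close>.\<close>

lemma divisor_sum_prime_power:
  fixes g :: "nat \<Rightarrow> real"
  assumes mult: "\<And>a b. g (a * b) = g a * g b" and p: "prime p" "\<not> p dvd m" and "0 < m"
  shows "g p = 1 \<Longrightarrow> (\<Sum>b | b dvd p ^ k * m. g b) = (real k + 1) * (\<Sum>b | b dvd m. g b)"
    and "g p = 0 \<Longrightarrow> (\<Sum>b | b dvd p ^ k * m. g b) = (\<Sum>b | b dvd m. g b)"
    and "g p = -1 \<Longrightarrow> (\<Sum>b | b dvd p ^ k * m. g b) = (if even k then \<Sum>b | b dvd m. g b else 0)"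
proof -
  note step = divisor_sum_prime_Suc[OF mult p \<open>0 < m\<close>]
  show "(\<Sum>b | b dvd p ^ k * m. g b) = (real k + 1) * (\<Sum>b | b dvd m. g b)" if "g p = 1"
    using that by (induction k) (simp_all add: step ring_distribs del: power_Suc)
  show "(\<Sum>b | b dvd p ^ k * m. g b) = (\<Sum>b | b dvd m. g b)" if "g p = 0"
    using that by (cases k) (simp_all add: step del: power_Suc)
  show "(\<Sum>b | b dvd p ^ k * m. g b) = (if even k then \<Sum>b | b dvd m. g b else 0)" if "g p = -1"
    using that by (induction k) (simp_all add: step del: power_Suc)
qed

lemma prime_power_cofactor_nat:
  fixes n :: nat
  assumes "1 < n"
  obtains p k m where "prime p" "\<not> p dvd m" "0 < m" "m < n" "n = p ^ k * m" "k = multiplicity p n"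
proof -
  obtain p where p: "prime p" "p dvd n"
    using prime_factor_nat[of n] assms by auto
  define k where "k = multiplicity p n"
  obtain m where m: "n = p ^ k * m" "\<not> p dvd m"
    using multiplicity_decompose'[of n p] p assms unfolding k_def by (auto simp: prime_nat_iff)
  have "k \<noteq> 0"
    using p m by (intro notI) simp
  have "0 < m"
    using m assms by (cases m) auto
  have "1 < p ^ k"
    using one_less_power[OF prime_gt_1_nat[OF p(1)], of k] \<open>k \<noteq> 0\<close> by simp
  then have "m < n"
    using \<open>0 < m\<close> m(1) by simp
  then show ?thesis
    using that p m \<open>0 < m\<close> k_def by blast
qed

lemma divisor_sum_nonneg:
  fixes g :: "nat \<Rightarrow> real"
  assumes mult: "\<And>a b. g (a * b) = g a * g b" and one: "g 1 = 1" and vals: "\<And>a. g a \<in> {-1, 0, 1}"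
    and "0 < n"
  shows "0 \<le> (\<Sum>b | b dvd n. g b)"
  using \<open>0 < n\<close>
proof (induction n rule: less_induct)
  case (less n)
  show ?case
  proof (cases "n = 1")
    case True
    then show ?thesis using one by simp
  next
    case False
    with less.prems obtain p k m where pk: "prime p" "\<not> p dvd m" "0 < m" "m < n" "n = p ^ k * m"
      using prime_power_cofactor_nat[of n] by (metis less_one linorder_neqE_nat less_irrefl)
    show ?thesis
      using less.IH[OF pk(4,3)] vals[of p] divisor_sum_prime_power[OF mult pk(1-3), of k]
      unfolding pk(5) by auto
  qed
qed

lemma divisor_sum_square_ge_1:
  fixes g :: "nat \<Rightarrow> real"
  assumes mult: "\<And>a b. g (a * b) = g a * g b" and one: "g 1 = 1" and vals: "\<And>a. g a \<in> {-1, 0, 1}"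
    and "0 < n"
  shows "1 \<le> (\<Sum>b | b dvd n\<^sup>2. g b)"
  using \<open>0 < n\<close>
proof (induction n rule: less_induct)
  case (less n)
  show ?case
  proof (cases "n = 1")
    case True
    then show ?thesis using one by simp
  next
    case False
    with less.prems obtain p k m where pk: "prime p" "\<not> p dvd m" "0 < m" "m < n" "n = p ^ k * m"
      using prime_power_cofactor_nat[of n] by (metis less_one linorder_neqE_nat less_irrefl)
    have "n\<^sup>2 = p ^ (2 * k) * m\<^sup>2"
      by (simp add: pk(5) power_mult_distrib power_mult mult.commute)
    moreover have "\<not> p dvd m\<^sup>2"
      using pk by (simp add: prime_dvd_power_iff)
    moreover have "1 * 1 \<le> (real (2 * k) + 1) * (\<Sum>b | b dvd m\<^sup>2. g b)"
      using less.IH[OF pk(4,3)] by (intro mult_mono) auto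
    ultimately show ?thesis
      using less.IH[OF pk(4,3)] vals[of p] divisor_sum_prime_power[OF mult pk(1), of "m\<^sup>2" "2 * k"] pk(3)
      by auto
  qed
qed

lemma divisor_sum_eq_0:
  fixes g :: "nat \<Rightarrow> real"
  assumes mult: "\<And>a b. g (a * b) = g a * g b"
    and p: "prime p" "odd (multiplicity p n)" "g p = -1"
  shows "(\<Sum>b | b dvd n. g b) = 0"
proof -
  have "n \<noteq> 0"
    using p by (intro notI) simp
  then obtain m where m: "n = p ^ multiplicity p n * m" "\<not> p dvd m"
    using multiplicity_decompose'[of n p] p by (auto simp: prime_nat_iff)
  then have "0 < m"
    using \<open>n \<noteq> 0\<close> by (cases m) auto
  then show ?thesis
    using divisor_sum_prime_power(3)[OF mult p(1) m(2), of "multiplicity p n"] p m(1) by simp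
qed

section \<open>Integers with prescribed values of quadratic characters\<close>

text \<open>A finite family of completely multiplicative functions that take the values \<open>1\<close> and \<open>-1\<close>
  on the integers coprime to \<open>N\<close>, only depend on the residue class modulo \<open>N\<close>, and are independent:
  every pattern of signs occurs.\<close>

locale independent_signs =
  fixes K :: "'i set" and c :: "'i \<Rightarrow> nat \<Rightarrow> int" and N :: nat
  assumes finite_K: "finite K" and N_pos: "0 < N"
    and c_mult: "\<And>i a b. i \<in> K \<Longrightarrow> c i (a * b) = c i a * c i b"
    and c_mod: "\<And>i a. i \<in> K \<Longrightarrow> c i (a mod N) = c i a"
    and c_sign: "\<And>i a. i \<in> K \<Longrightarrow> coprime a N \<Longrightarrow> c i a \<in> {-1, 1}"
    and independent: "\<And>e. (\<And>i. i \<in> K \<Longrightarrow> e i \<in> {-1, 1}) \<Longrightarrow> \<exists>a. coprime a N \<and> (\<forall>i\<in>K. c i a = e i)"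
begin

text \<open>The product of the characters in \<open>S\<close>, extended by zero to the integers that are not coprime
  to \<open>N\<close>. In particular, \<open>chi {}\<close> is the principal character.\<close>

definition chi :: "'i set \<Rightarrow> nat \<Rightarrow> real" where
  "chi S a = (if coprime a N then real_of_int (\<Prod>i\<in>S. c i a) else 0)"

lemma chi_mult: "S \<subseteq> K \<Longrightarrow> chi S (a * b) = chi S a * chi S b"
  by (auto simp: chi_def prod.distrib[symmetric] c_mult intro!: prod.cong)

lemma chi_mod: "S \<subseteq> K \<Longrightarrow> chi S (a mod N) = chi S a"
proof -
  assume "S \<subseteq> K"
  then have "(\<Prod>i\<in>S. c i (a mod N)) = (\<Prod>i\<in>S. c i a)"
    by (intro prod.cong) (auto simp: c_mod)
  then show ?thesis
    using N_pos by (simp add: chi_def coprime_mod_left_iff)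
qed

lemma sign_prod: "(\<And>i. i \<in> S \<Longrightarrow> e i \<in> {-1, 1}) \<Longrightarrow> (\<Prod>i\<in>S. e i) \<in> {-1, 1 :: int}"
proof (induction S rule: infinite_finite_induct)
  case (insert i S)
  then have "e i \<in> {-1, 1}" "(\<Prod>i\<in>S. e i) \<in> {-1, 1}"
    by blast+
  then have "e i * (\<Prod>i\<in>S. e i) \<in> {-1, 1}"
    by (elim insertE) simp_all
  with insert(1,2) show ?case by simp
qed simp_all

lemma chi_vals: "S \<subseteq> K \<Longrightarrow> chi S a \<in> {-1, 0, 1}"
proof -
  assume "S \<subseteq> K"
  then have "coprime a N \<Longrightarrow> (\<Prod>i\<in>S. c i a) \<in> {-1, 1}"
    using c_sign by (intro sign_prod) blast
  then show ?thesis
    unfolding chi_def by (auto simp del: of_int_prod)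
qed

lemma abs_chi_le: "S \<subseteq> K \<Longrightarrow> \<bar>chi S a\<bar> \<le> 1"
  using chi_vals[of S a] by auto

lemma chi_1: "S \<subseteq> K \<Longrightarrow> chi S 1 = 1"
proof -
  assume "S \<subseteq> K"
  have "c i 1 = 1" if "i \<in> S" for i
  proof -
    have "i \<in> K"
      using that \<open>S \<subseteq> K\<close> by auto
    then show ?thesis
      using c_mult[of i 1 1] c_sign[of i 1] by auto
  qed
  then show ?thesis
    by (simp add: chi_def)
qed

lemma chi_sym_diff:
  assumes "S \<subseteq> K" "T \<subseteq> K"
  shows "chi S a * chi T a = chi ((S - T) \<union> (T - S)) a"
proof (cases "coprime a N")
  case True
  have fin: "finite S" "finite T"
    using assms finite_K finite_subset by auto
  have "(\<Prod>i\<in>S \<inter> T. c i a) * (\<Prod>i\<in>S \<inter> T. c i a) = (\<Prod>i\<in>S \<inter> T. c i a * c i a)"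
    by (simp add: prod.distrib)
  also have "\<dots> = 1"
  proof (rule prod.neutral, rule ballI)
    fix i assume "i \<in> S \<inter> T"
    then show "c i a * c i a = 1"
      using c_sign[of i a] True assms by fastforce
  qed
  finally have sq: "(\<Prod>i\<in>S \<inter> T. c i a) * (\<Prod>i\<in>S \<inter> T. c i a) = 1" .
  have "(\<Prod>i\<in>S. c i a) = (\<Prod>i\<in>S - T. c i a) * (\<Prod>i\<in>S \<inter> T. c i a)"
    using fin by (subst prod.union_disjoint[symmetric]) (auto intro!: prod.cong)
  moreover have "(\<Prod>i\<in>T. c i a) = (\<Prod>i\<in>T - S. c i a) * (\<Prod>i\<in>S \<inter> T. c i a)"
    using fin by (subst prod.union_disjoint[symmetric]) (auto intro!: prod.cong)
  moreover have "(\<Prod>i\<in>(S - T) \<union> (T - S). c i a) = (\<Prod>i\<in>S - T. c i a) * (\<Prod>i\<in>T - S. c i a)"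
    using fin by (intro prod.union_disjoint) auto
  ultimately have "(\<Prod>i\<in>S. c i a) * (\<Prod>i\<in>T. c i a)
      = (\<Prod>i\<in>(S - T) \<union> (T - S). c i a) * ((\<Prod>i\<in>S \<inter> T. c i a) * (\<Prod>i\<in>S \<inter> T. c i a))"
    by (simp only: mult_ac)
  then have "(\<Prod>i\<in>S. c i a) * (\<Prod>i\<in>T. c i a) = (\<Prod>i\<in>(S - T) \<union> (T - S). c i a)"
    by (simp only: sq mult_1_right)
  then show ?thesis
    using True unfolding chi_def by (simp only: if_True flip: of_int_mult)
qed (simp add: chi_def)

lemma chi_sum_eq_0:
  assumes "S \<subseteq> K" "S \<noteq> {}"
  shows "(\<Sum>a<N. chi S a) = 0"
proof -
  obtain i where i: "i \<in> S"
    using assms by auto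
  obtain a where a: "coprime a N" "\<forall>j\<in>K. c j a = (if j = i then -1 else 1)"
    using independent[of "\<lambda>j. if j = i then -1 else 1"] by fastforce
  have "(\<Prod>j\<in>S. c j a) = (\<Prod>j\<in>S. if j = i then -1 else 1)"
    using a(2) assms by (intro prod.cong) auto
  also have "\<dots> = -1"
    using i finite_subset[OF assms(1) finite_K] by simp
  finally have chi_a: "chi S a = -1"
    using a(1) by (simp add: chi_def)
  have inj: "inj_on (\<lambda>k. a * k mod N) {..<N}"
  proof (rule inj_onI)
    fix x y assume xy: "x \<in> {..<N}" "y \<in> {..<N}" "a * x mod N = a * y mod N"
    then have "[x = y] (mod N)"
      using a(1) by (simp add: cong_mult_lcancel_nat flip: cong_def)
    then show "x = y"
      using xy by (simp add: cong_def)
  qed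
  have "(\<lambda>k. a * k mod N) ` {..<N} = {..<N}"
    using inj N_pos by (intro endo_inj_surj) auto
  then have "(\<Sum>k<N. chi S k) = (\<Sum>k<N. chi S (a * k mod N))"
    using sum.reindex[OF inj, of "chi S"] by simp
  also have "\<dots> = - (\<Sum>k<N. chi S k)"
    by (simp add: chi_mod[OF assms(1)] chi_mult[OF assms(1)] chi_a sum_negf)
  finally show ?thesis by simp
qed

lemma hyperbola_sum_chi_bounded:
  assumes "S \<subseteq> K" "S \<noteq> {}" "T \<subseteq> K" "T \<noteq> {}"
  shows "\<bar>hyperbola_sum (chi S) (chi T) y\<bar> \<le> 8 * real N + (2 * real N)\<^sup>2"
proof -
  have "\<bar>\<Sum>i\<in>{m<..k}. chi S i\<bar> \<le> 2 * real N" if "S \<subseteq> K" "S \<noteq> {}" for S m k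
    using N_pos chi_mod abs_chi_le chi_sum_eq_0 that by (intro periodic_sum_bounded) auto
  then show ?thesis
    using hyperbola_sum_bounded[of "chi S" "chi T" "2 * real N" y] abs_chi_le assms by auto
qed

text \<open>Twisting by \<open>chi S\<close> turns the divisor sums of \<open>chi T\<close> into the convolution of \<open>chi S\<close> with
  the product of \<open>chi S\<close> and \<open>chi T\<close>.\<close>

lemma hyperbola_sum_twist:
  assumes "S \<subseteq> K" "T \<subseteq> K"
  shows "hyperbola_sum (chi S) (chi ((S - T) \<union> (T - S))) y
      = (\<Sum>n\<in>{1..y\<^sup>2}. chi S n * (\<Sum>b | b dvd n. chi T b) / sqrt (real n))"
proof -
  have "(\<Sum>b | b dvd n. chi S (n div b) * chi ((S - T) \<union> (T - S)) b) = chi S n * (\<Sum>b | b dvd n. chi T b)" for n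
    unfolding sum_distrib_left
    by (intro sum.cong refl)
       (auto simp: chi_sym_diff[OF assms, symmetric] chi_mult[OF assms(1), symmetric]
             simp flip: mult.assoc)
  then show ?thesis
    by (simp add: hyperbola_sum_eq_divisor_sum)
qed

lemma hyperbola_sum_principal_unbounded:
  assumes "T \<subseteq> K"
  shows "\<exists>y. C < hyperbola_sum (chi {}) (chi T) y"
proof -
  have "\<forall>\<^sub>F M in sequentially. real N * C + 1 \<le> harm M"
    using harm_at_top by (auto simp: filterlim_at_top)
  then obtain M where M: "real N * C + 1 \<le> (harm M :: real)"
    by (auto simp: eventually_sequentially)
  define y where "y = N * M + 1"
  define f where "f n = (\<Sum>b | b dvd n. chi T b)" for n
  have f_nonneg: "0 \<le> f n" if "0 < n" for n
    unfolding f_def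
    by (rule divisor_sum_nonneg[of "chi T"]) (use assms that chi_mult chi_1 chi_vals in blast)+
  have f_square: "1 \<le> f (n\<^sup>2)" if "0 < n" for n
    unfolding f_def
    by (rule divisor_sum_square_ge_1[of "chi T"]) (use assms that chi_mult chi_1 chi_vals in blast)+
  let ?u = "\<lambda>n. chi {} n * f n / sqrt (real n)"
  let ?h = "\<lambda>k. (N * k + 1)\<^sup>2"
  \<comment> \<open>only the squares of the integers congruent to 1 modulo \<open>N\<close> are kept\<close>
  have "harm M / real N = (\<Sum>k<M. inverse (real (Suc k)) / real N)"
    unfolding harm_altdef by (rule sum_divide_distrib)
  also have "\<dots> = (\<Sum>k<M. 1 / (real N * real (Suc k)))"
    by (rule sum.cong[OF refl]) (simp add: divide_inverse mult.commute del: of_nat_Suc)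
  also have "\<dots> \<le> (\<Sum>k<M. ?u (?h k))"
  proof (rule sum_mono)
    fix k
    have "coprime (N * k + 1) N"
    proof (rule coprimeI)
      fix d assume d: "d dvd N * k + 1" "d dvd N"
      then have "d dvd N * k" by simp
      with d(1) show "is_unit d"
        using dvd_add_right_iff by blast
    qed
    then have "coprime ((N * k + 1)\<^sup>2) N"
      by (rule coprime_power_left_iff[THEN iffD2, OF disjI1])
    then have "?u (?h k) = f (?h k) / (real N * real k + 1)"
      by (simp add: chi_def add.commute)
    moreover have "1 / (real N * real (Suc k)) \<le> 1 / (real N * real k + 1)"
      using N_pos by (intro frac_le) (simp_all add: algebra_simps add_pos_nonneg)
    moreover have "1 / (real N * real k + 1) \<le> f (?h k) / (real N * real k + 1)"
      using f_square[of "N * k + 1"] by (intro divide_right_mono) auto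
    ultimately show "1 / (real N * real (Suc k)) \<le> ?u (?h k)"
      by linarith
  qed
  also have "\<dots> = (\<Sum>n\<in>?h ` {..<M}. ?u n)"
  proof (rule sum.reindex_cong[of ?h, symmetric])
    show "inj_on ?h {..<M}"
    proof (rule inj_onI)
      fix k j assume "?h k = ?h j"
      then have "N * k + 1 = N * j + 1"
        by (rule power_eq_imp_eq_base) auto
      then show "k = j"
        using N_pos by simp
    qed
  qed auto
  also have "\<dots> \<le> (\<Sum>n\<in>{1..y\<^sup>2}. ?u n)"
  proof (rule sum_mono2)
    show "?h ` {..<M} \<subseteq> {1..y\<^sup>2}"
      by (auto simp: y_def intro!: power_mono mult_le_mono2)
    show "0 \<le> ?u n" if "n \<in> {1..y\<^sup>2} - ?h ` {..<M}" for n
      using f_nonneg[of n] that by (simp add: chi_def)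
  qed simp
  also have "\<dots> = hyperbola_sum (chi {}) (chi T) y"
    using hyperbola_sum_twist[of "{}" T y] assms by (simp add: f_def)
  finally have "harm M / real N \<le> hyperbola_sum (chi {}) (chi T) y" .
  moreover have "C < harm M / real N"
    using M N_pos by (simp add: field_simps)
  ultimately show ?thesis
    by (intro exI[of _ y]) linarith
qed

text \<open>A substitute for Dirichlet's theorem for quadratic characters: the number \<open>n\<close> need not be prime, but
  its prime factors of odd multiplicity all lie in the kernel of the product of the characters in \<open>T\<close>.\<close>

theorem exists_prescribed_signs:
  assumes "T \<subseteq> K" and e: "\<And>i. i \<in> K \<Longrightarrow> e i \<in> {-1, 1}" and e_T: "(\<Prod>i\<in>T. e i) = 1"
  obtains n where "0 < n" "coprime n N" "\<And>i. i \<in> K \<Longrightarrow> c i n = e i"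
    "\<And>p. prime p \<Longrightarrow> odd (multiplicity p n) \<Longrightarrow> (\<Prod>i\<in>T. c i p) = 1"
proof (cases "T = {}")
  case True
  obtain a where a: "coprime a N" "\<forall>i\<in>K. c i a = e i"
    using independent e by blast
  have "coprime (a + N) N"
    using a(1) unfolding coprime_iff_gcd_eq_1 by simp
  moreover have "c i (a + N) = e i" if "i \<in> K" for i
    using a(2) c_mod[OF that, of a] c_mod[OF that, of "a + N"] that by simp
  ultimately show ?thesis
    using that[of "a + N"] N_pos True by simp
next
  case False
  define f where "f n = (\<Sum>b | b dvd n. chi T b)" for n
  define H where "H S y = hyperbola_sum (chi S) (chi ((S - T) \<union> (T - S))) y" for S y
  define E where "E S = real_of_int (\<Prod>i\<in>S. e i)" for S
  define B where "B = 8 * real N + (2 * real N)\<^sup>2"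
  have "\<exists>n. 0 < n \<and> coprime n N \<and> (\<forall>i\<in>K. c i n = e i) \<and> f n \<noteq> 0"
  proof (rule ccontr)
    assume none: "\<not> ?thesis"
    \<comment> \<open>the sum over all \<open>S\<close> detects the sign pattern \<open>e\<close>\<close>
    have detect: "(\<Sum>S\<in>Pow K. E S * H S y) = 0" for y
    proof -
      have "(\<Sum>S\<in>Pow K. E S * H S y) = (\<Sum>S\<in>Pow K. \<Sum>n\<in>{1..y\<^sup>2}. E S * chi S n * f n / sqrt (real n))"
        using assms(1) by (auto simp: H_def f_def hyperbola_sum_twist sum_distrib_left mult.assoc intro!: sum.cong)
      also have "\<dots> = (\<Sum>n\<in>{1..y\<^sup>2}. (\<Sum>S\<in>Pow K. E S * chi S n) * f n / sqrt (real n))"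
        by (subst sum.swap) (simp add: sum_distrib_right sum_divide_distrib)
      also have "\<dots> = (\<Sum>n\<in>{1..y\<^sup>2}. 0)"
      proof (rule sum.cong[OF refl])
        fix n assume n: "n \<in> {1..y\<^sup>2}"
        show "(\<Sum>S\<in>Pow K. E S * chi S n) * f n / sqrt (real n) = 0"
        proof (cases "coprime n N \<and> f n \<noteq> 0")
          case True
          with none n obtain i where i: "i \<in> K" "c i n \<noteq> e i"
            by auto
          then have "1 + e i * c i n = 0"
            using e[OF i(1)] c_sign[OF i(1), of n] True by auto
          then have "(\<Prod>i\<in>K. e i * c i n + 1) = 0"
            using i(1) finite_K by (intro prod_zero bexI[of _ i]) (auto simp: add.commute)
          moreover have "(\<Prod>i\<in>K. e i * c i n + 1) = (\<Sum>S\<in>Pow K. (\<Prod>i\<in>S. e i) * (\<Prod>i\<in>S. c i n))"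
            using prod_add[OF finite_K, of "\<lambda>i. e i * c i n" "\<lambda>_. 1"] by (simp add: prod.distrib)
          ultimately have "(\<Sum>S\<in>Pow K. (\<Prod>i\<in>S. e i) * (\<Prod>i\<in>S. c i n)) = 0"
            by simp
          then have "real_of_int (\<Sum>S\<in>Pow K. (\<Prod>i\<in>S. e i) * (\<Prod>i\<in>S. c i n)) = 0"
            by simp
          then show ?thesis
            using True by (simp add: E_def chi_def)
        qed (auto simp: chi_def)
      qed
      finally show ?thesis by simp
    qed
    have E_abs: "\<bar>E S\<bar> \<le> 1" if "S \<subseteq> K" for S
    proof -
      have "(\<Prod>i\<in>S. e i) \<in> {-1, 1}"
        using e that by (intro sign_prod) blast
      then show ?thesis
        unfolding E_def by (auto simp del: of_int_prod)
    qed
    have rest: "\<bar>\<Sum>S\<in>Pow K - {{}, T}. E S * H S y\<bar> \<le> real (card (Pow K)) * B" for y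
    proof -
      have "\<bar>\<Sum>S\<in>Pow K - {{}, T}. E S * H S y\<bar> \<le> (\<Sum>S\<in>Pow K - {{}, T}. B)"
      proof (rule order_trans[OF sum_abs sum_mono])
        fix S assume S: "S \<in> Pow K - {{}, T}"
        then have "\<bar>H S y\<bar> \<le> B"
          unfolding H_def B_def using assms(1) by (intro hyperbola_sum_chi_bounded) auto
        then show "\<bar>E S * H S y\<bar> \<le> B"
          using E_abs[of S] S mult_mono[of "\<bar>E S\<bar>" 1 "\<bar>H S y\<bar>" B] by (auto simp: abs_mult)
      qed
      also have "\<dots> \<le> real (card (Pow K)) * B"
        using finite_K by (auto simp: B_def intro!: mult_right_mono card_mono)
      finally show ?thesis .
    qed
    obtain y where y: "real (card (Pow K)) * B < hyperbola_sum (chi {}) (chi T) y"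
      using hyperbola_sum_principal_unbounded[OF assms(1)] by blast
    have "(\<Sum>S\<in>Pow K. E S * H S y) = (\<Sum>S\<in>{{}, T}. E S * H S y) + (\<Sum>S\<in>Pow K - {{}, T}. E S * H S y)"
      proof (subst sum.union_disjoint[symmetric])
      show "(\<Sum>S\<in>Pow K. E S * H S y) = (\<Sum>S\<in>{{}, T} \<union> (Pow K - {{}, T}). E S * H S y)"
        by (rule sum.cong) (use assms(1) in auto)
    qed (use finite_K in auto)
    also have "(\<Sum>S\<in>{{}, T}. E S * H S y) = H {} y + H T y"
      using False e_T by (simp add: E_def del: of_int_prod)
    also have "H {} y = hyperbola_sum (chi {}) (chi T) y"
      by (simp add: H_def)
    also have "H T y = hyperbola_sum (chi {}) (chi T) y"
      using hyperbola_sum_commute by (simp add: H_def)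
    finally have "0 = 2 * hyperbola_sum (chi {}) (chi T) y + (\<Sum>S\<in>Pow K - {{}, T}. E S * H S y)"
      using detect[of y] by simp
    then have "2 * hyperbola_sum (chi {}) (chi T) y \<le> real (card (Pow K)) * B"
      using rest[of y] by linarith
    moreover have "0 \<le> real (card (Pow K)) * B"
      by (simp add: B_def)
    ultimately show False
      using y by linarith
  qed
  then obtain n where n: "0 < n" "coprime n N" "\<forall>i\<in>K. c i n = e i" "f n \<noteq> 0"
    by blast
  have "(\<Prod>i\<in>T. c i p) = 1" if p: "prime p" "odd (multiplicity p n)" for p
  proof -
    have "p dvd n"
      using p(2) by (metis even_zero not_dvd_imp_multiplicity_0)
    then have "coprime p N"
      using n(2) coprime_divisors[of p n N N] by simp
    moreover have "chi T p \<noteq> -1"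
      using n(4) divisor_sum_eq_0[of "chi T" p n] chi_mult[OF assms(1)] p unfolding f_def by blast
    moreover have "(\<Prod>i\<in>T. c i p) \<in> {-1, 1}"
      using c_sign \<open>coprime p N\<close> assms(1) by (intro sign_prod) blast
    ultimately show ?thesis
      unfolding chi_def by (auto simp del: of_int_prod)
  qed
  with n show ?thesis
    using that by blast
qed

end

section \<open>The Jacobi symbol\<close>

lemma odd_nat_prime_induct [consumes 1, case_names one mult]:
  fixes n :: nat
  assumes "odd n" and one: "P 1"
    and mult: "\<And>p n. prime p \<Longrightarrow> odd p \<Longrightarrow> odd n \<Longrightarrow> P n \<Longrightarrow> P (p * n)"
  shows "P n"
proof -
  have "odd n \<longrightarrow> P n"
    by (induction n rule: prime_divisors_induct) (use one in \<open>auto intro: mult\<close>)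
  with \<open>odd n\<close> show ?thesis by simp
qed

lemma odd_prime_gt_2: "prime p \<Longrightarrow> odd p \<Longrightarrow> 2 < (p :: nat)"
  using prime_ge_2_nat[of p] by (cases "p = 2") auto

lemma Legendre_cong: "[a = b] (mod p) \<Longrightarrow> Legendre a p = Legendre b p"
proof -
  assume ab: "[a = b] (mod p)"
  then have "[y = a] (mod p) \<longleftrightarrow> [y = b] (mod p)" for y
    by (meson cong_sym cong_trans)
  then show ?thesis
    using cong_sym_eq[of a 0] cong_sym_eq[of b 0] by (auto simp: Legendre_def QuadRes_def)
qed

lemma Legendre_values: "Legendre a p \<in> {-1, 0, 1}"
  by (simp add: Legendre_def)

lemma Legendre_eq_0_iff: "Legendre a p = 0 \<longleftrightarrow> p dvd a"
  by (simp add: Legendre_def cong_0_iff)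

lemma Legendre_sign: "prime p \<Longrightarrow> coprime a (int p) \<Longrightarrow> Legendre a (int p) \<in> {-1, 1}"
  using Legendre_values[of a "int p"] Legendre_eq_0_iff[of a "int p"]
  by (auto simp: prime_nat_iff coprime_absorb_right)

lemma small_cong_eq:
  fixes x y :: int
  assumes "[x = y] (mod int p)" "2 < p" "x \<in> {-1, 0, 1}" "y \<in> {-1, 0, 1}"
  shows "x = y"
proof (rule ccontr)
  assume "x \<noteq> y"
  moreover have "int p dvd x - y"
    using assms(1) by (simp add: cong_iff_dvd_diff)
  ultimately have "int p \<le> \<bar>x - y\<bar>"
    by (intro zdvd_imp_le) auto
  then show False
    using assms(2-4) by auto
qed

lemma Legendre_mult:
  assumes "prime p" "odd p"
  shows "Legendre (a * b) (int p) = Legendre a (int p) * Legendre b (int p)"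
proof (rule small_cong_eq)
  note E = euler_criterion[OF assms(1) odd_prime_gt_2[OF assms]]
  have "[Legendre (a * b) (int p) = a ^ ((p - 1) div 2) * b ^ ((p - 1) div 2)] (mod int p)"
    using E[of "a * b"] by (simp add: power_mult_distrib)
  moreover have "[Legendre a (int p) * Legendre b (int p) = a ^ ((p - 1) div 2) * b ^ ((p - 1) div 2)] (mod int p)"
    by (rule cong_mult[OF E E])
  ultimately show "[Legendre (a * b) (int p) = Legendre a (int p) * Legendre b (int p)] (mod int p)"
    by (meson cong_sym cong_trans)
  show "Legendre a (int p) * Legendre b (int p) \<in> {-1, 0, 1}"
    using Legendre_values[of a "int p"] Legendre_values[of b "int p"] by auto
qed (use assms odd_prime_gt_2 Legendre_values in auto)

lemma Legendre_square: "prime p \<Longrightarrow> coprime a (int p) \<Longrightarrow> Legendre (a\<^sup>2) (int p) = 1"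
  by (auto simp: Legendre_def QuadRes_def cong_0_iff prime_dvd_power_iff coprime_absorb_right prime_nat_iff
      dest: prime_dvd_power intro!: exI[of _ a])

lemma Legendre_minus_one:
  assumes "prime p" "odd p"
  shows "Legendre (-1) (int p) = (if p mod 4 = 3 then -1 else 1)"
proof (rule small_cong_eq)
  have "p mod 4 = 1 \<or> p mod 4 = 3"
    using assms(2) by presburger
  then have "(-1 :: int) ^ ((p - 1) div 2) = (if p mod 4 = 3 then -1 else 1)"
    by (auto simp: minus_one_power_iff) presburger+
  then show "[Legendre (-1) (int p) = (if p mod 4 = 3 then -1 else 1)] (mod int p)"
    using euler_criterion[OF assms(1) odd_prime_gt_2[OF assms], of "-1"] by simp
qed (use assms odd_prime_gt_2 Legendre_values in auto)

lemma Jacobi_Suc_0 [simp]: "Jacobi a (Suc 0) = 1"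
  by (simp add: Jacobi_def)

lemma Jacobi_prime_mult:
  assumes "prime p" "0 < n"
  shows "Jacobi a (p * n) = Legendre a (int p) * Jacobi a n"
  using assms by (simp add: Jacobi_def prime_factorization_mult prime_factorization_prime)

lemma Jacobi_mult:
  assumes "odd n"
  shows "Jacobi (a * b) n = Jacobi a n * Jacobi b n"
  using assms
proof (induction rule: odd_nat_prime_induct)
  case (mult p n)
  then have "0 < n" by (cases n) auto
  with mult show ?case by (simp add: Jacobi_prime_mult Legendre_mult)
qed simp

lemma Jacobi_cong:
  assumes "odd n" "[a = b] (mod int n)"
  shows "Jacobi a n = Jacobi b n"
  using assms
proof (induction rule: odd_nat_prime_induct)
  case (mult p n)
  then have "0 < n" by (cases n) auto
  moreover have "[a = b] (mod int p)" "[a = b] (mod int n)"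
    using mult.prems by (auto intro: cong_modulus_mult cong_modulus_mult[where n = "int p"] simp: mult.commute)
  ultimately show ?case
    using mult Legendre_cong[of a b "int p"] by (simp add: Jacobi_prime_mult)
qed simp

lemma Jacobi_sign:
  assumes "odd n" "coprime a (int n)"
  shows "Jacobi a n \<in> {-1, 1}"
  using assms
proof (induction rule: odd_nat_prime_induct)
  case (mult p n)
  then have "0 < n" by (cases n) auto
  moreover have "Legendre a (int p) \<in> {-1, 1}" "Jacobi a n \<in> {-1, 1}"
    using mult Legendre_sign[of p a] by auto
  ultimately show ?case
    using mult by (auto simp: Jacobi_prime_mult)
qed simp

lemma Jacobi_minus_one:
  assumes "odd n"
  shows "Jacobi (-1) n = (if n mod 4 = 3 then -1 else 1)"
  using assms
proof (induction rule: odd_nat_prime_induct)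
  case (mult p n)
  then have "0 < n" by (cases n) auto
  have "p mod 4 = 1 \<or> p mod 4 = 3" "n mod 4 = 1 \<or> n mod 4 = 3"
    using mult.hyps(2,3) by presburger+
  moreover have "p * n mod 4 = (p mod 4) * (n mod 4) mod 4"
    by (simp add: mod_mult_eq)
  ultimately show ?case
    using mult \<open>0 < n\<close> by (auto simp: Jacobi_prime_mult Legendre_minus_one)
qed simp

text \<open>Quadratic reciprocity for a prime and an odd number.\<close>

lemma Legendre_reciprocity:
  assumes "prime p" "odd p" "odd n" "coprime p n"
  shows "Legendre (int n) (int p) = Jacobi (int p) n * (if p mod 4 = 3 \<and> n mod 4 = 3 then -1 else 1)"
  using assms(3,4)
proof (induction rule: odd_nat_prime_induct)
  case one
  have "Legendre 1 (int p) = 1"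
    using Legendre_square[OF assms(1), of 1] by simp
  then show ?case by simp
next
  case (mult l n)
  then have "0 < n" by (cases n) auto
  have "p \<noteq> l"
    using mult assms(1) by (auto simp: prime_nat_iff)
  have lp: "Legendre (int l) (int p) = Legendre (int p) (int l) * (if p mod 4 = 3 \<and> l mod 4 = 3 then -1 else 1)"
  proof -
    have "Legendre (int p) (int l) * Legendre (int l) (int p) = (-1) ^ ((p - 1) div 2 * ((l - 1) div 2))"
      using Quadratic_Reciprocity[of p l] odd_prime_gt_2 assms(1,2) mult.hyps \<open>p \<noteq> l\<close> by blast
    moreover have "even ((p - 1) div 2 * ((l - 1) div 2)) \<longleftrightarrow> \<not> (p mod 4 = 3 \<and> l mod 4 = 3)"
    proof -
      have "even ((k - 1) div 2) \<longleftrightarrow> k mod 4 \<noteq> 3" if "odd k" for k :: nat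
        using that by presburger
      then show ?thesis
        using assms(2) mult.hyps(2) by auto
    qed
    moreover have "Legendre (int p) (int l) \<in> {-1, 1}" "Legendre (int l) (int p) \<in> {-1, 1}"
      using Legendre_sign[of l "int p"] Legendre_sign[of p "int l"] assms(1) mult.hyps(1) \<open>p \<noteq> l\<close>
      by (simp_all add: primes_coprime)
    ultimately show ?thesis
      by (auto simp: minus_one_power_iff split: if_splits)
  qed
  have "n mod 4 = 1 \<or> n mod 4 = 3" "l mod 4 = 1 \<or> l mod 4 = 3"
    using mult.hyps(2,3) by presburger+
  moreover have "l * n mod 4 = (l mod 4) * (n mod 4) mod 4"
    by (simp add: mod_mult_eq)
  moreover have "Legendre (int n) (int p) = Jacobi (int p) n * (if p mod 4 = 3 \<and> n mod 4 = 3 then -1 else 1)"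
    using mult by simp
  ultimately show ?case
    using lp \<open>0 < n\<close> mult.hyps by (auto simp: Legendre_mult[OF assms(1,2)] Jacobi_prime_mult)
qed

lemma Jacobi_eq_1_of_square_mod:
  fixes n m :: nat
  assumes "odd m" "n mod 4 = 1" "coprime m n" "[y\<^sup>2 = int n] (mod int m)"
  shows "Jacobi (int m) n = 1"
  using assms(1,3,4)
proof (induction rule: odd_nat_prime_induct)
  case one
  have "odd n" using assms(2) by presburger
  then show ?case
    using Jacobi_mult[of n 1 1] Jacobi_sign[of n 1] by auto
next
  case (mult p m)
  have "odd n" using assms(2) by presburger
  have "coprime p n" "coprime m n" "[y\<^sup>2 = int n] (mod int p)" "[y\<^sup>2 = int n] (mod int m)"
    using mult.prems by (auto intro: cong_modulus_mult cong_modulus_mult[where n = "int p"] simp: mult.commute)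
  moreover from this have "Legendre (int n) (int p) = 1"
    using mult.hyps by (auto simp: Legendre_def QuadRes_def cong_0_iff coprime_absorb_left prime_nat_iff)
  ultimately show ?case
    using mult Legendre_reciprocity[of p n] \<open>odd n\<close> assms(2) by (simp add: Jacobi_mult)
qed

lemma Jacobi_eq_prod_odd_multiplicity:
  assumes "odd n" "coprime a (int n)"
  shows "Jacobi a n = (\<Prod>p | p \<in> prime_factors n \<and> odd (multiplicity p n). Legendre a (int p))"
proof -
  have pf: "Legendre a (int p) ^ multiplicity p n = (if odd (multiplicity p n) then Legendre a (int p) else 1)"
    if "p \<in> prime_factors n" for p
  proof -
    have "coprime a (int p)"
      using that assms(2) by (metis coprime_divisors dvd_refl in_prime_factors_imp_dvd of_nat_dvd_iff)
    then have "Legendre a (int p) = -1 \<or> Legendre a (int p) = 1"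
      using Legendre_sign[of p a] that by auto
    then show ?thesis
      by (elim disjE) (simp_all add: minus_one_power_iff)
  qed
  have "Jacobi a n = (\<Prod>p\<in>prime_factors n. Legendre a (int p) ^ multiplicity p n)"
    unfolding Jacobi_def image_prod_mset_multiplicity
    by (rule prod.cong) (auto simp: count_prime_factorization_prime dest: in_prime_factors_imp_prime)
  also have "\<dots> = (\<Prod>p\<in>prime_factors n. if odd (multiplicity p n) then Legendre a (int p) else 1)"
    by (rule prod.cong[OF refl pf])
  also have "\<dots> = (\<Prod>p | p \<in> prime_factors n \<and> odd (multiplicity p n). Legendre a (int p))"
    by (rule prod.inter_filter[symmetric]) simp
  finally show ?thesis .
qed

section \<open>Squares modulo an odd number\<close>

text \<open>A unit modulo an odd number is a square if it is a square modulo each prime divisor.\<close>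

lemma QuadRes_odd_modulus:
  assumes "odd q" "coprime a (int q)" "\<And>p. prime p \<Longrightarrow> p dvd q \<Longrightarrow> Legendre a (int p) = 1"
  shows "QuadRes (int q) a"
  using assms
proof (induction rule: odd_nat_prime_induct)
  case one
  then show ?case by (simp add: QuadRes_def)
next
  case (mult p q)
  have cop: "coprime a (int p)" "coprime a (int q)"
    using mult.prems(1) by auto
  have "QuadRes (int q) a"
    using mult.IH mult.prems(2) cop by auto
  then obtain x where x: "[x\<^sup>2 = a] (mod int q)"
    by (auto simp: QuadRes_def)
  show ?case
  proof (cases "p dvd q")
    case True
    \<comment> \<open>Hensel's step\<close>
    obtain t where t: "a = x\<^sup>2 + int q * t"
      using x by (metis cong_iff_lin)
    have "coprime x (int p)"
    proof (rule ccontr)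
      assume "\<not> coprime x (int p)"
      then have "int p dvd x"
        using mult.hyps(1) prime_imp_coprime[of "int p" x] by (auto simp: coprime_commute)
      then have "int p dvd a"
        unfolding t using True by (simp add: power2_eq_square)
      with cop(1) mult.hyps(1) show False
        by (auto simp: coprime_absorb_right prime_nat_iff)
    qed
    then have "coprime (2 * x) (int p)"
      using mult.hyps(1,2) by (simp add: coprime_mult_left_iff odd_imp_coprime_nat)
    then obtain s where s: "[2 * x * s = t] (mod int p)"
      using cong_solve_coprime_int[of "2 * x" "int p"] by (metis cong_scalar_left mult.assoc mult.commute mult_1)
    then obtain k where k: "t = 2 * x * s + int p * k"
      by (metis cong_iff_lin)
    obtain c where c: "int q = int p * c"
      using True by (metis dvdE of_nat_dvd_iff)
    have "a = (x + int q * s)\<^sup>2 + int q * int p * (k - c * s\<^sup>2)"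
      unfolding t k using c by (simp add: power2_eq_square algebra_simps)
    then have "[(x + int q * s)\<^sup>2 = a] (mod int (p * q))"
      by (metis cong_iff_lin mult.commute of_nat_mult)
    then show ?thesis
      unfolding QuadRes_def by blast
  next
    case False
    then have "coprime (int p) (int q)"
      using mult.hyps(1) by (simp add: prime_imp_coprime)
    moreover have "Legendre a (int p) = 1"
      using mult.prems(2)[of p] mult.hyps(1) by simp
    then obtain y where y: "[y\<^sup>2 = a] (mod int p)"
      by (auto simp: Legendre_def QuadRes_def split: if_splits)
    ultimately obtain z where z: "[z = y] (mod int p)" "[z = x] (mod int q)"
      using binary_chinese_remainder_int by blast
    then have "[z\<^sup>2 = a] (mod int p)" "[z\<^sup>2 = a] (mod int q)"
      using x y cong_pow cong_trans by blast+
    then show ?thesis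
      using \<open>coprime (int p) (int q)\<close> unfolding QuadRes_def
      by (intro exI[of _ z]) (simp add: coprime_cong_mult)
  qed
qed

lemma exists_nonresidue:
  assumes "prime p" "odd p"
  shows "\<exists>a. coprime a p \<and> Legendre (int a) (int p) = -1"
proof (rule ccontr)
  assume "\<not> ?thesis"
  then have all: "Legendre (int a) (int p) = 1" if "coprime a p" for a
    using that Legendre_sign[OF assms(1), of "int a"] by auto
  have p2: "2 < p"
    using odd_prime_gt_2 assms by blast
  \<comment> \<open>otherwise squaring is a permutation of the residues, although \<open>1\<close> and \<open>p - 1\<close> have the same square\<close>
  let ?f = "\<lambda>y. y\<^sup>2 mod p"
  have "{..<p} \<subseteq> ?f ` {..<p}"
  proof
    fix a assume a: "a \<in> {..<p}"
    have "\<exists>y. [y\<^sup>2 = int a] (mod int p)"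
    proof (cases "a = 0")
      case True
      then show ?thesis by (intro exI[of _ 0]) simp
    next
      case False
      then have "coprime a p"
        using a assms(1) by (metis coprime_commute lessThan_iff nat_dvd_not_less neq0_conv prime_imp_coprime)
      then show ?thesis
        using all by (force simp: Legendre_def QuadRes_def split: if_splits)
    qed
    then obtain y where y: "[y\<^sup>2 = int a] (mod int p)" ..
    define z where "z = nat (y mod int p)"
    have z: "int z = y mod int p"
      using p2 by (simp add: z_def)
    then have "[(int z)\<^sup>2 = int a] (mod int p)"
      using y by (simp add: cong_def power_mod)
    then have "[z\<^sup>2 = a] (mod p)"
      by (simp flip: cong_int_iff)
    then have "?f z = a"
      using a by (simp add: cong_def)
    moreover have "z < p"
      using z p2 by (metis of_nat_0_less_iff of_nat_less_iff pos_mod_bound zero_less_numeral less_trans)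
    ultimately show "a \<in> ?f ` {..<p}"
      by blast
  qed
  then have "inj_on ?f {..<p}"
    by (intro finite_surj_inj) auto
  moreover have "?f 1 = ?f (p - 1)"
  proof -
    have "[int (p - 1) = -1] (mod int p)"
      using p2 by (simp add: of_nat_diff cong_iff_dvd_diff)
    then have "[(int (p - 1))\<^sup>2 = (-1)\<^sup>2] (mod int p)"
      by (rule cong_pow)
    then have "[int ((p - 1)\<^sup>2) = int 1] (mod int p)"
      by simp
    then show ?thesis
      unfolding cong_int_iff by (simp add: cong_def)
  qed
  ultimately have "1 = p - 1"
    by (rule inj_onD) (use p2 in auto)
  with p2 show False by simp
qed

section \<open>A coefficient with prescribed residue that represents a form of given determinant\<close>

text \<open>The nonprincipal character modulo 4.\<close>

definition sign4 :: "nat \<Rightarrow> int" where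
  "sign4 a = (if a mod 4 = 1 then 1 else if a mod 4 = 3 then -1 else 0)"

lemma sign4_mult: "sign4 (a * b) = sign4 a * sign4 b"
proof -
  have "a mod 4 \<in> {0, 1, 2, 3}" "b mod 4 \<in> {0, 1, 2, 3}"
    by auto
  moreover have "a * b mod 4 = (a mod 4) * (b mod 4) mod 4"
    by (simp add: mod_mult_eq)
  ultimately show ?thesis
    unfolding sign4_def by (elim insertE emptyE) simp_all
qed

lemma sign4_mod: "4 dvd N \<Longrightarrow> sign4 (a mod N) = sign4 a"
  by (simp add: sign4_def mod_mod_cancel)

lemma sign4_odd: "odd a \<Longrightarrow> sign4 a \<in> {-1, 1}"
proof -
  assume "odd a"
  then have "a mod 4 = 1 \<or> a mod 4 = 3"
    by presburger
  then show ?thesis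
    by (auto simp: sign4_def)
qed

text \<open>The residue symbols at the primes dividing \<open>q\<close> together with the sign modulo 4; the index \<open>2\<close>
  stands for the latter.\<close>

definition residue_sign :: "nat \<Rightarrow> nat \<Rightarrow> int" where
  "residue_sign i a = (if i = 2 then sign4 a else Legendre (int a) (int i))"

lemma independent_residue_signs:
  assumes "odd q"
  shows "independent_signs (insert 2 (prime_factors q)) residue_sign (4 * q)"
proof
  have "0 < q" using assms by (cases q) auto
  then show "0 < 4 * q" by simp
  fix i assume i: "i \<in> insert 2 (prime_factors q)"
  have prime_i: "prime i"
    using i by auto
  have dvd_i: "i dvd 4 * q"
    using i by auto
  have odd_i: "odd i" if "i \<noteq> 2"
    using that prime_i by (metis prime_prime_factor two_is_prime_nat)
  show "residue_sign i (a * b) = residue_sign i a * residue_sign i b" for a b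
    using prime_i odd_i by (simp add: residue_sign_def sign4_mult Legendre_mult)
  show "residue_sign i (a mod (4 * q)) = residue_sign i a" for a
  proof -
    have "[a mod (4 * q) = a] (mod i)"
      using dvd_i by (metis cong_def mod_mod_cancel)
    then have "Legendre (int (a mod (4 * q))) (int i) = Legendre (int a) (int i)"
      by (intro Legendre_cong) (simp only: cong_int_iff)
    then show ?thesis
      by (simp add: residue_sign_def sign4_mod)
  qed
  show "residue_sign i a \<in> {-1, 1}" if "coprime a (4 * q)" for a
  proof (cases "i = 2")
    case True
    have "odd a"
      using that by (auto simp: coprime_mult_right_iff)
    then show ?thesis
      using True sign4_odd by (simp add: residue_sign_def)
  next
    case False
    have "coprime (int a) (int i)"
      using that dvd_i coprime_divisors[of a a i "4 * q"] by simp
    then show ?thesis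
      using False Legendre_sign[OF prime_i] by (simp add: residue_sign_def)
  qed
next
  fix e :: "nat \<Rightarrow> int"
  assume e: "\<And>i. i \<in> insert 2 (prime_factors q) \<Longrightarrow> e i \<in> {-1, 1}"
  let ?K = "insert 2 (prime_factors q)"
  define m where "m i = (if i = 2 then 4 else i :: nat)" for i
  have K: "prime i \<and> (i \<noteq> 2 \<longrightarrow> odd i)" if "i \<in> ?K" for i
    using that by (auto dest: in_prime_factors_imp_prime) (metis prime_prime_factor two_is_prime_nat in_prime_factors_imp_prime)
  have "\<exists>a. coprime a i \<and> residue_sign i a = e i" if "i \<in> ?K" for i
  proof (cases "i = 2")
    case True
    have "coprime (if e i = 1 then 1 else 3) i \<and> residue_sign i (if e i = 1 then 1 else 3) = e i"
      using e[OF that] True by (auto simp: residue_sign_def sign4_def)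
    then show ?thesis ..
  next
    case False
    have "Legendre 1 (int i) = 1"
      using Legendre_square[of i 1] K[OF that] by simp
    then show ?thesis
      using exists_nonresidue[of i] K[OF that] False e[OF that]
      by (auto simp: residue_sign_def intro: exI[of _ 1])
  qed
  then obtain u where u: "\<And>i. i \<in> ?K \<Longrightarrow> coprime (u i) i \<and> residue_sign i (u i) = e i"
    by metis
  have "coprime (m i) (m j)" if "i \<in> ?K" "j \<in> ?K" "i \<noteq> j" for i j
  proof -
    have "coprime i j"
      using K that by (simp add: primes_coprime)
    moreover have "coprime 4 k" if "coprime 2 k" for k :: nat
      using that coprime_power_left_iff[of 2 2 k] by simp
    ultimately show ?thesis
      by (auto simp: m_def coprime_commute)
  qed
  then obtain a where a: "\<And>i. i \<in> ?K \<Longrightarrow> [a = u i] (mod m i)"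
    using chinese_remainder_nat[of ?K m u] by auto
  have m_dvd: "i dvd m i" for i
    by (simp add: m_def)
  have a': "[a = u i] (mod i)" if "i \<in> ?K" for i
    using cong_dvd_modulus_nat[OF a[OF that] m_dvd] .
  have cop: "coprime a i" if "i \<in> ?K" for i
    using u[OF that] a'[OF that] cong_imp_coprime cong_sym by blast
  have "coprime a (4 * q)"
  proof (rule ccontr)
    assume "\<not> ?thesis"
    then obtain p where p: "prime p" "p dvd a" "p dvd 4 * q"
      using prime_factor_nat[of "gcd a (4 * q)"] by (auto simp: coprime_iff_gcd_eq_1 simp del: coprime_imp_gcd_eq_1)
    have "p dvd 4 \<or> p dvd q"
      using p prime_dvd_mult_iff by blast
    moreover have "p = 2" if "p dvd 4"
      using that p(1) prime_dvd_power[of p 2 2] by (simp add: primes_dvd_imp_eq)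
    ultimately have "p \<in> ?K"
      using p(1) assms by (auto simp: in_prime_factors_iff intro: ccontr)
    then show False
      using cop[of p] p by (auto simp: coprime_absorb_right prime_nat_iff)
  qed
  moreover have "residue_sign i a = e i" if "i \<in> ?K" for i
  proof (cases "i = 2")
    case True
    have "a mod 4 = u 2 mod 4"
      using a[of 2] by (simp add: m_def cong_def)
    moreover have "sign4 a = sign4 (a mod 4)" for a
      by (simp add: sign4_mod)
    ultimately have "sign4 a = sign4 (u 2)"
      by metis
    then show ?thesis
      using u[OF that] True by (simp add: residue_sign_def)
  next
    case False
    have "Legendre (int a) (int i) = Legendre (int (u i)) (int i)"
      using a'[OF that] by (intro Legendre_cong) (simp only: cong_int_iff)
    then show ?thesis
      using u[OF that] False by (simp add: residue_sign_def)
  qed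
  ultimately show "\<exists>a. coprime a (4 * q) \<and> (\<forall>i\<in>?K. residue_sign i a = e i)"
    by blast
qed simp

text \<open>The equation \<open>r * c - b\<^sup>2 = eps * n\<close> makes \<open>r\<close> the first coefficient of a form of determinant
  \<open>eps * n\<close>, and the congruence says that \<open>r\<close> is \<open>eps * a\<close> times a square modulo \<open>q\<close>. If
  \<open>- eps * n\<close> is congruent to 3 modulo 4, its residue symbol involves the class of \<open>r\<close>
  modulo 4, which is free. If it is congruent to 1 and \<open>eps = 1\<close>, the sign of the integer \<open>r\<close> is free.
  Only the remaining case requires a condition on \<open>a\<close>.\<close>

lemma exists_representing_coefficient:
  fixes q n :: nat and a eps :: int
  assumes "odd q" "n dvd q" "coprime a (int q)" and eps: "eps \<in> {-1, 1}"
    and cond: "eps = 1 \<or> n mod 4 = 3 \<or> Jacobi a n = 1"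
  obtains r b c k where "odd r" "r * c - b\<^sup>2 = eps * int n" "[a * k\<^sup>2 * r = eps] (mod int q)"
proof -
  have "odd n" using assms(1,2) by (metis dvd_trans)
  then have n4: "n mod 4 = 1 \<or> n mod 4 = 3" by presburger
  have "0 < q" using assms(1) by (cases q) auto
  then have "0 < n" using assms(2) by (auto intro: Nat.gr0I)
  define P where "P = {p \<in> prime_factors n. odd (multiplicity p n)}"
  have P_sub: "P \<subseteq> prime_factors q"
    using assms(2) \<open>0 < q\<close> by (auto simp: P_def dest: dvd_prime_factors[OF gr_implies_not0])
  have "2 \<notin> P"
    using \<open>odd n\<close> by (auto simp: P_def)
  have "finite P"
    by (simp add: P_def)
  have cop_n: "coprime a (int n)"
    using assms(2,3) coprime_divisors[of a a "int n" "int q"] by simp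
  interpret independent_signs "insert 2 (prime_factors q)" residue_sign "4 * q"
    by (rule independent_residue_signs[OF assms(1)])
  have prod_P: "(\<Prod>i\<in>P. residue_sign i x) = Jacobi (int x) n" if "coprime x n" for x
  proof -
    have "(\<Prod>i\<in>P. residue_sign i x) = (\<Prod>i\<in>P. Legendre (int x) (int i))"
      using \<open>2 \<notin> P\<close> by (intro prod.cong) (auto simp: residue_sign_def)
    also have "\<dots> = Jacobi (int x) n"
      using Jacobi_eq_prod_odd_multiplicity[OF \<open>odd n\<close>, of "int x"] that by (simp add: P_def)
    finally show ?thesis .
  qed
  define d where "d = - eps * int n"
  have Leg_d: "Legendre d (int p) = Legendre (- eps) (int p) * (Jacobi (int p) n * (if p mod 4 = 3 \<and> n mod 4 = 3 then -1 else 1))"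
    if "prime p" "odd p" "coprime p n" for p
    using that \<open>odd n\<close> Legendre_mult[OF that(1,2), of "- eps" "int n"] Legendre_reciprocity[OF that(1,2) \<open>odd n\<close> that(3)]
    by (simp add: d_def)
  have Leg_1: "Legendre 1 (int p) = 1" if "prime p" for p
    using Legendre_square[OF that, of 1] by simp
  \<comment> \<open>the sign \<open>s\<close> of the coefficient, the set \<open>T\<close> of signs whose product is the residue symbol of the
    discriminant, and the prescribed sign \<open>e2\<close> modulo 4\<close>
  obtain s T e2 where s: "s \<in> {-1, 1 :: int}" and T: "T = P \<or> T = insert 2 P" and e2: "e2 \<in> {-1, 1}"
    and e_T: "Jacobi (s * eps * a) n * (if T = P then 1 else e2) = 1"
    and T_d: "\<And>p. prime p \<Longrightarrow> odd p \<Longrightarrow> coprime p n \<Longrightarrow> Legendre d (int p) = (\<Prod>i\<in>T. residue_sign i p)"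
  proof (cases "(eps = 1 \<and> n mod 4 = 1) \<or> (eps = -1 \<and> n mod 4 = 3)")
    case True
    show thesis
    proof (rule that[of 1 "insert 2 P" "Jacobi (eps * a) n"])
      have "coprime (eps * a) (int n)"
        using cop_n eps by auto
      then show sgn: "Jacobi (eps * a) n \<in> {-1, 1}"
        by (rule Jacobi_sign[OF \<open>odd n\<close>])
      have "insert 2 P \<noteq> P"
        using \<open>2 \<notin> P\<close> by auto
      then show "Jacobi (1 * eps * a) n * (if insert 2 P = P then 1 else Jacobi (eps * a) n) = 1"
        using sgn by auto
      fix p assume p: "prime p" "odd p" "coprime p n"
      have "p mod 4 = 1 \<or> p mod 4 = 3"
        using p(2) by presburger
      then show "Legendre d (int p) = (\<Prod>i\<in>insert 2 P. residue_sign i p)"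
        using True Leg_d[OF p] Legendre_minus_one[OF p(1,2)] Leg_1[OF p(1)] p \<open>2 \<notin> P\<close> \<open>finite P\<close> prod_P[OF p(3)]
        by (auto simp: residue_sign_def sign4_def)
    qed auto
  next
    case False
    then have ne: "(eps = 1 \<and> n mod 4 = 3) \<or> (eps = -1 \<and> n mod 4 = 1)"
      using eps n4 by auto
    show thesis
    proof (rule that[of "if eps = 1 then Jacobi a n else 1" P 1])
      have sgn: "Jacobi a n \<in> {-1, 1}"
        by (rule Jacobi_sign[OF \<open>odd n\<close> cop_n])
      then show "(if eps = 1 then Jacobi a n else 1) \<in> {-1, 1}"
        by simp
      have J1: "Jacobi 1 n = 1"
        using Jacobi_mult[OF \<open>odd n\<close>, of 1 1] Jacobi_sign[OF \<open>odd n\<close>, of 1] by auto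
      show "Jacobi ((if eps = 1 then Jacobi a n else 1) * eps * a) n * (if P = P then 1 else 1) = 1"
        using ne sgn cond J1 Jacobi_minus_one[OF \<open>odd n\<close>] Jacobi_mult[OF \<open>odd n\<close>, of "-1" a]
        by (auto split: if_splits)
      fix p assume p: "prime p" "odd p" "coprime p n"
      have "p mod 4 = 1 \<or> p mod 4 = 3"
        using p(2) by presburger
      then show "Legendre d (int p) = (\<Prod>i\<in>P. residue_sign i p)"
        using ne Leg_d[OF p] Legendre_minus_one[OF p(1,2)] Leg_1[OF p(1)] prod_P[OF p(3)]
        by auto
    qed auto
  qed
  define e where "e i = (if i = 2 then e2 else Legendre (s * eps * a) (int i))" for i :: nat
  have cop_sa: "coprime (s * eps * a) (int q)"
    using assms(3) s eps by auto
  have cop_sa_p: "coprime (s * eps * a) (int p)" if "p dvd q" for p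
    using cop_sa that coprime_divisors[of "s * eps * a" "s * eps * a" "int p" "int q"] by simp
  have e_sign: "e i \<in> {-1, 1}" if "i \<in> insert 2 (prime_factors q)" for i
    using that e2 Legendre_sign[of i "s * eps * a"] cop_sa_p[of i] by (auto simp: e_def)
  have "(\<Prod>i\<in>T. e i) = 1"
  proof -
    have "(\<Prod>i\<in>P. e i) = (\<Prod>i\<in>P. Legendre (s * eps * a) (int i))"
      using \<open>2 \<notin> P\<close> by (intro prod.cong) (auto simp: e_def)
    also have "\<dots> = Jacobi (s * eps * a) n"
      using Jacobi_eq_prod_odd_multiplicity[OF \<open>odd n\<close>, of "s * eps * a"] cop_n s eps by (auto simp: P_def)
    finally show ?thesis
      using T e_T \<open>2 \<notin> P\<close> \<open>finite P\<close> by (auto simp: e_def mult.commute split: if_splits)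
  qed
  moreover have "T \<subseteq> insert 2 (prime_factors q)"
    using T P_sub by auto
  ultimately obtain m where m: "0 < m" "coprime m (4 * q)"
    "\<And>i. i \<in> insert 2 (prime_factors q) \<Longrightarrow> residue_sign i m = e i"
    "\<And>p. prime p \<Longrightarrow> odd (multiplicity p m) \<Longrightarrow> (\<Prod>i\<in>T. residue_sign i p) = 1"
    using exists_prescribed_signs[of T e] e_sign by blast
  \<comment> \<open>square factors of \<open>m\<close> do not matter\<close>
  define r0 where "r0 = squarefree_part m"
  define w where "w = square_part m"
  have m_eq: "m = r0 * w\<^sup>2"
    unfolding r0_def w_def by (rule squarefree_decompose)
  have cop_r0: "coprime r0 (4 * q)" and cop_w: "coprime w (4 * q)"
    using m(2) unfolding m_eq by (auto simp: coprime_mult_left_iff)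
  have "odd r0"
    using cop_r0 by (auto simp: coprime_mult_right_iff)
  have "coprime r0 q" "coprime w q"
    using cop_r0 cop_w by (auto simp: coprime_mult_right_iff)
  have "coprime r0 n"
    using \<open>coprime r0 q\<close> assms(2) coprime_divisors[of r0 r0 n q] by simp
  have "QuadRes (int r0) d"
  proof (rule QuadRes_odd_modulus[OF \<open>odd r0\<close>])
    show "coprime d (int r0)"
      using \<open>coprime r0 n\<close> eps by (auto simp: d_def coprime_commute)
    fix p assume p: "prime p" "p dvd r0"
    have "multiplicity p r0 \<noteq> 0"
      using p \<open>odd r0\<close> by (metis multiplicity_eq_zero_iff not_prime_unit odd_pos neq0_conv)
    then have "odd (multiplicity p m)"
      using prime_multiplicity_squarefree_part[OF p(1), of m] by (auto simp: r0_def odd_iff_mod_2_eq_one)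
    moreover have "odd p" "coprime p n"
      using p(2) \<open>odd r0\<close> \<open>coprime r0 n\<close> coprime_divisors[of p r0 n n] by auto
    ultimately show "Legendre d (int p) = 1"
      using T_d[OF p(1)] m(4)[OF p(1)] by simp
  qed
  then obtain b where b: "[b\<^sup>2 = d] (mod int r0)"
    by (auto simp: QuadRes_def)
  define r where "r = s * int r0"
  have "int r0 dvd b\<^sup>2 - d"
    using b by (simp add: cong_iff_dvd_diff)
  then have "r dvd b\<^sup>2 - d"
    using s by (auto simp: r_def)
  then obtain c where c: "b\<^sup>2 - d = r * c" ..
  have "QuadRes (int q) (eps * a * r)"
  proof (rule QuadRes_odd_modulus[OF assms(1)])
    show "coprime (eps * a * r) (int q)"
      using assms(3) eps s \<open>coprime r0 q\<close> by (auto simp: r_def)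
    fix p assume p: "prime p" "p dvd q"
    have "odd p"
      using p assms(1) by (metis dvd_trans)
    have "p \<in> prime_factors q"
      using p \<open>0 < q\<close> by (simp add: in_prime_factors_iff)
    then have "Legendre (int m) (int p) = Legendre (s * eps * a) (int p)"
    proof -
      have "p \<noteq> 2"
        using \<open>odd p\<close> by auto
      then show ?thesis
        using m(3)[of p] \<open>p \<in> prime_factors q\<close> by (simp add: residue_sign_def e_def)
    qed
    moreover have "Legendre (int m) (int p) = Legendre (int r0) (int p)"
    proof -
      have "coprime (int w) (int p)"
        using \<open>coprime w q\<close> p(2) coprime_divisors[of w w p q] by simp
      then show ?thesis
        using Legendre_mult[OF p(1) \<open>odd p\<close>, of "int r0" "(int w)\<^sup>2"] Legendre_square[OF p(1)]
        by (simp add: m_eq)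
    qed
    moreover have "Legendre (eps * a * r) (int p) = Legendre (s * eps * a) (int p) * Legendre (int r0) (int p)"
      using Legendre_mult[OF p(1) \<open>odd p\<close>, of "s * eps * a" "int r0"] by (simp add: r_def mult_ac)
    ultimately have "Legendre (eps * a * r) (int p) = Legendre (s * eps * a) (int p) * Legendre (s * eps * a) (int p)"
      by simp
    then show "Legendre (eps * a * r) (int p) = 1"
      using Legendre_sign[OF p(1) cop_sa_p[OF p(2)]] by auto
  qed
  then obtain y where y: "[y\<^sup>2 = eps * a * r] (mod int q)"
    by (auto simp: QuadRes_def)
  have "coprime (eps * a * r) (int q)"
    using assms(3) eps s \<open>coprime r0 q\<close> by (auto simp: r_def)
  then have "coprime (y\<^sup>2) (int q)"
    using y cong_imp_coprime cong_sym by blast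
  then have "coprime y (int q)"
    by simp
  then obtain k where k: "[y * k = 1] (mod int q)"
    using cong_solve_coprime_int by blast
  have "[eps * (eps * a * r) * k\<^sup>2 = eps * y\<^sup>2 * k\<^sup>2] (mod int q)"
    using y by (intro cong_mult cong_refl) (rule cong_sym)
  also have "eps * y\<^sup>2 * k\<^sup>2 = eps * (y * k)\<^sup>2"
    by (simp add: power_mult_distrib)
  also have "[eps * (y * k)\<^sup>2 = eps * 1\<^sup>2] (mod int q)"
    using k by (intro cong_mult cong_refl cong_pow)
  finally have "[a * k\<^sup>2 * r = eps] (mod int q)"
    using eps by (auto simp: mult_ac)
  moreover have "odd r"
    using s \<open>odd r0\<close> by (auto simp: r_def)
  moreover have "r * c - b\<^sup>2 = eps * int n"
    using c by (simp add: d_def)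
  ultimately show ?thesis
    using that by blast
qed

section \<open>Integral binary forms\<close>

text \<open>The bilinear form of the adjugate \<open>[[C, -B], [-B, A]]\<close> of the symmetric matrix
  \<open>[[A, B], [B, C]]\<close>; it is the numerator of the pairing on the cokernel of that matrix.\<close>

definition form_value :: "int \<Rightarrow> int \<Rightarrow> int \<Rightarrow> int \<Rightarrow> int \<Rightarrow> int \<Rightarrow> int \<Rightarrow> int" where
  "form_value A B C x1 x2 y1 y2 = C * x1 * y1 - B * (x1 * y2 + x2 * y1) + A * x2 * y2"

lemma form_value_discriminant:
  "form_value A B C x1 x2 x1 x2 * form_value A B C y1 y2 y1 y2 - (form_value A B C x1 x2 y1 y2)\<^sup>2
     = (A * C - B\<^sup>2) * (x1 * y2 - x2 * y1)\<^sup>2"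
  unfolding form_value_def by (simp add: power2_eq_square algebra_simps)

text \<open>Over \<open>n\<close> congruent to 1 modulo 4, all values of an odd form of determinant \<open>-n\<close> that are coprime
  to \<open>n\<close> have Jacobi symbol 1.\<close>

lemma Jacobi_form_value:
  fixes n :: nat
  assumes det: "A * C - B\<^sup>2 = - int n" and n: "n mod 4 = 1"
    and odd_form: "odd A \<or> odd C"
    and coprime: "coprime (form_value A B C y1 y2 y1 y2) (int n)"
  shows "Jacobi (form_value A B C y1 y2 y1 y2) n = 1"
proof -
  let ?f = "\<lambda>z1 z2. form_value A B C z1 z2 z1 z2"
  have "odd n" using n by presburger
  \<comment> \<open>move the vector within its class modulo \<open>n\<close> so that the value becomes odd\<close>
  obtain w1 w2 where odd_value: "odd (?f (y1 + int n * w1) (y2 + int n * w2))"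
  proof (cases "odd A")
    case True
    have "odd (?f (y1 + int n * (if even y1 then 0 else 1)) (y2 + int n * (if even y2 then 1 else 0)))"
      using True \<open>odd n\<close> by (auto simp: form_value_def)
    then show ?thesis using that by blast
  next
    case False
    then have "odd C" using odd_form by simp
    then have "odd (?f (y1 + int n * (if even y1 then 1 else 0)) (y2 + int n * (if even y2 then 0 else 1)))"
      using \<open>odd n\<close> by (auto simp: form_value_def)
    then show ?thesis using that by blast
  qed
  define z1 z2 where "z1 = y1 + int n * w1" and "z2 = y2 + int n * w2"
  have value_cong: "[?f z1 z2 = ?f y1 y2] (mod int n)"
    unfolding form_value_def z1_def z2_def
    by (intro cong_add cong_diff cong_mult cong_refl) (simp_all add: cong_def)
  have odd_z: "odd (?f z1 z2)"
    using odd_value by (simp add: z1_def z2_def)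
  have cop_z: "coprime (?f z1 z2) (int n)"
    using value_cong coprime cong_imp_coprime cong_sym by blast
  define d where "d = gcd z1 z2"
  have "d \<noteq> 0"
    using odd_z by (auto simp: d_def form_value_def)
  obtain x1 x2 where x: "z1 = x1 * d" "z2 = x2 * d" "coprime x1 x2"
    using gcd_coprime_exists[of z1 z2] \<open>d \<noteq> 0\<close> unfolding d_def by auto
  have fz: "?f z1 z2 = d\<^sup>2 * ?f x1 x2"
    by (simp add: x form_value_def power2_eq_square algebra_simps)
  obtain u1 u2 where u: "x1 * u2 - x2 * u1 = 1"
  proof -
    obtain a b where "x1 * a + x2 * b = 1"
      using bezout_int[of x1 x2] x(3) by (auto simp: mult.commute)
    then show ?thesis
      using that[of a "- b"] by simp
  qed
  define v where "v = ?f x1 x2"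
  define m where "m = nat \<bar>v\<bar>"
  have m: "int m = \<bar>v\<bar>" by (simp add: m_def)
  have "odd v" "coprime d (int n)" "coprime v (int n)"
    using odd_z cop_z unfolding fz v_def by (auto simp: coprime_mult_left_iff)
  have "odd m"
    using \<open>odd v\<close> m by (metis even_abs_add_iff even_of_nat_iff add.right_neutral even_zero abs_dvd_iff dvd_abs_iff)
  have "coprime m n"
    using \<open>coprime v (int n)\<close> m by (metis coprime_abs_left_iff coprime_int_iff)
  moreover have "[(form_value A B C x1 x2 u1 u2)\<^sup>2 = int n] (mod int m)"
  proof -
    have "v * ?f u1 u2 - (form_value A B C x1 x2 u1 u2)\<^sup>2 = - int n"
      using form_value_discriminant[of A B C x1 x2 u1 u2] by (simp add: det u v_def)
    then have "(form_value A B C x1 x2 u1 u2)\<^sup>2 - int n = v * ?f u1 u2"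
      by simp
    then show ?thesis
      by (simp add: cong_iff_dvd_diff m)
  qed
  ultimately have Jm: "Jacobi (int m) n = 1"
    using Jacobi_eq_1_of_square_mod[OF \<open>odd m\<close> n] by blast
  have "v = int m \<or> v = (-1) * int m"
    using m by linarith
  then have "Jacobi v n = 1"
    using Jm Jacobi_mult[OF \<open>odd n\<close>, of "-1" "int m"] Jacobi_minus_one[OF \<open>odd n\<close>] n by auto
  moreover have "Jacobi (d\<^sup>2) n = 1"
    using Jacobi_sign[OF \<open>odd n\<close> \<open>coprime d (int n)\<close>] by (auto simp: power2_eq_square Jacobi_mult[OF \<open>odd n\<close>])
  ultimately have "Jacobi (?f z1 z2) n = 1"
    unfolding fz v_def by (simp add: Jacobi_mult[OF \<open>odd n\<close>])
  then show ?thesis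
    using Jacobi_cong[OF \<open>odd n\<close> value_cong] by simp
qed

lemma divide_diff_in_Ints_iff:
  assumes "(q :: int) \<noteq> 0"
  shows "(of_int x / of_int q - of_int y / of_int q :: rat) \<in> \<int> \<longleftrightarrow> [x = y] (mod q)"
proof -
  have "(of_int x / of_int q - of_int y / of_int q :: rat) = of_int (x - y) / of_int q"
    by (simp add: diff_divide_distrib)
  also have "\<dots> \<in> \<int> \<longleftrightarrow> q dvd x - y"
    using assms by (subst of_int_div_of_int_in_Ints_iff) simp
  finally show ?thesis
    by (simp add: cong_iff_dvd_diff)
qed

text \<open>Comparison of the pairing of the matrix \<open>[[A, B], [B, C]]\<close> with the diagonal pairing with entries
  \<open>a1 / q1\<close> and \<open>a2 / q2\<close>. The vectors \<open>x\<close> and \<open>y\<close>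
  stand for the images of the two orthogonal generators, and \<open>(s1, t1)\<close>, \<open>(s2, t2)\<close> for the
  coordinates of the two unit vectors with respect to these generators.\<close>

lemma presentation_invariants:
  fixes A B C x1 x2 y1 y2 s1 t1 s2 t2 a1 a2 :: int and q1 q2 :: nat
  defines "D \<equiv> A * C - B\<^sup>2"
  defines "L \<equiv> \<lambda>u1 u2 v1 v2. of_int (form_value A B C u1 u2 v1 v2) / (of_int D :: rat)"
  assumes "D \<noteq> 0" and q: "0 < q1" "0 < q2" "q1 dvd q2"
    and cop: "coprime a1 (int q1)" "coprime a2 (int q2)"
    and xx: "L x1 x2 x1 x2 - of_int a1 / of_nat q1 \<in> \<int>"
    and xy: "L x1 x2 y1 y2 \<in> \<int>"
    and yy: "L y1 y2 y1 y2 - of_int a2 / of_nat q2 \<in> \<int>"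
    and e11: "L 1 0 1 0 - (of_int (s1 * s1) * (of_int a1 / of_nat q1) + of_int (t1 * t1) * (of_int a2 / of_nat q2)) \<in> \<int>"
    and e12: "L 1 0 0 1 - (of_int (s1 * s2) * (of_int a1 / of_nat q1) + of_int (t1 * t2) * (of_int a2 / of_nat q2)) \<in> \<int>"
    and e22: "L 0 1 0 1 - (of_int (s2 * s2) * (of_int a1 / of_nat q1) + of_int (t2 * t2) * (of_int a2 / of_nat q2)) \<in> \<int>"
  obtains eps A' B' C' where "eps \<in> {-1, 1}" "A = int q1 * A'" "B = int q1 * B'" "C = int q1 * C'"
    "A' * C' - B'\<^sup>2 = eps * int (q2 div q1)" "QuadRes (int q1) (eps * a1 * a2)"
    "[eps * form_value A' B' C' y1 y2 y1 y2 = a2] (mod int q2)"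
proof -
  define n where "n = q2 div q1"
  have q2: "q2 = q1 * n" using q(3) by (simp add: n_def)
  have "0 < n" using q q2 by (cases n) auto
  define g where "g = gcd A (gcd B C)"
  have "g \<noteq> 0"
    using \<open>D \<noteq> 0\<close> by (auto simp: g_def D_def)
  have "g > 0" using \<open>g \<noteq> 0\<close> by (simp add: g_def order_less_le)
  have "g dvd A" "g dvd B" "g dvd C"
    by (auto simp: g_def intro: dvd_trans[OF gcd_dvd2])
  then obtain A' B' C' where A': "A = g * A'" and B': "B = g * B'" and C': "C = g * C'"
    by (metis dvdE)
  define D' where "D' = A' * C' - B'\<^sup>2"
  have D: "D = g * (g * D')"
    by (simp add: D_def D'_def A' B' C' power2_eq_square algebra_simps)
  then have "D' \<noteq> 0" using \<open>D \<noteq> 0\<close> by auto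
  have primitive: "gcd A' (gcd B' C') = 1"
  proof -
    have "g = g * gcd A' (gcd B' C')"
      using \<open>g > 0\<close> unfolding g_def[symmetric] A' B' C'
      by (metis A' B' C' g_def gcd_mult_distrib_int abs_of_pos)
    then show ?thesis using \<open>g \<noteq> 0\<close> by simp
  qed
  let ?f = "form_value A' B' C'"
  have form_g: "form_value A B C u1 u2 v1 v2 = g * ?f u1 u2 v1 v2" for u1 u2 v1 v2
    by (simp add: form_value_def A' B' C' algebra_simps)
  have L: "L u1 u2 v1 v2 = of_int (?f u1 u2 v1 v2) / of_int (g * D')" for u1 u2 v1 v2
    using \<open>g \<noteq> 0\<close> unfolding L_def form_g D by simp
  have a1n: "(of_int a1 / of_nat q1 :: rat) = of_int (int n * a1) / of_int (int q2)"
    using \<open>0 < n\<close> q unfolding q2 by simp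
  have diag: "of_int s * (of_int a1 / of_nat q1) + of_int t * (of_int a2 / of_nat q2)
      = (of_int (s * (int n * a1) + t * a2) / of_int (int q2) :: rat)" for s t
    unfolding a1n by (simp add: add_divide_distrib)
  \<comment> \<open>the denominator of the form is the exponent of the group\<close>
  have dvd_of_Ints: "g * D' dvd int q2 * ?f u1 u2 v1 v2"
    if "L u1 u2 v1 v2 - of_int z / of_int (int q2) \<in> \<int>" for u1 u2 v1 v2 z
  proof -
    have "of_int (int q2) * (L u1 u2 v1 v2 - of_int z / of_int (int q2)) \<in> (\<int> :: rat set)"
      by (rule Ints_mult[OF Ints_of_int that])
    then have "of_int (int q2) * L u1 u2 v1 v2 - of_int z \<in> (\<int> :: rat set)"
      using q(2) by (simp add: right_diff_distrib)
    then have "of_int (int q2) * L u1 u2 v1 v2 \<in> (\<int> :: rat set)"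
      using Ints_add[OF _ Ints_of_int[of z]] by fastforce
    then have "of_int (int q2 * ?f u1 u2 v1 v2) / (of_int (g * D') :: rat) \<in> \<int>"
      unfolding L by simp
    then show ?thesis
      using \<open>g \<noteq> 0\<close> \<open>D' \<noteq> 0\<close> by (subst (asm) of_int_div_of_int_in_Ints_iff) auto
  qed
  have "g * D' dvd int q2 * C'" "g * D' dvd int q2 * B'" "g * D' dvd int q2 * A'"
    using e11[unfolded diag, THEN dvd_of_Ints] e12[unfolded diag, THEN dvd_of_Ints]
      e22[unfolded diag, THEN dvd_of_Ints] by (simp_all add: form_value_def)
  then have "g * D' dvd gcd (int q2 * A') (gcd (int q2 * B') (int q2 * C'))"
    by (intro gcd_greatest)
  also have "gcd (int q2 * A') (gcd (int q2 * B') (int q2 * C')) = int q2 * gcd A' (gcd B' C')"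
    by (simp add: gcd_mult_distrib_int[symmetric])
  finally have 1: "g * D' dvd int q2"
    by (simp add: primitive)
  have 2: "int q2 dvd g * D'"
  proof -
    have "of_int (g * D') * (L y1 y2 y1 y2 - of_int a2 / of_nat q2) \<in> (\<int> :: rat set)"
      by (rule Ints_mult[OF Ints_of_int yy])
    moreover have "of_int (g * D') * L y1 y2 y1 y2 = (of_int (?f y1 y2 y1 y2) :: rat)"
      unfolding L using \<open>g \<noteq> 0\<close> \<open>D' \<noteq> 0\<close> by simp
    ultimately have "of_int (?f y1 y2 y1 y2) - of_int (g * D' * a2) / of_int (int q2) \<in> (\<int> :: rat set)"
      by (simp add: right_diff_distrib)
    then have "of_int (g * D' * a2) / of_int (int q2) \<in> (\<int> :: rat set)"
      using Ints_diff[OF Ints_of_int[of "?f y1 y2 y1 y2"]] by fastforce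
    then have "int q2 dvd g * D' * a2"
      using q(2) by (subst (asm) of_int_div_of_int_in_Ints_iff) auto
    then show ?thesis
      using cop(2) by (simp add: coprime_commute coprime_dvd_mult_left_iff)
  qed
  define eps where "eps = sgn D'"
  have eps: "eps \<in> {-1, 1}" and eps_sq: "eps * eps = 1"
    using \<open>D' \<noteq> 0\<close> by (auto simp: eps_def sgn_if)
  have "int q2 = \<bar>g * D'\<bar>"
    using 1 2 zdvd_antisym_abs[of "int q2" "g * D'"] by simp
  then have gD': "int q2 = g * (eps * D')"
  proof -
    have "\<bar>D'\<bar> = eps * D'"
      by (simp add: eps_def abs_sgn mult.commute)
    then show ?thesis
      using \<open>int q2 = \<bar>g * D'\<bar>\<close> \<open>g > 0\<close> by (simp add: abs_mult)
  qed
  have L': "L u1 u2 v1 v2 = of_int (eps * ?f u1 u2 v1 v2) / of_int (int q2)" for u1 u2 v1 v2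
    unfolding L gD' using eps by auto
  have q2_nz: "int q2 \<noteq> 0" using q by simp
  note cong = divide_diff_in_Ints_iff[OF q2_nz]
  have cxx: "[eps * ?f x1 x2 x1 x2 = int n * a1] (mod int q2)"
    using xx unfolding L' a1n cong .
  have cxy: "[eps * ?f x1 x2 y1 y2 = 0] (mod int q2)"
    using xy cong[of "eps * ?f x1 x2 y1 y2" 0] unfolding L' by simp
  have cyy: "[eps * ?f y1 y2 y1 y2 = a2] (mod int q2)"
    using yy cong[of "eps * ?f y1 y2 y1 y2" a2] unfolding L' by simp
  have c11: "[eps * ?f 1 0 1 0 = s1 * s1 * (int n * a1) + t1 * t1 * a2] (mod int q2)"
    using e11 unfolding L' diag cong .
  have c12: "[eps * ?f 1 0 0 1 = s1 * s2 * (int n * a1) + t1 * t2 * a2] (mod int q2)"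
    using e12 unfolding L' diag cong .
  have c22: "[eps * ?f 0 1 0 1 = s2 * s2 * (int n * a1) + t2 * t2 * a2] (mod int q2)"
    using e22 unfolding L' diag cong .
  have det: "eps * ?f u1 u2 u1 u2 * (eps * ?f v1 v2 v1 v2) - (eps * ?f u1 u2 v1 v2) * (eps * ?f u1 u2 v1 v2)
      = D' * (u1 * v2 - u2 * v1)\<^sup>2" for u1 u2 v1 v2
  proof -
    have "eps * ?f u1 u2 u1 u2 * (eps * ?f v1 v2 v1 v2) - (eps * ?f u1 u2 v1 v2) * (eps * ?f u1 u2 v1 v2)
      = (eps * eps) * (?f u1 u2 u1 u2 * ?f v1 v2 v1 v2 - (?f u1 u2 v1 v2)\<^sup>2)"
      by (simp add: algebra_simps power2_eq_square)
    then show ?thesis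
      by (simp add: eps_sq form_value_discriminant D'_def)
  qed
  define delta where "delta = x1 * y2 - x2 * y1"
  \<comment> \<open>comparison of the two determinants, in both directions\<close>
  have dx: "[D' * delta\<^sup>2 = int n * a1 * a2 - 0 * 0] (mod int q2)"
    using cong_diff[OF cong_mult[OF cxx cyy] cong_mult[OF cxy cxy]] unfolding det delta_def .
  have de: "[D' = int n * (a1 * a2 * (s1 * t2 - s2 * t1)\<^sup>2)] (mod int q2)"
    using cong_diff[OF cong_mult[OF c11 c22] cong_mult[OF c12 c12]] unfolding det
    by (simp add: power2_eq_square algebra_simps)
  have n_dvd_D': "int n dvd D'"
  proof -
    have "[D' = int n * (a1 * a2 * (s1 * t2 - s2 * t1)\<^sup>2)] (mod int n)"
      using de by (rule cong_dvd_modulus) (simp add: q2)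
    then show ?thesis
      by (metis cong_dvd_iff cong_sym dvd_triv_left)
  qed
  moreover have "D' dvd int n"
  proof -
    have D'_dvd: "D' dvd int q2"
      unfolding gD' by simp
    then have "[D' * delta\<^sup>2 = int n * a1 * a2] (mod D')"
      using dx by (simp add: cong_dvd_modulus)
    then have "D' dvd int n * a1 * a2"
      by (metis cong_dvd_iff dvd_triv_left)
    moreover have "coprime D' a2"
      using cop(2) D'_dvd coprime_divisors[of D' "int q2" a2 a2] by (simp add: coprime_commute)
    ultimately have "D' dvd int n * a1"
      by (simp add: coprime_dvd_mult_left_iff)
    then have "D' dvd gcd (int n * a1) (int n * int q1)"
      using D'_dvd by (intro gcd_greatest) (simp_all add: q2 mult.commute)
    also have "gcd (int n * a1) (int n * int q1) = int n * gcd a1 (int q1)"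
      by (simp add: gcd_mult_distrib_int[symmetric])
    finally show ?thesis
      using cop(1) by simp
  qed
  ultimately have "\<bar>D'\<bar> = int n"
    using zdvd_antisym_abs[of "int n" D'] by simp
  then have D'_n: "eps * D' = int n" and D'_eq: "D' = eps * int n"
    using \<open>D' \<noteq> 0\<close> by (auto simp: eps_def sgn_if split: if_splits)
  have g_q1: "g = int q1"
    using gD' \<open>0 < n\<close> unfolding D'_n q2 by simp
  have "[int n * (eps * delta\<^sup>2) = int n * (a1 * a2)] (mod (int n * int q1))"
    using dx unfolding D'_eq q2 by (simp add: mult_ac)
  then have "[eps * delta\<^sup>2 = a1 * a2] (mod int q1)"
    using \<open>0 < n\<close> by (simp add: cong_iff_dvd_diff flip: right_diff_distrib)
  then have "[eps * (eps * delta\<^sup>2) = eps * (a1 * a2)] (mod int q1)"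
    by (rule cong_mult[OF cong_refl])
  moreover have "eps * (eps * delta\<^sup>2) = delta\<^sup>2"
    using eps_sq by (simp flip: mult.assoc)
  ultimately have "QuadRes (int q1) (eps * a1 * a2)"
    unfolding QuadRes_def by (intro exI[of _ delta]) (simp add: mult.assoc)
  then show ?thesis
    using that[of eps A' B' C'] eps A' B' C' g_q1 D'_eq cyy by (simp add: D'_def n_def)
qed

text \<open>The sign of the determinant is determined by its class modulo 4.\<close>

lemma sign_exponent:
  assumes "odd Q" "u \<in> {-1, 1}" "eps \<in> {-1, 1}" "[eps * int Q = u] (mod 4)"
  shows "(-1) ^ nat ((int Q - u) div 2) = eps"
proof -
  have "0 \<le> (int Q - u) div 2"
    using assms(1,2) by (cases Q) auto
  then have "even (nat ((int Q - u) div 2)) \<longleftrightarrow> even ((int Q - u) div 2)"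
    by (simp add: even_nat_iff)
  moreover have "even ((int Q - u) div 2) \<longleftrightarrow> eps = 1"
  proof -
    have "odd (int Q)" using assms(1) by simp
    moreover have "int Q mod 4 = u mod 4" if "eps = 1"
      using assms(4) that by (simp add: cong_def)
    moreover have "(- int Q) mod 4 = u mod 4" if "eps = -1"
      using assms(4) that by (simp add: cong_def)
    ultimately show ?thesis
      using assms(2,3) by (elim insertE emptyE) (simp_all, presburger+)
  qed
  ultimately show ?thesis
    using assms(3) by (auto simp: minus_one_power_iff)
qed

section \<open>Bilinear pairings on abelian groups\<close>

lemma rat_class_add: "rat_class (x + y) = rat_class x + rat_class y"
  by (simp add: plus_rat_mod_int.abs_eq)

lemma rat_class_minus: "rat_class (- x) = - rat_class x"
  by (simp add: uminus_rat_mod_int.abs_eq)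

lemma rat_class_0: "rat_class 0 = 0"
  by (simp add: zero_rat_mod_int_def)

lemma rat_class_eq_0_iff: "rat_class x = 0 \<longleftrightarrow> x \<in> \<int>"
  using rat_class_eq_iff[of x 0] by (simp add: rat_class_0)

lemma rat_class_surj: obtains r where "v = rat_class r"
  by (metis Quotient3_abs_rep Quotient3_rat_mod_int)

lemma additive_eq_rat_class:
  assumes add: "\<And>i j :: int. h (i + j) = h i + h j" and one: "h 1 = rat_class r"
  shows "h k = rat_class (of_int k * r)"
proof -
  have h0: "h 0 = 0"
    using add[of 0 0] by simp
  show ?thesis
  proof (induction k rule: int_induct[of _ 0])
    case base
    then show ?case by (simp add: h0 rat_class_0)
  next
    case (step1 i)
    then show ?case by (simp add: add one distrib_right rat_class_add)
  next
    case (step2 i)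
    have "h i = h (i - 1) + h 1"
      using add[of "i - 1" 1] by simp
    then have "h (i - 1) = h i + - h 1"
      by simp
    also have "\<dots> = rat_class (of_int i * r + - r)"
      unfolding step2 one rat_class_add rat_class_minus ..
    finally show ?case by (simp add: left_diff_distrib)
  qed
qed

text \<open>An abelian group with a nondegenerate symmetric bilinear pairing into \<open>\<rat>/\<int>\<close>; finiteness is not assumed.\<close>

locale linking_pairing = comm_group G for G (structure) +
  fixes l :: "'a \<Rightarrow> 'a \<Rightarrow> rat_mod_int"
  assumes bilinear: "bilinear_pairing G l" and symmetric: "symmetric_pairing G l"
    and nondegenerate: "nondegenerate_pairing G l"
begin

lemma pair_mult_left: "\<lbrakk>x \<in> carrier G; y \<in> carrier G; z \<in> carrier G\<rbrakk> \<Longrightarrow> l (x \<otimes> y) z = l x z + l y z"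
  and pair_mult_right: "\<lbrakk>x \<in> carrier G; y \<in> carrier G; z \<in> carrier G\<rbrakk> \<Longrightarrow> l x (y \<otimes> z) = l x y + l x z"
  using bilinear unfolding bilinear_pairing_def by blast+

lemma pair_commute: "\<lbrakk>x \<in> carrier G; y \<in> carrier G\<rbrakk> \<Longrightarrow> l x y = l y x"
  using symmetric unfolding symmetric_pairing_def by blast

lemma pair_one_left: "y \<in> carrier G \<Longrightarrow> l \<one> y = 0"
  using pair_mult_left[of \<one> \<one> y] by simp

lemma eq_one_if_pair_eq_0: "x \<in> carrier G \<Longrightarrow> (\<And>y. y \<in> carrier G \<Longrightarrow> l x y = 0) \<Longrightarrow> x = \<one>"
  using nondegenerate unfolding nondegenerate_pairing_def by blast

lemma pair_int_pow_left:
  assumes "x \<in> carrier G" "y \<in> carrier G" "l x y = rat_class r"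
  shows "l (x [^] (k :: int)) y = rat_class (of_int k * r)"
  by (rule additive_eq_rat_class[of "\<lambda>k. l (x [^] k) y"]) (use assms in \<open>simp_all add: int_pow_mult pair_mult_left\<close>)

lemma pair_int_pow:
  assumes "x \<in> carrier G" "y \<in> carrier G" "l x y = rat_class r"
  shows "l (x [^] (s :: int)) (y [^] (t :: int)) = rat_class (of_int (s * t) * r)"
proof -
  have "l y x = rat_class r"
    using assms pair_commute by simp
  then have "l (y [^] t) x = rat_class (of_int t * r)"
    using assms pair_int_pow_left by blast
  then have "l x (y [^] t) = rat_class (of_int t * r)"
    using assms pair_commute by simp
  then show ?thesis
    using pair_int_pow_left[of x "y [^] t" "of_int t * r" s] assms by (simp add: mult.assoc)
qed

lemma pair_combination:
  assumes "x \<in> carrier G" "y \<in> carrier G"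
    and "l x x = rat_class a" "l x y = rat_class b" "l y y = rat_class c"
  shows "l (x [^] (s :: int) \<otimes> y [^] (t :: int)) (x [^] (s' :: int) \<otimes> y [^] (t' :: int))
      = rat_class (of_int (s * s') * a + of_int (s * t' + t * s') * b + of_int (t * t') * c)"
proof -
  have yx: "l y x = rat_class b"
    using assms pair_commute by simp
  have "l (x [^] s \<otimes> y [^] t) (x [^] s' \<otimes> y [^] t')
      = (l (x [^] s) (x [^] s') + l (x [^] s) (y [^] t')) + (l (y [^] t) (x [^] s') + l (y [^] t) (y [^] t'))"
    using assms(1,2) by (simp add: pair_mult_left pair_mult_right)
  also have "\<dots> = rat_class (of_int (s * s') * a) + rat_class (of_int (s * t') * b)
      + (rat_class (of_int (t * s') * b) + rat_class (of_int (t * t') * c))"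
    using assms yx by (simp add: pair_int_pow)
  finally show ?thesis
    by (simp add: algebra_simps flip: rat_class_add)
qed

lemma int_pow_combination_mult:
  assumes "x \<in> carrier G" "y \<in> carrier G"
  shows "(x [^] (s :: int) \<otimes> y [^] (t :: int)) \<otimes> (x [^] (s' :: int) \<otimes> y [^] (t' :: int))
      = x [^] (s + s') \<otimes> y [^] (t + t')"
  using assms by (simp add: int_pow_mult m_ac)

lemma int_pow_combination_pow:
  assumes "x \<in> carrier G" "y \<in> carrier G"
  shows "(x [^] (s :: int) \<otimes> y [^] (t :: int)) [^] (k :: int) = x [^] (s * k) \<otimes> y [^] (t * k)"
  using assms by (simp add: int_pow_distrib int_pow_pow)

lemma order_dvd_if_pair_self_pow_eq_0:
  assumes "x \<in> carrier G" "l x x = rat_class (of_int a / of_nat q)" "0 < q" "coprime a (int q)"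
    and "l (x [^] (k :: int)) x = 0"
  shows "int q dvd k"
proof -
  have "of_int k * (of_int a / of_nat q) \<in> (\<int> :: rat set)"
    using pair_int_pow_left[OF assms(1,1,2)] assms(5) by (simp add: rat_class_eq_0_iff)
  then have "of_int (k * a) / of_int (int q) \<in> (\<int> :: rat set)"
    by simp
  then have "int q dvd k * a"
    using assms(3) by (subst (asm) of_int_div_of_int_in_Ints_iff) auto
  then show ?thesis
    using assms(4) by (simp add: coprime_commute coprime_dvd_mult_left_iff)
qed

lemma self_pairing_coprime:
  assumes x: "x \<in> carrier G" "ord x = q" "0 < q" "l x x = rat_class (of_int a / of_nat q)"
    and span: "\<And>y. y \<in> carrier G \<Longrightarrow> \<exists>(s :: int) z. z \<in> carrier G \<and> l x z = 0 \<and> y = x [^] s \<otimes> z"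
  shows "coprime a (int q)"
proof (rule ccontr)
  assume "\<not> coprime a (int q)"
  define d where "d = gcd a (int q)"
  have d: "d > 0" "d dvd a" "d dvd int q" "d \<noteq> 1"
    using \<open>0 < q\<close> \<open>\<not> coprime a (int q)\<close> by (auto simp: d_def coprime_iff_gcd_eq_1 simp del: coprime_imp_gcd_eq_1)
  obtain m b where m: "int q = d * m" and b: "a = d * b"
    using d by (metis dvdE)
  have "m \<noteq> 0" using m \<open>0 < q\<close> by auto
  have "x [^] m = \<one>"
  proof (rule eq_one_if_pair_eq_0)
    fix y assume "y \<in> carrier G"
    then obtain s :: int and z where z: "z \<in> carrier G" "l x z = 0" "y = x [^] s \<otimes> z"
      using span by blast
    have "l (x [^] m) (x [^] s) = rat_class (of_int (m * s) * (of_int a / of_nat q))"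
      by (rule pair_int_pow[OF x(1,1,4)])
    also have "(of_int (m * s) * (of_int a / of_nat q) :: rat) = of_int (s * b)"
    proof -
      have "(of_nat q :: rat) = of_int (d * m)"
        using m by (metis of_int_of_nat_eq)
      then show ?thesis
        using d(1) \<open>m \<noteq> 0\<close> by (simp add: b)
    qed
    also have "rat_class (of_int (s * b)) = 0"
      by (simp add: rat_class_eq_0_iff)
    finally have "l (x [^] m) (x [^] s) = 0" .
    moreover have "l (x [^] m) z = 0"
      using pair_int_pow_left[of x z 0 m] x z by (simp add: rat_class_0)
    ultimately show "l (x [^] m) y = 0"
      using x(1) z by (simp add: pair_mult_right)
  qed (use x in simp)
  then have "int q dvd m"
    using int_pow_eq_id[OF x(1)] x(2) by simp
  then have "d * m dvd 1 * m"
    using m by simp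
  then have "d dvd 1"
    using \<open>m \<noteq> 0\<close> by (subst (asm) dvd_mult_cancel_right) simp
  then show False
    using d by simp
qed

lemma decomposition_elements:
  assumes "orthogonal_cyclic_decomposition G l g1 q1 g2 q2" "x \<in> carrier G"
  obtains s t :: int where "x = g1 [^] s \<otimes> g2 [^] t"
proof -
  have g: "g1 \<in> carrier G" "g2 \<in> carrier G" and "generate G {g1} <#> generate G {g2} = carrier G"
    using assms(1) by (auto simp: orthogonal_cyclic_decomposition_def orthogonal_sum_def)
  then have "x \<in> generate G {g1} <#> generate G {g2}"
    using assms(2) by simp
  then show ?thesis
    using that unfolding set_mult_def generate_pow[OF g(1)] generate_pow[OF g(2)] by auto
qed

lemma decomposition_orthogonal:
  assumes "orthogonal_cyclic_decomposition G l g1 q1 g2 q2"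
  shows "l g1 g2 = 0"
  using assms generate.incl[of g1 "{g1}" G] generate.incl[of g2 "{g2}" G]
  unfolding orthogonal_cyclic_decomposition_def orthogonal_sum_def by blast

lemma decomposition_pair:
  assumes dec: "orthogonal_cyclic_decomposition G l g1 q1 g2 q2"
    and num: "self_pairing_numerators l g1 q1 g2 q2 a1 a2"
  shows "l (g1 [^] (s :: int) \<otimes> g2 [^] (t :: int)) (g1 [^] (s' :: int) \<otimes> g2 [^] (t' :: int))
      = rat_class (of_int (s * s') * (of_int a1 / of_nat q1) + of_int (t * t') * (of_int a2 / of_nat q2))"
proof -
  have "g1 \<in> carrier G" "g2 \<in> carrier G"
    using dec by (auto simp: orthogonal_cyclic_decomposition_def)
  moreover have "l g1 g2 = rat_class 0"
    using decomposition_orthogonal[OF dec] by (simp add: rat_class_0)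
  ultimately show ?thesis
    using num pair_combination[of g1 g2] by (simp add: self_pairing_numerators_def)
qed

lemma decomposition_coprime:
  assumes dec: "orthogonal_cyclic_decomposition G l g1 q1 g2 q2"
    and num: "self_pairing_numerators l g1 q1 g2 q2 a1 a2"
  shows "coprime a1 (int q1)" "coprime a2 (int q2)"
proof -
  have g: "g1 \<in> carrier G" "g2 \<in> carrier G" "ord g1 = q1" "ord g2 = q2" "0 < q1" "0 < q2"
    using dec by (auto simp: orthogonal_cyclic_decomposition_def)
  have self: "l g1 g1 = rat_class (of_int a1 / of_nat q1)" "l g2 g2 = rat_class (of_int a2 / of_nat q2)"
    using num by (auto simp: self_pairing_numerators_def)
  have orth: "l g1 (g2 [^] t) = 0" "l g2 (g1 [^] t) = 0" for t :: int
    using pair_int_pow[of g1 g2 0 1 t] pair_int_pow[of g2 g1 0 1 t] g decomposition_orthogonal[OF dec]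
      pair_commute[of g1 g2] by (simp_all add: rat_class_0)
  show "coprime a1 (int q1)"
  proof (rule self_pairing_coprime[OF g(1,3,5) self(1)])
    fix y assume "y \<in> carrier G"
    then obtain s t :: int where "y = g1 [^] s \<otimes> g2 [^] t"
      using decomposition_elements[OF dec] by blast
    then show "\<exists>(s :: int) z. z \<in> carrier G \<and> l g1 z = 0 \<and> y = g1 [^] s \<otimes> z"
      using g orth by blast
  qed
  show "coprime a2 (int q2)"
  proof (rule self_pairing_coprime[OF g(2,4,6) self(2)])
    fix y assume "y \<in> carrier G"
    then obtain s t :: int where "y = g1 [^] s \<otimes> g2 [^] t"
      using decomposition_elements[OF dec] by blast
    then have "y = g2 [^] t \<otimes> g1 [^] s"
      using g m_comm by simp
    then show "\<exists>(s :: int) z. z \<in> carrier G \<and> l g2 z = 0 \<and> y = g2 [^] s \<otimes> z"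
      using g orth by blast
  qed
qed

lemma pair_eq_fraction:
  assumes "x \<in> carrier G" "y \<in> carrier G" "x [^] (q :: nat) = \<one>" "0 < q"
  obtains a :: int where "l x y = rat_class (of_int a / of_nat q)"
proof -
  obtain r where r: "l x y = rat_class r"
    by (rule rat_class_surj)
  have "l (x [^] int q) y = 0"
    using assms by (simp add: int_pow_int pair_one_left)
  then have "of_int (int q) * r \<in> \<int>"
    using pair_int_pow_left[OF assms(1,2) r] by (simp add: rat_class_eq_0_iff)
  then obtain a where "of_int (int q) * r = of_int a"
    by (auto elim: Ints_cases)
  then have "r = of_int a / of_nat q"
    using assms(4) by (simp add: field_simps)
  with r that show ?thesis by blast
qed

lemma exists_two_numerators:
  assumes dec: "orthogonal_cyclic_decomposition G l g1 q1 g2 q2"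
  shows "\<exists>a1 a2 b1 b2. self_pairing_numerators l g1 q1 g2 q2 a1 a2 \<and>
    self_pairing_numerators l g1 q1 g2 q2 b1 b2 \<and> a1 \<noteq> b1 \<and> a2 \<noteq> b2"
proof -
  have g: "g1 \<in> carrier G" "g2 \<in> carrier G" "ord g1 = q1" "ord g2 = q2" "0 < q1" "0 < q2"
    using dec by (auto simp: orthogonal_cyclic_decomposition_def)
  obtain a1 where a1: "l g1 g1 = rat_class (of_int a1 / of_nat q1)"
    using pair_eq_fraction[of g1 g1 q1] g pow_ord_eq_1 by blast
  obtain a2 where a2: "l g2 g2 = rat_class (of_int a2 / of_nat q2)"
    using pair_eq_fraction[of g2 g2 q2] g pow_ord_eq_1 by blast
  have shift: "rat_class (of_int (a + int q) / of_nat q) = rat_class (of_int a / of_nat q)" if "0 < q" for a q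
    using that by (simp add: rat_class_eq_iff add_divide_distrib)
  have "self_pairing_numerators l g1 q1 g2 q2 a1 a2"
    "self_pairing_numerators l g1 q1 g2 q2 (a1 + int q1) (a2 + int q2)"
    using a1 a2 shift g by (simp_all add: self_pairing_numerators_def)
  then show ?thesis
    using g by (intro exI[of _ a1] exI[of _ a2] exI[of _ "a1 + int q1"] exI[of _ "a2 + int q2"]) simp
qed

end

section \<open>Existence of an orthogonal decomposition\<close>

text \<open>A binary form that no prime divisor of \<open>e\<close> divides takes a value coprime to \<open>e\<close>.\<close>

lemma exists_coprime_form_value:
  fixes a b c :: int and e :: nat
  assumes "0 < e" and prim: "\<And>p. prime p \<Longrightarrow> p dvd e \<Longrightarrow> \<not> (int p dvd a \<and> int p dvd b \<and> int p dvd c)"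
  shows "\<exists>x y. coprime (a * x\<^sup>2 + b * x * y + c * y\<^sup>2) (int e)"
proof -
  \<comment> \<open>each prime divisor of \<open>e\<close> is made to divide all but one of the three terms\<close>
  define X where "X = {p \<in> prime_factors e. int p dvd a \<and> \<not> int p dvd c}"
  define Y where "Y = {p \<in> prime_factors e. \<not> int p dvd a}"
  define x where "x = int (\<Prod>X)"
  define y where "y = int (\<Prod>Y)"
  have dvd_prod: "int p dvd int (\<Prod>Z) \<longleftrightarrow> p \<in> Z" if "prime p" "Z \<subseteq> prime_factors e" for p Z
  proof
    have fin: "finite Z" using that(2) finite_subset by blast
    show "p \<in> Z" if dvd: "int p dvd int (\<Prod>Z)"
    proof -
      have "p dvd \<Prod>Z"
        using dvd of_nat_dvd_iff by blast
      then obtain r where "r \<in> Z" "p dvd r"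
        using prime_dvd_prod_iff[OF fin \<open>prime p\<close>, of "\<lambda>x. x"] by auto
      then show ?thesis
        using \<open>prime p\<close> \<open>Z \<subseteq> prime_factors e\<close> primes_dvd_imp_eq by blast
    qed
    show "int p dvd int (\<Prod>Z)" if "p \<in> Z"
      using dvd_prodI[OF fin that, of "\<lambda>x. x"] by (simp del: of_nat_prod)
  qed
  have "coprime (a * x\<^sup>2 + b * x * y + c * y\<^sup>2) (int e)"
  proof (rule ccontr)
    assume "\<not> ?thesis"
    then have "gcd (nat \<bar>a * x\<^sup>2 + b * x * y + c * y\<^sup>2\<bar>) e \<noteq> 1"
      by (metis coprime_abs_left_iff coprime_iff_gcd_eq_1 coprime_int_iff int_nat_eq abs_ge_zero)
    then obtain p where p: "prime p" "p dvd nat \<bar>a * x\<^sup>2 + b * x * y + c * y\<^sup>2\<bar>" "p dvd e"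
      by (metis gcd_greatest_iff prime_factor_nat)
    then have p_dvd: "int p dvd a * x\<^sup>2 + b * x * y + c * y\<^sup>2"
      by (metis abs_ge_zero dvd_abs_iff int_nat_eq of_nat_dvd_iff)
    have pe: "p \<in> prime_factors e"
      using p assms(1) by (simp add: in_prime_factors_iff)
    have "X \<subseteq> prime_factors e" "Y \<subseteq> prime_factors e"
      by (auto simp: X_def Y_def)
    then have px: "int p dvd x \<longleftrightarrow> p \<in> X" and py: "int p dvd y \<longleftrightarrow> p \<in> Y"
      unfolding x_def y_def using dvd_prod[OF p(1)] by blast+
    have prime_int: "prime (int p)" using p(1) by simp
    consider "\<not> int p dvd a" | "int p dvd a" "\<not> int p dvd c" | "int p dvd a" "int p dvd c"
      by blast
    then show False
    proof cases
      case 1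
      then have y: "int p dvd y" and x: "\<not> int p dvd x"
        using px py pe by (auto simp: X_def Y_def)
      have "int p dvd b * x * y + c * y\<^sup>2"
        using y by (simp add: power2_eq_square)
      then have "int p dvd a * x\<^sup>2"
        using p_dvd by (metis add.assoc dvd_add_left_iff)
      then show False
        using 1 x prime_int by (simp add: prime_dvd_mult_iff prime_dvd_power_iff)
    next
      case 2
      then have x: "int p dvd x" and y: "\<not> int p dvd y"
        using px py pe by (auto simp: X_def Y_def)
      have "int p dvd a * x\<^sup>2 + b * x * y"
        using x by (simp add: power2_eq_square)
      then have "int p dvd c * y\<^sup>2"
        using p_dvd dvd_add_right_iff by blast
      then show False
        using 2 y prime_int by (simp add: prime_dvd_mult_iff prime_dvd_power_iff)
    next
      case 3
      then have xy: "\<not> int p dvd x" "\<not> int p dvd y"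
        using px py pe by (auto simp: X_def Y_def)
      have "int p dvd b * x * y"
      proof -
        have "b * x * y = (a * x\<^sup>2 + b * x * y + c * y\<^sup>2) - (a * x\<^sup>2 + c * y\<^sup>2)"
          by simp
        then show ?thesis
          using p_dvd 3 by (metis dvd_add dvd_diff dvd_mult2)
      qed
      then show False
        using xy 3 prim[OF p(1,3)] prime_int by (simp add: prime_dvd_mult_iff)
    qed
  qed
  then show ?thesis by blast
qed

context linking_pairing
begin

lemma generate_two:
  assumes "S \<subseteq> carrier G" "finite S" "card S \<le> 2" "generate G S = carrier G"
  obtains s1 s2 where "s1 \<in> carrier G" "s2 \<in> carrier G"
    "\<And>x. x \<in> carrier G \<Longrightarrow> \<exists>(i :: int) (j :: int). x = s1 [^] i \<otimes> s2 [^] j"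
proof -
  obtain s1 s2 where s: "s1 \<in> carrier G" "s2 \<in> carrier G" "S \<subseteq> {s1, s2}"
  proof -
    consider "card S = 0" | "card S = 1" | "card S = 2"
      using assms(3) by linarith
    then show ?thesis
    proof cases
      case 1
      then show ?thesis using assms(2) that[of \<one> \<one>] by simp
    next
      case 2
      then obtain s where "S = {s}" by (auto simp: card_1_singleton_iff)
      then show ?thesis using assms(1) that[of s s] by simp
    next
      case 3
      then obtain s t where "S = {s, t}" by (auto simp: card_2_iff)
      then show ?thesis using assms(1) that[of s t] by simp
    qed
  qed
  have "\<exists>(i :: int) (j :: int). x = s1 [^] i \<otimes> s2 [^] j" if "x \<in> generate G S" for x
    using that
  proof induction
    case one
    have "\<one> = s1 [^] (0 :: int) \<otimes> s2 [^] (0 :: int)"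
      by simp
    then show ?case by blast
  next
    case (incl h)
    then have "h = s1 [^] (1 :: int) \<otimes> s2 [^] (0 :: int) \<or> h = s1 [^] (0 :: int) \<otimes> s2 [^] (1 :: int)"
      using s by auto
    then show ?case by blast
  next
    case (inv h)
    then have "inv h = s1 [^] (-1 :: int) \<otimes> s2 [^] (0 :: int) \<or> inv h = s1 [^] (0 :: int) \<otimes> s2 [^] (-1 :: int)"
      using s int_pow_neg[of s1 1] int_pow_neg[of s2 1] by auto
    then show ?case by blast
  next
    case (eng x y)
    then show ?case
      using int_pow_combination_mult[OF s(1,2)] by metis
  qed
  then show ?thesis
    using that[OF s(1,2)] assms(4) by simp
qed

lemma exists_orthogonal_decomposition:
  assumes odd_order: "odd (order G)"
    and S: "S \<subseteq> carrier G" "finite S" "card S \<le> 2" "generate G S = carrier G"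
  shows "\<exists>g1 q1 g2 q2. orthogonal_cyclic_decomposition G l g1 q1 g2 q2"
proof -
  have "0 < order G"
    using odd_order by (cases "order G") auto
  obtain s1 s2 where s: "s1 \<in> carrier G" "s2 \<in> carrier G"
    and span: "\<And>x. x \<in> carrier G \<Longrightarrow> \<exists>(i :: int) (j :: int). x = s1 [^] i \<otimes> s2 [^] j"
    by (rule generate_two[OF S]) blast
  \<comment> \<open>the exponent of the group\<close>
  define e where "e = (LEAST k :: nat. 0 < k \<and> (\<forall>x\<in>carrier G. x [^] k = \<one>))"
  have "\<exists>k :: nat. 0 < k \<and> (\<forall>x\<in>carrier G. x [^] k = \<one>)"
    using \<open>0 < order G\<close> pow_order_eq_1 by blast
  from LeastI_ex[OF this] have e: "0 < e" "\<And>x. x \<in> carrier G \<Longrightarrow> x [^] e = \<one>"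
    unfolding e_def[symmetric] by auto
  have e_dvd: "e dvd k" if k: "\<And>x. x \<in> carrier G \<Longrightarrow> x [^] k = \<one>" for k :: nat
  proof -
    have "x [^] gcd e k = \<one>" if "x \<in> carrier G" for x
      using e(2)[OF that] k[OF that] that by (simp add: pow_eq_id)
    then have "e \<le> gcd e k"
      unfolding e_def by (intro Least_le) (use e(1) in \<open>simp add: e_def[symmetric]\<close>)
    then have "gcd e k = e"
      using e(1) gcd_le1_nat[of e k] by linarith
    then show ?thesis
      by (metis gcd_dvd2)
  qed
  have "odd e"
    using e_dvd[of "order G"] pow_order_eq_1 odd_order by (metis dvd_trans)
  obtain a b c :: int where abc: "l s1 s1 = rat_class (of_int a / of_nat e)"
    "l s1 s2 = rat_class (of_int b / of_nat e)" "l s2 s2 = rat_class (of_int c / of_nat e)"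
    using pair_eq_fraction e s by metis
  have pair: "l (s1 [^] (i :: int) \<otimes> s2 [^] (j :: int)) (s1 [^] (i' :: int) \<otimes> s2 [^] (j' :: int))
      = rat_class (of_int (i * i' * a + (i * j' + j * i') * b + j * j' * c) / of_nat e)" for i j i' j'
    using pair_combination[OF s abc] by (simp add: add_divide_distrib)
  \<comment> \<open>otherwise, \<open>p\<close> being odd, raising to the power \<open>e div p\<close> would map everything to the radical\<close>
  have prim: "\<not> (int p dvd a \<and> int p dvd 2 * b \<and> int p dvd c)" if p: "prime p" "p dvd e" for p
  proof
    assume dvd: "int p dvd a \<and> int p dvd 2 * b \<and> int p dvd c"
    have "odd p" using p(2) \<open>odd e\<close> by (metis dvd_trans)
    then have "int p dvd b"
      using dvd p(1) by (simp add: coprime_dvd_mult_right_iff prime_int_nat_transfer)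
    then obtain a' b' c' where abc': "a = int p * a'" "b = int p * b'" "c = int p * c'"
      using dvd by (auto elim!: dvdE)
    obtain m where m: "e = p * m"
      using p(2) by blast
    have "0 < m" using e(1) m by (cases m) auto
    have "x [^] m = \<one>" if x: "x \<in> carrier G" for x
    proof (rule eq_one_if_pair_eq_0)
      fix y assume "y \<in> carrier G"
      then obtain i j i' j' :: int where xy: "x = s1 [^] i \<otimes> s2 [^] j" "y = s1 [^] i' \<otimes> s2 [^] j'"
        using span x by meson
      have "x [^] int m = s1 [^] (i * int m) \<otimes> s2 [^] (j * int m)"
        unfolding xy by (rule int_pow_combination_pow[OF s])
      then have "l (x [^] m) y = rat_class (of_int (i * int m * i' * a + (i * int m * j' + j * int m * i') * b + j * int m * j' * c) / of_nat e)"
        using pair[of "i * int m" "j * int m" i' j'] xy(2) by (simp add: int_pow_int)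
      also have "i * int m * i' * a + (i * int m * j' + j * int m * i') * b + j * int m * j' * c
          = int e * (i * i' * a' + (i * j' + j * i') * b' + j * j' * c')"
        by (simp add: abc' m algebra_simps)
      finally show "l (x [^] m) y = 0"
        using e(1) by (simp add: rat_class_eq_0_iff)
    qed (use x in simp)
    then have "e dvd m"
      by (rule e_dvd)
    then have "p * m \<le> 1 * m"
      using m \<open>0 < m\<close> dvd_imp_le by simp
    then show False
      using prime_gt_1_nat[OF p(1)] \<open>0 < m\<close> by simp
  qed
  let ?f = "\<lambda>x y. a * x\<^sup>2 + 2 * b * x * y + c * y\<^sup>2"
  obtain v1 v2 where v: "coprime v1 v2" "coprime (?f v1 v2) (int e)"
  proof -
    obtain z1 z2 where z: "coprime (?f z1 z2) (int e)"
      using exists_coprime_form_value[OF e(1) prim] by blast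
    show ?thesis
    proof (cases "gcd z1 z2 = 0")
      case True
      then have "z1 = 0" "z2 = 0" by auto
      then have "e = 1"
        using z by simp
      then show ?thesis
        using that[of 1 0] by simp
    next
      case False
      then obtain x1 x2 where x: "z1 = x1 * gcd z1 z2" "z2 = x2 * gcd z1 z2" "coprime x1 x2"
        using gcd_coprime_exists[of z1 z2] by auto
      have "?f z1 z2 = (gcd z1 z2)\<^sup>2 * ?f x1 x2"
        by (subst x(1), subst (2) x(1), subst x(2), subst (2) x(2)) (simp add: power2_eq_square algebra_simps)
      then have "coprime (?f x1 x2) (int e)"
        using z by (simp add: coprime_mult_left_iff)
      then show ?thesis
        using that x(3) by blast
    qed
  qed
  obtain w1 w2 where w: "v1 * w2 - v2 * w1 = 1"
  proof -
    obtain x y where "v1 * x + v2 * y = 1"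
      using bezout_int[of v1 v2] v(1) by (auto simp: mult.commute)
    then show ?thesis
      using that[of x "- y"] by simp
  qed
  \<comment> \<open>complete \<open>v\<close> to a basis \<open>v, w\<close> of \<open>\<int>\<^sup>2\<close> and make \<open>w\<close> orthogonal to \<open>v\<close> modulo \<open>e\<close>\<close>
  define beta where "beta = v1 * w1 * a + (v1 * w2 + v2 * w1) * b + v2 * w2 * c"
  obtain t where t: "[t * ?f v1 v2 = beta] (mod int e)"
  proof -
    obtain x where "[?f v1 v2 * x = 1] (mod int e)"
      using cong_solve_coprime_int[OF v(2)] by blast
    then have "[?f v1 v2 * x * beta = 1 * beta] (mod int e)"
      by (intro cong_mult cong_refl)
    then show ?thesis
      using that[of "x * beta"] by (simp add: mult_ac)
  qed
  define g2 where "g2 = s1 [^] v1 \<otimes> s2 [^] v2"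
  define g1 where "g1 = s1 [^] (w1 - t * v1) \<otimes> s2 [^] (w2 - t * v2)"
  have g: "g1 \<in> carrier G" "g2 \<in> carrier G"
    using s by (simp_all add: g1_def g2_def)
  have l22: "l g2 g2 = rat_class (of_int (?f v1 v2) / of_nat e)"
    unfolding g2_def pair by (simp add: power2_eq_square algebra_simps)
  have l12: "l g1 g2 = 0"
  proof -
    have "(w1 - t * v1) * v1 * a + ((w1 - t * v1) * v2 + (w2 - t * v2) * v1) * b + (w2 - t * v2) * v2 * c
        = beta - t * ?f v1 v2"
      by (simp add: beta_def power2_eq_square algebra_simps)
    moreover have "int e dvd beta - t * ?f v1 v2"
      using cong_sym[OF t] by (simp add: cong_iff_dvd_diff)
    ultimately show ?thesis
      unfolding g1_def g2_def pair rat_class_eq_0_iff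
      using e(1) of_int_div_of_int_in_Ints_iff[of "beta - t * ?f v1 v2" "int e", where ?'a = rat] by simp
  qed
  have orth: "l (g1 [^] i) (g2 [^] j) = 0" for i j :: int
    using pair_int_pow[OF g, of 0 i j] l12 by (simp add: rat_class_0)
  have e_dvd_j: "int e dvd j" if "l (g2 [^] j) g2 = 0" for j :: int
    using order_dvd_if_pair_self_pow_eq_0[OF g(2) l22 e(1) v(2) that] .
  have ord_g2: "ord g2 = e"
  proof (rule dvd_antisym)
    show "ord g2 dvd e"
      using e(2)[OF g(2)] pow_eq_id[OF g(2)] by blast
    have "l (g2 [^] int (ord g2)) g2 = 0"
      using g by (simp add: int_pow_int pair_one_left)
    then show "e dvd ord g2"
      using e_dvd_j of_nat_dvd_iff by blast
  qed
  have ord_g1: "ord g1 dvd e"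
    using e(2)[OF g(1)] pow_eq_id[OF g(1)] by blast
  have gen: "generate G {g1} = {g1 [^] (k :: int) |k. k \<in> UNIV}" "generate G {g2} = {g2 [^] (k :: int) |k. k \<in> UNIV}"
    using generate_pow g by auto
  have inter: "generate G {g1} \<inter> generate G {g2} = {\<one>}"
  proof -
    have "x = \<one>" if x: "x \<in> generate G {g1}" "x \<in> generate G {g2}" for x
    proof -
      obtain i j :: int where ij: "x = g1 [^] i" "x = g2 [^] j"
        using x unfolding gen by blast
      then have "l (g2 [^] j) g2 = 0"
        using orth[of i 1] g by simp
      then show ?thesis
        using e_dvd_j int_pow_eq_id[OF g(2)] ord_g2 ij(2) by simp
    qed
    moreover have "\<one> \<in> generate G {g1}" "\<one> \<in> generate G {g2}"
      by (rule generate.one)+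
    ultimately show ?thesis by blast
  qed
  have "carrier G \<subseteq> generate G {g1} <#> generate G {g2}"
  proof
    fix x assume "x \<in> carrier G"
    then obtain i j :: int where x: "x = s1 [^] i \<otimes> s2 [^] j"
      using span by blast
    \<comment> \<open>coordinates with respect to the basis \<open>v, w\<close>, and then with respect to \<open>v, w - t * v\<close>\<close>
    define k where "k = v1 * j - v2 * i"
    define m where "m = i * w2 - j * w1 + t * k"
    have "(w1 - t * v1) * k + v1 * m = (v1 * w2 - v2 * w1) * i" "(w2 - t * v2) * k + v2 * m = (v1 * w2 - v2 * w1) * j"
      by (simp_all add: k_def m_def algebra_simps)
    then have "g1 [^] k \<otimes> g2 [^] m = x"
      unfolding g1_def g2_def x int_pow_combination_pow[OF s] int_pow_combination_mult[OF s] by (simp add: w)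
    then show "x \<in> generate G {g1} <#> generate G {g2}"
      unfolding set_mult_def gen by blast
  qed
  moreover have "generate G {g1} <#> generate G {g2} \<subseteq> carrier G"
    unfolding set_mult_def gen using g by auto
  moreover have "subgroup (generate G {g1}) G" "subgroup (generate G {g2}) G"
    using g by (auto intro: generate_is_subgroup)
  moreover have "\<forall>x\<in>generate G {g1}. \<forall>y\<in>generate G {g2}. l x y = 0"
    unfolding gen using orth by auto
  moreover have "0 < ord g1" "odd (ord g1)"
    using ord_g1 e(1) \<open>odd e\<close> by (auto intro: Nat.gr0I dest: dvd_trans)
  ultimately have "orthogonal_cyclic_decomposition G l g1 (ord g1) g2 e"
    using g inter ord_g1 ord_g2 e(1) \<open>odd e\<close>
    unfolding orthogonal_cyclic_decomposition_def orthogonal_sum_def by auto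
  then show ?thesis by blast
qed

end

section \<open>Pairings presented by symmetric \<open>2 \<times> 2\<close> matrices\<close>

lemma matrix_vector_mult_2:
  fixes M :: "'a::comm_semiring_1 ^ 2 ^ 2"
  shows "(M *v x) $ 1 = M $ 1 $ 1 * x $ 1 + M $ 1 $ 2 * x $ 2"
    and "(M *v x) $ 2 = M $ 2 $ 1 * x $ 1 + M $ 2 $ 2 * x $ 2"
  by (simp_all add: matrix_vector_mult_def sum_2)

lemma symmetric_2: "transpose M = M \<Longrightarrow> M $ 2 $ 1 = (M :: 'a ^ 2 ^ 2) $ 1 $ 2"
proof -
  assume "transpose M = M"
  then have "transpose M $ 2 $ 1 = M $ 2 $ 1"
    by simp
  then show ?thesis
    by (simp add: transpose_def)
qed

lemma det_symmetric_2:
  fixes M :: "int ^ 2 ^ 2"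
  assumes "transpose M = M"
  shows "det M = M $ 1 $ 1 * M $ 2 $ 2 - (M $ 1 $ 2)\<^sup>2"
  using symmetric_2[OF assms] by (simp add: det_2 power2_eq_square)

lemma inverse_form_2:
  fixes M :: "int ^ 2 ^ 2"
  assumes sym: "transpose M = M" and "det M \<noteq> 0"
  shows "inverse_form M x y
    = of_int (form_value (M $ 1 $ 1) (M $ 1 $ 2) (M $ 2 $ 2) (x $ 1) (x $ 2) (y $ 1) (y $ 2)) / of_int (det M)"
proof -
  define R where "R = (map_matrix of_int M :: rat ^ 2 ^ 2)"
  define N where "N = matrix_inv R"
  have "invertible R"
    using assms(2) by (simp add: R_def invertible_det_nz det_map_of_int)
  then have inv: "N ** R = mat 1"
    by (simp add: N_def invertible_matrix_inv)
  define D where "D = (of_int (det M) :: rat)"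
  have "D \<noteq> 0" using assms(2) by (simp add: D_def)
  have R: "R $ i $ j = of_int (M $ i $ j)" for i j
    by (simp add: R_def)
  have D: "D = R $ 1 $ 1 * R $ 2 $ 2 - R $ 1 $ 2 * R $ 1 $ 2"
    unfolding D_def det_symmetric_2[OF sym] R by (simp add: power2_eq_square)
  have R21: "R $ 2 $ 1 = R $ 1 $ 2"
    unfolding R symmetric_2[OF sym] ..
  define Y where "Y = ((\<chi> j. of_int (y $ j)) :: rat ^ 2)"
  \<comment> \<open>Cramer's rule\<close>
  define Z where "Z = ((\<chi> i. if i = 1 then (R $ 2 $ 2 * Y $ 1 - R $ 1 $ 2 * Y $ 2) / D
      else (R $ 1 $ 1 * Y $ 2 - R $ 1 $ 2 * Y $ 1) / D) :: rat ^ 2)"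
  have Z: "Z $ 1 = (R $ 2 $ 2 * Y $ 1 - R $ 1 $ 2 * Y $ 2) / D"
    "Z $ 2 = (R $ 1 $ 1 * Y $ 2 - R $ 1 $ 2 * Y $ 1) / D"
    by (simp_all add: Z_def)
  have DZ: "D * Z $ 1 = R $ 2 $ 2 * Y $ 1 - R $ 1 $ 2 * Y $ 2" "D * Z $ 2 = R $ 1 $ 1 * Y $ 2 - R $ 1 $ 2 * Y $ 1"
    using \<open>D \<noteq> 0\<close> by (simp_all add: Z)
  have "D * (R *v Z) $ 1 = R $ 1 $ 1 * (D * Z $ 1) + R $ 1 $ 2 * (D * Z $ 2)"
    "D * (R *v Z) $ 2 = R $ 1 $ 2 * (D * Z $ 1) + R $ 2 $ 2 * (D * Z $ 2)"
    unfolding matrix_vector_mult_2 R21 by (simp_all add: algebra_simps)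
  then have "D * (R *v Z) $ 1 = D * Y $ 1" "D * (R *v Z) $ 2 = D * Y $ 2"
    unfolding DZ by (simp_all add: D algebra_simps)
  then have "R *v Z = Y"
    using \<open>D \<noteq> 0\<close> by (simp add: vec_eq_iff forall_2)
  then have "N *v Y = Z"
    by (metis inv matrix_vector_mul_assoc matrix_vector_mul_lid)
  then have "inverse_form M x y = of_int (x $ 1) * Z $ 1 + of_int (x $ 2) * Z $ 2"
    by (simp add: inverse_form_def N_def R_def Y_def sum_2)
  also have "\<dots> = (of_int (x $ 1) * (R $ 2 $ 2 * Y $ 1 - R $ 1 $ 2 * Y $ 2)
      + of_int (x $ 2) * (R $ 1 $ 1 * Y $ 2 - R $ 1 $ 2 * Y $ 1)) / D"
    unfolding Z by (simp add: add_divide_distrib)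
  also have "\<dots> = of_int (form_value (M $ 1 $ 1) (M $ 1 $ 2) (M $ 2 $ 2) (x $ 1) (x $ 2) (y $ 1) (y $ 2)) / D"
    by (simp add: form_value_def R Y_def algebra_simps)
  finally show ?thesis
    by (simp add: D_def)
qed

lemma odd_square_mult_mod_4:
  fixes q n :: nat
  assumes "odd q"
  shows "q * (q * n) mod 4 = n mod 4"
proof -
  have "q mod 4 = 1 \<or> q mod 4 = 3"
    using assms by presburger
  moreover have "q * q mod 4 = (q mod 4) * (q mod 4) mod 4"
    by (simp add: mod_mult_eq)
  ultimately have "q * q mod 4 = 1"
    by (elim disjE) simp_all
  moreover have "q * (q * n) mod 4 = (q * q mod 4) * n mod 4"
    by (simp add: mod_mult_left_eq mult.assoc)
  ultimately show ?thesis
    by simp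
qed

lemma group_int_vec: "group (int_vec_group :: (int ^ 'n) monoid)"
proof (rule groupI)
  fix x :: "int ^ 'n"
  show "\<exists>y\<in>carrier int_vec_group. y \<otimes>\<^bsub>int_vec_group\<^esub> x = \<one>\<^bsub>int_vec_group\<^esub>"
    by (rule bexI[of _ "- x"]) (simp_all add: int_vec_group_def)
qed (simp_all add: int_vec_group_def add.assoc)

context linking_pairing
begin

lemma conditions_of_presentation:
  fixes M :: "int ^ 2 ^ 2"
  assumes dec: "orthogonal_cyclic_decomposition G l g1 q1 g2 q2"
    and num: "self_pairing_numerators l g1 q1 g2 q2 a1 a2"
    and u: "u \<in> {-1, 1}"
    and M: "presents M G l" "odd_matrix M" "[det M = u] (mod 4)"
  shows "condition_B a1 a2 q1 q2 u"
proof -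
  have sym: "transpose M = M" and det: "det M \<noteq> 0"
    using M(1) by (auto simp: presents_def)
  obtain \<phi> where \<phi>: "\<phi> \<in> iso G (cokernel M)"
    "\<And>x y. x \<in> carrier G \<Longrightarrow> y \<in> carrier G \<Longrightarrow> matrix_pairing M (\<phi> x) (\<phi> y) = l x y"
    using M(1) by (auto simp: presents_def isometric_pairings_def)
  let ?c = "\<lambda>x. range (\<lambda>v. M *v v) #>\<^bsub>int_vec_group\<^esub> x"
  have carrier_cok: "carrier (cokernel M) = range ?c"
    unfolding cokernel_def carrier_FactGroup by (simp add: int_vec_group_def)
  have bij: "\<phi> ` carrier G = range ?c"
    using \<phi>(1) unfolding carrier_cok[symmetric] by (simp add: iso_def bij_betw_def)
  have g: "g1 \<in> carrier G" "g2 \<in> carrier G" "0 < q1" "0 < q2" "odd q1" "odd q2" "q1 dvd q2"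
    using dec by (auto simp: orthogonal_cyclic_decomposition_def)
  have image: "\<exists>v. \<phi> x = ?c v" if "x \<in> carrier G" for x
    using bij that by blast
  obtain x y where x: "\<phi> g1 = ?c x" and y: "\<phi> g2 = ?c y"
    using image g by meson
  have preimage: "\<exists>s t. \<phi> (g1 [^] (s :: int) \<otimes> g2 [^] (t :: int)) = ?c v" for v
  proof -
    have "?c v \<in> \<phi> ` carrier G"
      unfolding bij by blast
    then obtain z where "z \<in> carrier G" "\<phi> z = ?c v"
      by fastforce
    then show ?thesis
      using decomposition_elements[OF dec, of z] by metis
  qed
  define e1 e2 :: "int ^ 2" where "e1 = vector [1, 0]" and "e2 = vector [0, 1]"
  have e: "e1 $ 1 = 1" "e1 $ 2 = 0" "e2 $ 1 = 0" "e2 $ 2 = 1"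
    by (simp_all add: e1_def e2_def vector_2)
  obtain s1 t1 where st1: "\<phi> (g1 [^] (s1 :: int) \<otimes> g2 [^] (t1 :: int)) = ?c e1"
    using preimage by blast
  obtain s2 t2 where st2: "\<phi> (g1 [^] (s2 :: int) \<otimes> g2 [^] (t2 :: int)) = ?c e2"
    using preimage by blast
  define A B C where "A = M $ 1 $ 1" and "B = M $ 1 $ 2" and "C = M $ 2 $ 2"
  have det_eq: "det M = A * C - B\<^sup>2"
    unfolding det_symmetric_2[OF sym] A_def B_def C_def ..
  define L where "L u1 u2 v1 v2 = of_int (form_value A B C u1 u2 v1 v2) / (of_int (A * C - B\<^sup>2) :: rat)" for u1 u2 v1 v2
  have pair_L: "rat_class (L (v $ 1) (v $ 2) (w $ 1) (w $ 2)) = l z z'"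
    if "\<phi> z = ?c v" "\<phi> z' = ?c w" "z \<in> carrier G" "z' \<in> carrier G" for v w z z'
    using \<phi>(2)[OF that(3,4)] matrix_pairing_coset[OF sym det, of v w] inverse_form_2[OF sym det, of v w] that(1,2)
    by (simp add: L_def det_eq A_def B_def C_def)
  have self: "l g1 g1 = rat_class (of_int a1 / of_nat q1)" "l g2 g2 = rat_class (of_int a2 / of_nat q2)"
    using num by (auto simp: self_pairing_numerators_def)
  have xx: "L (x $ 1) (x $ 2) (x $ 1) (x $ 2) - of_int a1 / of_nat q1 \<in> \<int>"
    using pair_L[OF x x] g self by (simp flip: rat_class_eq_iff)
  have xy: "L (x $ 1) (x $ 2) (y $ 1) (y $ 2) \<in> \<int>"
    using pair_L[OF x y] g decomposition_orthogonal[OF dec] by (simp flip: rat_class_eq_0_iff)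
  have yy: "L (y $ 1) (y $ 2) (y $ 1) (y $ 2) - of_int a2 / of_nat q2 \<in> \<int>"
    using pair_L[OF y y] g self by (simp flip: rat_class_eq_iff)
  note unit = decomposition_pair[OF dec num]
  have e11: "L 1 0 1 0 - (of_int (s1 * s1) * (of_int a1 / of_nat q1) + of_int (t1 * t1) * (of_int a2 / of_nat q2)) \<in> \<int>"
    using pair_L[OF st1 st1] g unfolding e unit by (simp flip: rat_class_eq_iff)
  have e12: "L 1 0 0 1 - (of_int (s1 * s2) * (of_int a1 / of_nat q1) + of_int (t1 * t2) * (of_int a2 / of_nat q2)) \<in> \<int>"
    using pair_L[OF st1 st2] g unfolding e unit by (simp flip: rat_class_eq_iff)
  have e22: "L 0 1 0 1 - (of_int (s2 * s2) * (of_int a1 / of_nat q1) + of_int (t2 * t2) * (of_int a2 / of_nat q2)) \<in> \<int>"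
    using pair_L[OF st2 st2] g unfolding e unit by (simp flip: rat_class_eq_iff)
  obtain eps A' B' C' where eps: "eps \<in> {-1, 1}"
    and ABC: "A = int q1 * A'" "B = int q1 * B'" "C = int q1 * C'"
    and det': "A' * C' - B'\<^sup>2 = eps * int (q2 div q1)" and res: "QuadRes (int q1) (eps * a1 * a2)"
    and val: "[eps * form_value A' B' C' (y $ 1) (y $ 2) (y $ 1) (y $ 2) = a2] (mod int q2)"
    by (rule presentation_invariants[of A C B q1 q2 a1 a2 "x $ 1" "x $ 2" "y $ 1" "y $ 2" s1 t1 s2 t2])
       (use det det_eq g decomposition_coprime[OF dec num] xx xy yy e11 e12 e22 in \<open>simp_all add: L_def\<close>)
  define n where "n = q2 div q1"
  have q2: "q2 = q1 * n" using g(7) by (simp add: n_def)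
  have det_M: "det M = eps * int (q1 * q2)"
  proof -
    have "det M = int q1 * int q1 * (A' * C' - B'\<^sup>2)"
      unfolding det_eq ABC by (simp add: power2_eq_square algebra_simps)
    then show ?thesis
      unfolding det' n_def[symmetric] q2 by simp
  qed
  have "odd (q1 * q2)" using g by simp
  then have sign: "(-1) ^ nat ((int (q1 * q2) - u) div 2) = eps"
    using sign_exponent[of "q1 * q2" u eps] u eps M(3) unfolding det_M by blast
  have B1: "condition_B1 a1 a2 q1 q2 u"
    unfolding condition_B1_def sign using res .
  have B2: "condition_B2 a2 q1 q2 u"
    unfolding condition_B2_def
  proof (rule ccontr)
    assume neg: "\<not> (u = 1 \<or> [q1 * q2 = 3] (mod 4) \<or> Jacobi a2 (q2 div q1) = 1)"
    have "u = -1" using neg u by auto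
    have q_mod: "q1 * q2 mod 4 = 1"
    proof -
      have "q1 * q2 mod 4 = 1 \<or> q1 * q2 mod 4 = 3"
        using \<open>odd (q1 * q2)\<close> by presburger
      then show ?thesis
        using neg by (simp add: cong_def)
    qed
    have "eps = -1"
    proof (rule ccontr)
      assume "eps \<noteq> -1"
      then have "[int (q1 * q2) = -1] (mod int 4)"
        using eps M(3) \<open>u = -1\<close> unfolding det_M by auto
      then have "[int (q1 * q2) = int 3] (mod int 4)"
        by (simp add: cong_def)
      then have "[q1 * q2 = 3] (mod 4)"
        by (simp only: cong_int_iff)
      then show False using neg by simp
    qed
    have "n mod 4 = 1"
      using q_mod odd_square_mult_mod_4[OF g(5), of n] unfolding q2 by simp
    then have "odd n" by presburger
    let ?v = "form_value A' B' C' (y $ 1) (y $ 2) (y $ 1) (y $ 2)"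
    have val': "[(-1) * ?v = a2] (mod int q2)"
      using val \<open>eps = -1\<close> by simp
    have "coprime a2 (int q2)"
      by (rule decomposition_coprime[OF dec num])
    then have "coprime ((-1) * ?v) (int q2)"
      using val' cong_imp_coprime cong_sym by blast
    have "n dvd q2" unfolding q2 by simp
    then have cop_v: "coprime ?v (int n)"
      using \<open>coprime ((-1) * ?v) (int q2)\<close> coprime_divisors[of ?v ?v "int n" "int q2"] by simp
    obtain i where "odd (M $ i $ i)"
      using M(2) by (auto simp: odd_matrix_def)
    then have "odd A \<or> odd C"
      using exhaust_2[of i] by (auto simp: A_def C_def)
    then have odd': "odd A' \<or> odd C'"
      unfolding ABC by auto
    have "Jacobi ?v n = 1"
      using Jacobi_form_value[OF _ \<open>n mod 4 = 1\<close> odd' cop_v] det' \<open>eps = -1\<close>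
      by (simp add: n_def)
    then have "Jacobi ((-1) * ?v) n = 1"
      using Jacobi_minus_one[OF \<open>odd n\<close>] \<open>n mod 4 = 1\<close> by (simp add: Jacobi_mult[OF \<open>odd n\<close>] del: mult_minus1 mult_minus_left)
    moreover have "[(-1) * ?v = a2] (mod int n)"
      using val' \<open>n dvd q2\<close> by (meson cong_dvd_modulus of_nat_dvd_iff)
    ultimately have "Jacobi a2 n = 1"
      using Jacobi_cong[OF \<open>odd n\<close>] by metis
    then show False
      using neg by (simp add: n_def)
  qed
  show ?thesis
    using B1 B2 by (simp add: condition_B_def)
qed

text \<open>A surjection from \<open>\<int>\<^sup>2\<close> that carries the form \<open>M\<^sup>-\<^sup>1\<close> to the pairing has kernel \<open>M \<int>\<^sup>2\<close>, so
  it identifies the cokernel of \<open>M\<close> with the group.\<close>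

lemma presents_of_surjection:
  fixes M :: "int ^ 2 ^ 2" and h :: "int ^ 2 \<Rightarrow> 'a"
  assumes sym: "transpose M = M" and det: "det M \<noteq> 0"
    and closed: "\<And>v. h v \<in> carrier G" and add: "\<And>v w. h (v + w) = h v \<otimes> h w"
    and surj: "\<And>x. x \<in> carrier G \<Longrightarrow> \<exists>v. h v = x"
    and pair: "\<And>v w. l (h v) (h w) = rat_class (inverse_form M v w)"
  shows "presents M G l"
proof -
  let ?V = "int_vec_group :: (int ^ 2) monoid"
  let ?K = "range (\<lambda>v. M *v v)"
  let ?c = "\<lambda>x. ?K #>\<^bsub>?V\<^esub> x"
  interpret V: group ?V
    by (rule group_int_vec)
  interpret h: group_hom ?V G h
    by unfold_locales (auto simp: hom_def int_vec_group_def closed add)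
  have h0: "h 0 = \<one>"
    using h.hom_one by (simp add: int_vec_group_def)
  \<comment> \<open>by nondegeneracy, the kernel consists of the vectors that pair integrally with everything\<close>
  have h_eq_one_iff: "h v = \<one> \<longleftrightarrow> (\<forall>w. inverse_form M v w \<in> \<int>)" for v
  proof
    assume "h v = \<one>"
    then show "\<forall>w. inverse_form M v w \<in> \<int>"
      using pair[of v] closed pair_one_left by (simp flip: rat_class_eq_0_iff)
  next
    assume *: "\<forall>w. inverse_form M v w \<in> \<int>"
    show "h v = \<one>"
    proof (rule eq_one_if_pair_eq_0[OF closed])
      fix y assume "y \<in> carrier G"
      then obtain w where "h w = y" using surj by blast
      then show "l (h v) y = 0"
        using pair[of v w] * by (simp add: rat_class_eq_0_iff)
    qed
  qed
  define A B C where "A = M $ 1 $ 1" and "B = M $ 1 $ 2" and "C = M $ 2 $ 2"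
  have D: "det M = A * C - B\<^sup>2"
    unfolding det_symmetric_2[OF sym] A_def B_def C_def ..
  have kernel: "kernel ?V G h = ?K"
  proof (rule Set.set_eqI)
    fix v
    have "v \<in> kernel ?V G h \<longleftrightarrow> h v = \<one>"
      by (simp add: kernel_def int_vec_group_def)
    also have "\<dots> \<longleftrightarrow> v \<in> ?K"
    proof
      assume "h v = \<one>"
      then have int: "inverse_form M v w \<in> \<int>" for w
        using h_eq_one_iff by blast
      have ints: "(of_int (form_value A B C (v $ 1) (v $ 2) (w $ 1) (w $ 2)) / of_int (det M) :: rat) \<in> \<int>" for w :: "int ^ 2"
        using int[of w] unfolding inverse_form_2[OF sym det] A_def B_def C_def .
      have dvd: "det M dvd form_value A B C (v $ 1) (v $ 2) (w $ 1) (w $ 2)" for w :: "int ^ 2"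
        using ints[of w] det by (subst (asm) of_int_div_of_int_in_Ints_iff) simp
      obtain z1 where z1: "C * v $ 1 - B * v $ 2 = det M * z1"
        using dvd[of "vector [1, 0]"] by (auto simp: form_value_def vector_2 elim: dvdE)
      obtain z2 where z2: "A * v $ 2 - B * v $ 1 = det M * z2"
        using dvd[of "vector [0, 1]"] by (auto simp: form_value_def vector_2 elim: dvdE)
      have "det M * (A * z1 + B * z2) = det M * v $ 1"
      proof -
        have "det M * (A * z1 + B * z2) = A * (det M * z1) + B * (det M * z2)"
          by (simp add: algebra_simps)
        also have "\<dots> = det M * v $ 1"
          unfolding z1[symmetric] z2[symmetric] by (simp add: D power2_eq_square algebra_simps)
        finally show ?thesis .
      qed
      moreover have "det M * (B * z1 + C * z2) = det M * v $ 2"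
      proof -
        have "det M * (B * z1 + C * z2) = B * (det M * z1) + C * (det M * z2)"
          by (simp add: algebra_simps)
        also have "\<dots> = det M * v $ 2"
          unfolding z1[symmetric] z2[symmetric] by (simp add: D power2_eq_square algebra_simps)
        finally show ?thesis .
      qed
      ultimately have "M *v vector [z1, z2] = v"
        using det symmetric_2[OF sym]
        by (simp add: vec_eq_iff forall_2 matrix_vector_mult_2 vector_2 A_def B_def C_def)
      then show "v \<in> ?K" by (metis rangeI)
    next
      assume "v \<in> ?K"
      then obtain w where v: "v = M *v w" by blast
      have "inverse_form M v x \<in> \<int>" for x
        using inverse_form_shift[OF det, of x 0 w]
        by (simp add: v inverse_form_commute[OF sym det, of "M *v w" x] inverse_form_2[OF sym det, of x 0]
            form_value_def del: of_int_sum)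
      then show "h v = \<one>"
        using h_eq_one_iff by blast
    qed
    finally show "v \<in> kernel ?V G h \<longleftrightarrow> v \<in> ?K" .
  qed
  define \<theta> where "\<theta> = (\<lambda>X. the_elem (h ` X))"
  have "h ` carrier ?V = carrier G"
    using closed surj by (fastforce simp: int_vec_group_def)
  then have \<theta>: "\<theta> \<in> iso (cokernel M) G"
    using h.FactGroup_iso_set unfolding kernel \<theta>_def cokernel_def by blast
  have "group (cokernel M)"
    using normal.factorgroup_is_group[OF h.normal_kernel] unfolding kernel cokernel_def .
  then have inv: "inv_into (carrier (cokernel M)) \<theta> \<in> iso G (cokernel M)"
    using group.iso_set_sym \<theta> by blast
  have \<theta>_c: "\<theta> (?c v) = h v" for v
  proof -
    have "h (k + v) = h v" if "k \<in> ?K" for k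
    proof -
      have "h k = \<one>"
        using that unfolding kernel[symmetric] by (simp add: kernel_def)
      then show ?thesis
        using closed by (simp add: add)
    qed
    then have "(\<lambda>k. h (k + v)) ` ?K = (\<lambda>_. h v) ` ?K"
      by (rule image_cong[OF refl])
    moreover have "?c v = (\<lambda>k. k + v) ` ?K"
      by (auto simp: r_coset_def int_vec_group_def)
    ultimately have "h ` ?c v = {h v}"
      by (simp add: image_image image_constant_conv)
    then show ?thesis
      by (simp add: \<theta>_def)
  qed
  have c_closed: "?c v \<in> carrier (cokernel M)" for v
    unfolding cokernel_def carrier_FactGroup by (simp add: int_vec_group_def)
  have inj: "inj_on \<theta> (carrier (cokernel M))"
    using \<theta> by (simp add: iso_def bij_betw_def)
  have inv_c: "inv_into (carrier (cokernel M)) \<theta> (h v) = ?c v" for v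
    using inv_into_f_f[OF inj c_closed[of v]] unfolding \<theta>_c .
  have "isometric_pairings G l (cokernel M) (matrix_pairing M)"
    unfolding isometric_pairings_def
  proof (rule bexI[OF _ inv], intro ballI)
    fix x y assume "x \<in> carrier G" "y \<in> carrier G"
    then obtain v w where "h v = x" "h w = y"
      using surj by blast
    then show "matrix_pairing M (inv_into (carrier (cokernel M)) \<theta> x) (inv_into (carrier (cokernel M)) \<theta> y) = l x y"
      using inv_c matrix_pairing_coset[OF sym det] pair by metis
  qed
  then show ?thesis
    using sym det by (simp add: presents_def)
qed

lemma presentation_of_conditions:
  assumes dec: "orthogonal_cyclic_decomposition G l g1 q1 g2 q2"
    and num: "self_pairing_numerators l g1 q1 g2 q2 a1 a2"
    and u: "u \<in> {-1, 1}"
    and B: "condition_B a1 a2 q1 q2 u"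
  shows "\<exists>M :: int ^ 2 ^ 2. presents M G l \<and> odd_matrix M \<and> [det M = u] (mod 4)"
proof -
  have g: "g1 \<in> carrier G" "g2 \<in> carrier G" "0 < q1" "0 < q2" "odd q1" "odd q2" "q1 dvd q2"
    "ord g1 = q1" "ord g2 = q2"
    using dec by (auto simp: orthogonal_cyclic_decomposition_def)
  have cop: "coprime a1 (int q1)" "coprime a2 (int q2)"
    using decomposition_coprime[OF dec num] by auto
  define n where "n = q2 div q1"
  have q2: "q2 = q1 * n" using g(7) by (simp add: n_def)
  have "0 < n" using g q2 by (cases n) auto
  have "n dvd q2" unfolding q2 by simp
  have "odd (q1 * q2)" using g by simp
  obtain eps :: int where eps: "eps \<in> {-1, 1}" and eps_u: "[eps * int (q1 * q2) = u] (mod 4)"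
  proof -
    have dvd: "4 dvd Q - u \<or> 4 dvd - Q - u" if "odd Q" for Q :: int
      using u that by (elim insertE emptyE) (hypsubst, presburger)+
    have "4 dvd int (q1 * q2) - u \<or> 4 dvd - int (q1 * q2) - u"
      by (rule dvd) (use \<open>odd (q1 * q2)\<close> in simp)
    then have "[int (q1 * q2) = u] (mod 4) \<or> [- int (q1 * q2) = u] (mod 4)"
      unfolding cong_iff_dvd_diff .
    then show ?thesis
      using that[of 1] that[of "-1"] by auto
  qed
  have eps_sq: "eps * eps = 1" using eps by auto
  have res: "QuadRes (int q1) (eps * a1 * a2)"
    using B sign_exponent[OF \<open>odd (q1 * q2)\<close> u eps eps_u] by (simp add: condition_B_def condition_B1_def)
  have n_mod: "q1 * q2 mod 4 = n mod 4"
    using odd_square_mult_mod_4[OF g(5), of n] unfolding q2 .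
  have cond: "eps = 1 \<or> n mod 4 = 3 \<or> Jacobi a2 n = 1"
  proof (rule ccontr)
    assume neg: "\<not> ?thesis"
    then have "eps = -1" using eps by auto
    have "odd n" using \<open>n dvd q2\<close> g(6) by (metis dvd_trans)
    then have q_mod: "q1 * q2 mod 4 = 1"
      unfolding n_mod using neg by presburger
    then have "u \<noteq> 1"
    proof -
      have "int (q1 * q2) mod 4 = 1"
        using q_mod by (metis of_nat_1 of_nat_numeral zmod_int)
      then show ?thesis
        using eps_u \<open>eps = -1\<close> by (auto simp: cong_def zmod_zminus1_eq_if simp del: of_nat_mult)
    qed
    then show False
      using B neg q_mod by (auto simp: condition_B_def condition_B2_def n_def cong_def)
  qed
  obtain r b c k where r: "odd r" and det: "r * c - b\<^sup>2 = eps * int n"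
    and k: "[a2 * k\<^sup>2 * r = eps] (mod int q2)"
    using exists_representing_coefficient[OF g(6) \<open>n dvd q2\<close> cop(2) eps cond] .
  have cop_kr: "coprime (a2 * k\<^sup>2 * r) (int q2)"
  proof -
    have "coprime eps (int q2)" using eps by auto
    then show ?thesis using k cong_imp_coprime cong_sym by blast
  qed
  then have cop_r: "coprime r (int q2)" and cop_k: "coprime k (int q2)"
    by auto
  \<comment> \<open>the multiplier \<open>\<tau>\<close> of the first generator satisfies \<open>a1 * \<tau>\<^sup>2 * r = 1\<close> modulo \<open>q1\<close>\<close>
  obtain \<tau> where \<tau>: "[a1 * \<tau>\<^sup>2 * r = 1] (mod int q1)"
  proof -
    obtain s where s: "[s\<^sup>2 = eps * a1 * a2] (mod int q1)"
      using res by (auto simp: QuadRes_def)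
    have "coprime a2 (int q1)"
      using cop(2) g(7) coprime_divisors[of a2 a2 "int q1" "int q2"] by simp
    then have "coprime (eps * a1 * a2) (int q1)"
      using cop(1) eps by auto
    then have "coprime (s\<^sup>2) (int q1)"
      using s cong_imp_coprime cong_sym by blast
    then have "coprime s (int q1)" by simp
    then obtain s' where s': "[s * s' = 1] (mod int q1)"
      using cong_solve_coprime_int by blast
    have k1: "[a2 * k\<^sup>2 * r = eps] (mod int q1)"
      using k g(7) by (meson cong_dvd_modulus of_nat_dvd_iff)
    have "a1 * (a2 * k * s')\<^sup>2 * r = a1 * a2 * s'\<^sup>2 * (a2 * k\<^sup>2 * r)"
      by (simp add: power2_eq_square algebra_simps)
    also have "[\<dots> = a1 * a2 * s'\<^sup>2 * eps] (mod int q1)"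
      by (rule cong_mult[OF cong_refl k1])
    also have "a1 * a2 * s'\<^sup>2 * eps = (eps * a1 * a2) * s'\<^sup>2"
      by simp
    also have "[\<dots> = s\<^sup>2 * s'\<^sup>2] (mod int q1)"
      by (rule cong_mult[OF cong_sym[OF s] cong_refl])
    also have "s\<^sup>2 * s'\<^sup>2 = (s * s')\<^sup>2"
      by (simp add: power_mult_distrib)
    also have "[\<dots> = 1\<^sup>2] (mod int q1)"
      by (rule cong_pow[OF s'])
    finally show ?thesis
      using that[of "a2 * k * s'"] by simp
  qed
  define M :: "int ^ 2 ^ 2" where
    "M = vector [vector [int q1 * c, - (int q1 * b)], vector [- (int q1 * b), int q1 * r]]"
  have M: "M $ 1 $ 1 = int q1 * c" "M $ 1 $ 2 = - (int q1 * b)" "M $ 2 $ 1 = - (int q1 * b)" "M $ 2 $ 2 = int q1 * r"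
    by (simp_all add: M_def vector_2)
  have sym: "transpose M = M"
    by (simp add: vec_eq_iff forall_2 transpose_def M)
  have det_M: "det M = eps * int (q1 * q2)"
  proof -
    have "det M = int q1 * int q1 * (r * c - b\<^sup>2)"
      by (simp add: det_2 M power2_eq_square algebra_simps)
    then show ?thesis
      unfolding det by (simp add: q2)
  qed
  then have det_nz: "det M \<noteq> 0"
    using eps g by auto
  define h :: "int ^ 2 \<Rightarrow> 'a" where
    "h v = g1 [^] (\<tau> * v $ 2) \<otimes> g2 [^] (k * (r * v $ 1 + b * v $ 2))" for v
  have "presents M G l"
  proof (rule presents_of_surjection[OF sym det_nz])
    show "h v \<in> carrier G" for v
      using g by (simp add: h_def)
    show "h (v + w) = h v \<otimes> h w" for v w
      unfolding h_def int_pow_combination_mult[OF g(1,2)] by (simp add: algebra_simps)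
    show "\<exists>v. h v = x" if x: "x \<in> carrier G" for x
    proof -
      obtain i j :: int where ij: "x = g1 [^] i \<otimes> g2 [^] j"
        using decomposition_elements[OF dec x] .
      have "coprime (a1 * \<tau>\<^sup>2 * r) (int q1)"
        using \<tau> cong_imp_coprime cong_sym coprime_1_left by blast
      then have "coprime \<tau> (int q1)" by simp
      then obtain \<tau>' where \<tau>': "[\<tau> * \<tau>' = 1] (mod int q1)"
        using cong_solve_coprime_int by blast
      have "coprime (k * r) (int q2)" using cop_k cop_r by simp
      then obtain z where z: "[k * r * z = 1] (mod int q2)"
        using cong_solve_coprime_int by blast
      define v2 where "v2 = \<tau>' * i"
      define v1 where "v1 = z * (j - k * b * v2)"
      have "[\<tau> * v2 = i] (mod int q1)"
        using cong_mult[OF \<tau>' cong_refl[of i]] by (simp add: v2_def mult.assoc)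
      then have 1: "g1 [^] (\<tau> * v2) = g1 [^] i"
        unfolding int_pow_eq[OF g(1)] g(8) by (simp add: cong_iff_dvd_diff dvd_diff_commute)
      have "[k * r * z * (j - k * b * v2) + k * b * v2 = 1 * (j - k * b * v2) + k * b * v2] (mod int q2)"
        by (intro cong_add cong_mult z cong_refl)
      moreover have "k * (r * v1 + b * v2) = k * r * z * (j - k * b * v2) + k * b * v2"
        by (simp add: v1_def algebra_simps)
      ultimately have "[k * (r * v1 + b * v2) = j] (mod int q2)"
        by simp
      then have 2: "g2 [^] (k * (r * v1 + b * v2)) = g2 [^] j"
        unfolding int_pow_eq[OF g(2)] g(9) by (simp add: cong_iff_dvd_diff dvd_diff_commute)
      have "h (vector [v1, v2]) = x"
        unfolding h_def ij by (simp add: vector_2 1 2)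
      then show ?thesis by blast
    qed
    show "l (h v) (h w) = rat_class (inverse_form M v w)" for v w
    proof -
      define f where "f = r * v $ 1 * w $ 1 + b * (v $ 1 * w $ 2 + v $ 2 * w $ 1) + c * v $ 2 * w $ 2"
      define V where "V = r * v $ 1 + b * v $ 2"
      define W where "W = r * w $ 1 + b * w $ 2"
      define S where "S = int n * (a1 * \<tau>\<^sup>2) * (v $ 2 * w $ 2) + a2 * k\<^sup>2 * (V * W)"
      have "l (h v) (h w) = rat_class (of_int S / of_int (int q2))"
      proof -
        have "(of_int a1 / of_nat q1 :: rat) = of_int (int n * a1) / of_int (int q2)"
          using \<open>0 < n\<close> g unfolding q2 by simp
        then have "(of_int ((\<tau> * v $ 2) * (\<tau> * w $ 2)) * (of_int a1 / of_nat q1)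
            + of_int ((k * V) * (k * W)) * (of_int a2 / of_nat q2) :: rat) = of_int S / of_int (int q2)"
          by (simp add: S_def power2_eq_square algebra_simps flip: add_divide_distrib)
        then show ?thesis
          unfolding h_def decomposition_pair[OF dec num] V_def W_def by simp
      qed
      moreover have "inverse_form M v w = of_int (eps * f) / of_int (int q2)"
      proof -
        have "form_value (M $ 1 $ 1) (M $ 1 $ 2) (M $ 2 $ 2) (v $ 1) (v $ 2) (w $ 1) (w $ 2) = int q1 * f"
          by (simp add: M form_value_def f_def algebra_simps)
        moreover have "(of_int (int q1 * f) / of_int (eps * int (q1 * q2)) :: rat) = of_int (eps * f) / of_int (int q2)"
          using eps g(3) by auto
        ultimately show ?thesis
          unfolding inverse_form_2[OF sym det_nz] det_M by simp
      qed
      moreover have "[S = eps * f] (mod int q2)"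
      proof -
        have "[int n * (a1 * \<tau>\<^sup>2 * r) = int n * 1] (mod (int n * int q1))"
          using \<tau> by (rule cong_cmult_leftI)
        then have 1: "[int n * (a1 * \<tau>\<^sup>2 * r) * (v $ 2 * w $ 2) = int n * (v $ 2 * w $ 2)] (mod int q2)"
          using cong_mult[OF _ cong_refl[of "v $ 2 * w $ 2"]] by (fastforce simp: q2 mult.commute)
        have 2: "[a2 * k\<^sup>2 * r * (V * W) = eps * (V * W)] (mod int q2)"
          by (rule cong_mult[OF k cong_refl])
        have "r * S = int n * (a1 * \<tau>\<^sup>2 * r) * (v $ 2 * w $ 2) + a2 * k\<^sup>2 * r * (V * W)"
          by (simp add: S_def algebra_simps)
        also have "[\<dots> = int n * (v $ 2 * w $ 2) + eps * (V * W)] (mod int q2)"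
          by (rule cong_add[OF 1 2])
        also have "int n * (v $ 2 * w $ 2) + eps * (V * W) = r * (eps * f)"
        proof -
          have "r * f = V * W + (r * c - b\<^sup>2) * (v $ 2 * w $ 2)"
            by (simp add: f_def V_def W_def power2_eq_square algebra_simps)
          then have "eps * (r * f) = eps * (V * W) + (eps * eps) * (int n * (v $ 2 * w $ 2))"
            unfolding det by (simp add: algebra_simps)
          then show ?thesis
            by (simp add: eps_sq algebra_simps)
        qed
        finally show ?thesis
          using cop_r by (simp add: cong_mult_lcancel)
      qed
      ultimately show ?thesis
        using divide_diff_in_Ints_iff[of "int q2" S "eps * f"] g(4) by (simp add: rat_class_eq_iff)
    qed
  qed
  moreover have "odd_matrix M"
    unfolding odd_matrix_def using M(4) r g(5) by (intro exI[of _ 2]) simp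
  ultimately show ?thesis
    using eps_u det_M by auto
qed

end

theorem proposition1p12:
  fixes G :: "('a, 'm) monoid_scheme"
    and l :: "'a \<Rightarrow> 'a \<Rightarrow> rat_mod_int"
  assumes "comm_group G"
    and "odd (order G)"
    and "\<exists>S \<subseteq> carrier G. finite S \<and> card S \<le> 2 \<and> generate G S = carrier G"
    and "bilinear_pairing G l"
    and "symmetric_pairing G l"
    and "nondegenerate_pairing G l"
  shows
    "(\<exists>g1 q1 g2 q2. orthogonal_cyclic_decomposition G l g1 q1 g2 q2) \<and>
     (\<forall>g1 q1 g2 q2. orthogonal_cyclic_decomposition G l g1 q1 g2 q2 \<longrightarrow>
        (\<exists>a1 a2 b1 b2.
            self_pairing_numerators l g1 q1 g2 q2 a1 a2 \<and>
            self_pairing_numerators l g1 q1 g2 q2 b1 b2 \<and> a1 \<noteq> b1 \<and> a2 \<noteq> b2) \<and>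
        (\<forall>a1 a2. self_pairing_numerators l g1 q1 g2 q2 a1 a2 \<longrightarrow>
            coprime a1 (int q1) \<and> coprime a2 (int q2) \<and>
            (\<forall>u\<in>{-1, 1}.
               (\<exists>M :: int ^ 2 ^ 2. presents M G l \<and> odd_matrix M \<and> [det M = u] (mod 4)) \<longleftrightarrow>
               condition_B a1 a2 q1 q2 u)) \<and>
        (\<forall>h1 h2 a1 a2 b1 b2.
            orthogonal_cyclic_decomposition G l h1 q1 h2 q2 \<and>
            self_pairing_numerators l g1 q1 g2 q2 a1 a2 \<and>
            self_pairing_numerators l h1 q1 h2 q2 b1 b2 \<longrightarrow>
            (\<forall>u\<in>{-1, 1}. condition_B a1 a2 q1 q2 u \<longleftrightarrow> condition_B b1 b2 q1 q2 u)))"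
proof -
  interpret linking_pairing G l
    using assms by (simp add: linking_pairing_def linking_pairing_axioms_def)
  obtain S where S: "S \<subseteq> carrier G" "finite S" "card S \<le> 2" "generate G S = carrier G"
    using assms(3) by blast
  \<comment> \<open>the left-hand side does not mention a decomposition, so the right-hand side is the same for all of them\<close>
  have iff: "(\<exists>M :: int ^ 2 ^ 2. presents M G l \<and> odd_matrix M \<and> [det M = u] (mod 4)) \<longleftrightarrow>
      condition_B a1 a2 q1 q2 u"
    if "orthogonal_cyclic_decomposition G l g1 q1 g2 q2" "self_pairing_numerators l g1 q1 g2 q2 a1 a2"
      "u \<in> {-1, 1}" for g1 q1 g2 q2 a1 a2 u
    using conditions_of_presentation[OF that] presentation_of_conditions[OF that] by blast
  show ?thesis
    by (intro conjI allI impI ballI exists_orthogonal_decomposition[OF assms(2) S])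
      (blast intro: exists_two_numerators decomposition_coprime iff[symmetric] | metis iff)+
qed

end
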